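(* Let $\theta,\gamma,\omega,\nu,\beta$ be real with $\theta\neq0$, $\beta>0$, $\beta-\nu^2\neq0$, and let $q=\gamma+\frac{\nu(\gamma\nu-1)}{2(\beta-\nu^2)}$. For any $k\in\mathbb{R}$, any $l,s\in\mathbb{R}$ with $\min\{l,s\}<-\tfrac12$ and any $T>0$, the data-to-solution map $(B_0,\psi_{10},\psi_{20})\mapsto(B,\psi_1,\psi_2)$ associated to the Zakharov-Rubenchik system $$\begin{cases} i\partial_t B + \omega\partial_x^2 B = \gamma\left(\sqrt{\beta}-\frac{\nu}{2}\right)\psi_1 B - \gamma\left(\sqrt{\beta}+\frac{\nu}{2}\right)\psi_2 B + \gamma q|B|^2 B,\\ \theta\partial_{t}\psi_1 + (\sqrt{\beta}-\nu)\partial_{x}\psi_1 = \frac{\gamma}{2}\left(-1+\frac{\nu}{2\sqrt{\beta}}\right)\partial_{x}(|B|^2),\\ \theta\partial_t\psi_2 - (\nu+\sqrt{\beta})\partial_x\psi_2 = \frac{\gamma}{2}\left(-1-\frac{\nu}{2\sqrt{\beta}}\right)\partial_x(|B|^2), \end{cases}\qquad x\in\mathbb{R},$$ from $H^k(\mathbb{R})\times H^l(\mathbb{R})\times H^s(\mathbb{R})$ to $C([0,T];H^k(\mathbb{R})\times H^l(\mathbb{R})\times H^s(\mathbb{R}))$ is not $C^2$ at the origin $(0,0,0)$.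
   Context: $B$ is complex-valued; $\psi_1,\psi_2$ are real-valued; $(B,\psi_1,\psi_2)|_{t=0}=(B_0,\psi_{10},\psi_{20})$. $H^s(\mathbb{R})$ is the usual $L^2$-based Sobolev space. Solutions are understood as solutions of the integral (Duhamel) form of the system.
   Formalization: Added hypothesis: l<-1/2 with γ(√β-ν/2)≠0, or s<-1/2 with γ(√β+ν/2)≠0; without it the claim fails (γ=0 gives a bounded linear map; at ν=2√β the component ψ1 decouples, so l is irrelevant, and likewise ψ2 and s at ν=-2√β). *)

theory Defs
  imports "HOL-Analysis.Analysis" "HOL-Library.Function_Algebras"
begin

section \<open>Function spaces as real vector spaces\<close>

instantiation "fun" :: (type, real_vector) real_vector
begin

definition scaleR_fun :: "real \<Rightarrow> ('a \<Rightarrow> 'b) \<Rightarrow> 'a \<Rightarrow> 'b"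
  where "scaleR_fun c f = (\<lambda>x. c *\<^sub>R f x)"

instance
  by standard (simp_all add: scaleR_fun_def fun_eq_iff algebra_simps)

end

section \<open>Normed spaces on carriers and twice continuous differentiability\<close>

text \<open>The Sobolev exponents are real variables of the statement, so the spaces involved cannot be
  types. A normed space is a subspace \<open>vecs\<close> of an ambient real vector space, with a norm \<open>nrm\<close>
  whose values outside \<open>vecs\<close> are irrelevant.\<close>

record 'a nvs =
  vecs :: "'a set"
  nrm :: "'a \<Rightarrow> real"

text \<open>Bounded real-linear operators with the operator norm. Operators vanish outside the domain
  space, so that equality of operators is equality of functions.\<close>

definition bounded_ops :: "'a::real_vector nvs \<Rightarrow> 'b::real_vector nvs \<Rightarrow> ('a \<Rightarrow> 'b) nvs" where
  "bounded_ops X Y = \<lparr>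
     vecs = {A. (\<forall>x. x \<notin> vecs X \<longrightarrow> A x = 0) \<and>
       (\<forall>x\<in>vecs X. A x \<in> vecs Y) \<and>
       (\<forall>x\<in>vecs X. \<forall>y\<in>vecs X. A (x + y) = A x + A y) \<and>
       (\<forall>c. \<forall>x\<in>vecs X. A (c *\<^sub>R x) = c *\<^sub>R A x) \<and>
       (\<exists>C. \<forall>x\<in>vecs X. nrm Y (A x) \<le> C * nrm X x)},
     nrm = (\<lambda>A. Inf {C. 0 \<le> C \<and> (\<forall>x\<in>vecs X. nrm Y (A x) \<le> C * nrm X x)})\<rparr>"

definition has_frechet_deriv ::
    "'a::real_vector nvs \<Rightarrow> 'b::real_vector nvs \<Rightarrow> ('a \<Rightarrow> 'b) \<Rightarrow> ('a \<Rightarrow> 'b) \<Rightarrow> 'a \<Rightarrow> bool" where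
  "has_frechet_deriv X Y f A x \<longleftrightarrow>
     A \<in> vecs (bounded_ops X Y) \<and>
     (\<forall>e>0. \<exists>d>0. \<forall>h\<in>vecs X. nrm X h < d \<longrightarrow>
        nrm Y (f (x + h) - f x - A h) \<le> e * nrm X h)"

text \<open>Twice Frechet differentiable near \<open>x\<close>, with second derivative continuous at \<open>x\<close>. Continuity
  of the second derivative is asked for at \<open>x\<close> only, so the negation below also refutes being of
  class C2 on some neighbourhood of \<open>x\<close>.\<close>

definition C2_at ::
    "'a::real_vector nvs \<Rightarrow> 'b::real_vector nvs \<Rightarrow> ('a \<Rightarrow> 'b) \<Rightarrow> 'a \<Rightarrow> bool" where
  "C2_at X Y f x \<longleftrightarrow>
     (\<exists>r>0. \<exists>f' f''.
        (\<forall>y\<in>vecs X. nrm X (y - x) < r \<longrightarrow>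
           f y \<in> vecs Y \<and>
           has_frechet_deriv X Y f (f' y) y \<and>
           has_frechet_deriv X (bounded_ops X Y) f' (f'' y) y) \<and>
        (\<forall>e>0. \<exists>d>0. \<forall>y\<in>vecs X. nrm X (y - x) < d \<longrightarrow>
           nrm (bounded_ops X (bounded_ops X Y)) (f'' y - f'' x) < e))"

text \<open>\<open>C([0,T];X)\<close> with the supremum norm; curves are extended by 0 outside \<open>[0,T]\<close>.\<close>

definition curve_space :: "real \<Rightarrow> 'a::real_vector nvs \<Rightarrow> (real \<Rightarrow> 'a) nvs" where
  "curve_space T X = \<lparr>
     vecs = {u. (\<forall>t. t \<notin> {0..T} \<longrightarrow> u t = 0) \<and> (\<forall>t\<in>{0..T}. u t \<in> vecs X) \<and>
       (\<forall>t\<in>{0..T}. \<forall>e>0. \<exists>d>0. \<forall>t'\<in>{0..T}. \<bar>t' - t\<bar> < d \<longrightarrow> nrm X (u t' - u t) < e)},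
     nrm = (\<lambda>u. SUP t\<in>{0..T}. nrm X (u t))\<rparr>"

definition prod_space ::
    "'a::real_vector nvs \<Rightarrow> 'b::real_vector nvs \<Rightarrow> ('a \<times> 'b) nvs" where
  "prod_space X Y = \<lparr>
     vecs = vecs X \<times> vecs Y,
     nrm = (\<lambda>(x, y). sqrt ((nrm X x)\<^sup>2 + (nrm Y y)\<^sup>2))\<rparr>"

section \<open>Tempered distributions on the line\<close>

definition vderiv :: "(real \<Rightarrow> complex) \<Rightarrow> real \<Rightarrow> complex" where
  "vderiv f = (\<lambda>x. vector_derivative f (at x))"

definition schwartz :: "(real \<Rightarrow> complex) \<Rightarrow> bool" where
  "schwartz f \<longleftrightarrow>
     (\<forall>n. (\<forall>x. (vderiv ^^ n) f differentiable (at x)) \<and>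
          (\<forall>m. bounded (range (\<lambda>x. x ^ m *\<^sub>R (vderiv ^^ n) f x))))"

definition schwartz_seminorm :: "nat \<Rightarrow> nat \<Rightarrow> (real \<Rightarrow> complex) \<Rightarrow> real" where
  "schwartz_seminorm m n f = (SUP x. norm (x ^ m *\<^sub>R (vderiv ^^ n) f x))"

text \<open>A distribution is a functional on all functions that vanishes off the Schwartz space, so
  that equality of distributions is equality of functions. The pairing is bilinear.\<close>

type_synonym distr = "(real \<Rightarrow> complex) \<Rightarrow> complex"

definition tempered :: "distr \<Rightarrow> bool" where
  "tempered u \<longleftrightarrow>
     (\<forall>\<phi>. \<not> schwartz \<phi> \<longrightarrow> u \<phi> = 0) \<and>
     (\<forall>\<phi> \<eta>. schwartz \<phi> \<longrightarrow> schwartz \<eta> \<longrightarrow> u (\<lambda>x. \<phi> x + \<eta> x) = u \<phi> + u \<eta>) \<and>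
     (\<forall>c \<phi>. schwartz \<phi> \<longrightarrow> u (\<lambda>x. c * \<phi> x) = c * u \<phi>) \<and>
     (\<exists>C N. \<forall>\<phi>. schwartz \<phi> \<longrightarrow>
        norm (u \<phi>) \<le> C * (\<Sum>m\<le>N. \<Sum>n\<le>N. schwartz_seminorm m n \<phi>))"

definition real_distr :: "distr \<Rightarrow> bool" where
  "real_distr u \<longleftrightarrow> (\<forall>\<phi>. u (\<lambda>x. cnj (\<phi> x)) = cnj (u \<phi>))"

definition regular_distr :: "(real \<Rightarrow> complex) \<Rightarrow> distr" where
  "regular_distr f = (\<lambda>\<phi>. if schwartz \<phi> then (\<integral>x. f x * \<phi> x \<partial>lborel) else 0)"

definition distr_deriv :: "distr \<Rightarrow> distr" where
  "distr_deriv u = (\<lambda>\<phi>. if schwartz \<phi> then - u (vderiv \<phi>) else 0)"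

definition fourier :: "(real \<Rightarrow> complex) \<Rightarrow> real \<Rightarrow> complex" where
  "fourier \<phi> = (\<lambda>\<xi>. \<integral>x. cis (- (x * \<xi>)) * \<phi> x \<partial>lborel)"

definition inv_fourier :: "(real \<Rightarrow> complex) \<Rightarrow> real \<Rightarrow> complex" where
  "inv_fourier \<phi> = (\<lambda>x. (\<integral>\<xi>. cis (x * \<xi>) * \<phi> \<xi> \<partial>lborel) / of_real (2 * pi))"

text \<open>The Fourier multiplier \<open>m(D)\<close> on tempered distributions, for smooth \<open>m\<close> of which all
  derivatives are polynomially bounded: \<open>\<langle>m(D)u, \<phi>\<rangle> = \<langle>m \<F>u, \<F>\<^sup>-\<^sup>1\<phi>\<rangle> = \<langle>u, \<F>(m \<F>\<^sup>-\<^sup>1\<phi>)\<rangle>\<close>.\<close>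

definition fourier_multiplier :: "(real \<Rightarrow> complex) \<Rightarrow> distr \<Rightarrow> distr" where
  "fourier_multiplier m u =
     (\<lambda>\<phi>. if schwartz \<phi> then u (fourier (\<lambda>\<xi>. m \<xi> * inv_fourier \<phi> \<xi>)) else 0)"

section \<open>Sobolev spaces\<close>

text \<open>The Fourier transform of \<open>u\<close>, which is \<open>\<phi> \<mapsto> u (\<F>\<phi>)\<close>, is the function \<open>g\<close>.\<close>

definition fourier_density :: "distr \<Rightarrow> (real \<Rightarrow> complex) \<Rightarrow> bool" where
  "fourier_density u g \<longleftrightarrow>
     g \<in> borel_measurable lborel \<and>
     (\<forall>\<phi>. schwartz \<phi> \<longrightarrow>
        integrable lborel (\<lambda>\<xi>. g \<xi> * \<phi> \<xi>) \<and> u (fourier \<phi>) = (\<integral>\<xi>. g \<xi> * \<phi> \<xi> \<partial>lborel))"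

text \<open>The density is unique almost everywhere, so the choice in the norm is immaterial.\<close>

definition sobolev :: "real \<Rightarrow> distr nvs" where
  "sobolev s = \<lparr>
     vecs = {u. tempered u \<and> (\<exists>g. fourier_density u g \<and>
       integrable lborel (\<lambda>\<xi>. (1 + \<xi>\<^sup>2) powr s * (cmod (g \<xi>))\<^sup>2))},
     nrm = (\<lambda>u. let g = (SOME g. fourier_density u g)
       in sqrt (\<integral>\<xi>. (1 + \<xi>\<^sup>2) powr s * (cmod (g \<xi>))\<^sup>2 \<partial>lborel))\<rparr>"

definition real_sobolev :: "real \<Rightarrow> distr nvs" where
  "real_sobolev s = \<lparr>vecs = {u \<in> vecs (sobolev s). real_distr u}, nrm = nrm (sobolev s)\<rparr>"

text \<open>\<open>H\<^sup>k \<times> H\<^sup>l \<times> H\<^sup>s\<close>, first component complex-valued, the others real-valued; a real normed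
  space, as \<open>B \<mapsto> \<bar>B\<bar>\<^sup>2\<close> is only real differentiable.\<close>

definition zr_space :: "real \<Rightarrow> real \<Rightarrow> real \<Rightarrow> (distr \<times> distr \<times> distr) nvs" where
  "zr_space k l s = prod_space (sobolev k) (prod_space (real_sobolev l) (real_sobolev s))"

section \<open>The Zakharov-Rubenchik system\<close>

text \<open>\<open>u(t) = U(t) u\<^sub>0 + \<integral>\<^sub>0\<^sup>t U(t - \<tau>) F(\<tau>) d\<tau>\<close> on \<open>[0,T]\<close>, for the group \<open>U\<close> with symbol \<open>m\<close>; the
  integral is taken in the weak sense, test function by test function.\<close>

definition duhamel ::
    "(real \<Rightarrow> real \<Rightarrow> complex) \<Rightarrow> (real \<Rightarrow> distr) \<Rightarrow> real \<Rightarrow> distr \<Rightarrow> (real \<Rightarrow> distr) \<Rightarrow> bool" where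
  "duhamel m F T u0 u \<longleftrightarrow>
     (\<forall>t\<in>{0..T}. \<forall>\<phi>. schwartz \<phi> \<longrightarrow>
        u t \<phi> = fourier_multiplier (m t) u0 \<phi> +
          integral {0..t} (\<lambda>\<tau>. fourier_multiplier (m (t - \<tau>)) (F \<tau>) \<phi>))"

text \<open>Symbols of \<open>exp(i t \<omega> \<partial>\<^sub>x\<^sup>2)\<close> and of \<open>exp(- t v \<partial>\<^sub>x)\<close>, translation by \<open>t v\<close>.\<close>

definition schroedinger_symbol :: "real \<Rightarrow> real \<Rightarrow> real \<Rightarrow> complex" where
  "schroedinger_symbol \<omega> t \<xi> = cis (- (t * \<omega> * \<xi>\<^sup>2))"

definition transport_symbol :: "real \<Rightarrow> real \<Rightarrow> real \<Rightarrow> complex" where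
  "transport_symbol v t \<xi> = cis (- (t * v * \<xi>))"

definition bounded_continuous :: "(real \<Rightarrow> 'a::real_normed_vector) \<Rightarrow> bool" where
  "bounded_continuous f \<longleftrightarrow> continuous_on UNIV f \<and> bounded (range f)"

text \<open>Smooth (\<open>H\<^sup>\<infinity>\<close>-valued) solutions of the Duhamel form on \<open>[0,T]\<close> with data \<open>u0\<close>. The components
  are functions \<open>B\<close>, \<open>\<psi>1\<close>, \<open>\<psi>2\<close>, which gives the products their pointwise meaning. The two
  transport equations are divided by \<open>\<theta>\<close>.\<close>

definition smooth_zr_solution ::
    "real \<Rightarrow> real \<Rightarrow> real \<Rightarrow> real \<Rightarrow> real \<Rightarrow> real \<Rightarrow> real \<Rightarrow>
     distr \<times> distr \<times> distr \<Rightarrow> (real \<Rightarrow> distr \<times> distr \<times> distr) \<Rightarrow> bool" where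
  "smooth_zr_solution \<theta> \<gamma> \<omega> \<nu> \<beta> q T u0 u \<longleftrightarrow>
     (\<forall>\<sigma>. u \<in> vecs (curve_space T (zr_space \<sigma> \<sigma> \<sigma>))) \<and>
     (\<exists>(B :: real \<Rightarrow> real \<Rightarrow> complex) (\<psi>1 :: real \<Rightarrow> real \<Rightarrow> real) (\<psi>2 :: real \<Rightarrow> real \<Rightarrow> real).
        (\<forall>t\<in>{0..T}.
           bounded_continuous (B t) \<and> bounded_continuous (\<psi>1 t) \<and> bounded_continuous (\<psi>2 t) \<and>
           u t = (regular_distr (B t), regular_distr (\<lambda>x. of_real (\<psi>1 t x)),
                  regular_distr (\<lambda>x. of_real (\<psi>2 t x)))) \<and>
        duhamel (schroedinger_symbol \<omega>)
          (\<lambda>t. regular_distr (\<lambda>x. - \<i> *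
             (of_real (\<gamma> * (sqrt \<beta> - \<nu> / 2) * \<psi>1 t x) * B t x
              - of_real (\<gamma> * (sqrt \<beta> + \<nu> / 2) * \<psi>2 t x) * B t x
              + of_real (\<gamma> * q * (cmod (B t x))\<^sup>2) * B t x)))
          T (fst u0) (\<lambda>t. fst (u t)) \<and>
        duhamel (transport_symbol ((sqrt \<beta> - \<nu>) / \<theta>))
          (\<lambda>t. (\<gamma> / 2 * (- 1 + \<nu> / (2 * sqrt \<beta>)) / \<theta>) *\<^sub>R
             distr_deriv (regular_distr (\<lambda>x. of_real ((cmod (B t x))\<^sup>2))))
          T (fst (snd u0)) (\<lambda>t. fst (snd (u t))) \<and>
        duhamel (transport_symbol (- (\<nu> + sqrt \<beta>) / \<theta>))
          (\<lambda>t. (\<gamma> / 2 * (- 1 - \<nu> / (2 * sqrt \<beta>)) / \<theta>) *\<^sub>R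
             distr_deriv (regular_distr (\<lambda>x. of_real ((cmod (B t x))\<^sup>2))))
          T (snd (snd u0)) (\<lambda>t. snd (snd (u t))))"

text \<open>At low regularity the products in the system have no intrinsic meaning, so a data-to-solution
  map is any map from a neighbourhood of the origin of \<open>H\<^sup>k \<times> H\<^sup>l \<times> H\<^sup>s\<close> to \<open>C([0,T]; H\<^sup>k \<times> H\<^sup>l \<times> H\<^sup>s)\<close>
  that extends the classical one: data with a smooth solution on \<open>[0,T]\<close> are mapped to that
  solution. Nothing is assumed at other data, and no existence theory is presupposed.\<close>

definition data_to_solution_map ::
    "real \<Rightarrow> real \<Rightarrow> real \<Rightarrow> real \<Rightarrow> real \<Rightarrow> real \<Rightarrow> real \<Rightarrow> real \<Rightarrow> real \<Rightarrow> real \<Rightarrow>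
     (distr \<times> distr \<times> distr \<Rightarrow> real \<Rightarrow> distr \<times> distr \<times> distr) \<Rightarrow> bool" where
  "data_to_solution_map \<theta> \<gamma> \<omega> \<nu> \<beta> q k l s T \<Phi> \<longleftrightarrow>
     (\<exists>r>0. \<forall>u0\<in>vecs (zr_space k l s). nrm (zr_space k l s) u0 < r \<longrightarrow>
        \<Phi> u0 \<in> vecs (curve_space T (zr_space k l s)) \<and>
        (\<forall>u. smooth_zr_solution \<theta> \<gamma> \<omega> \<nu> \<beta> q T u0 u \<longrightarrow> \<Phi> u0 = u))"

text \<open>The coupling between \<open>B\<close> and \<open>\<psi>1\<close> has coefficient \<open>\<gamma>(\<surd>\<beta> - \<nu>/2)\<close>, that between \<open>B\<close> and \<open>\<psi>2\<close> has
  coefficient \<open>\<gamma>(\<surd>\<beta> + \<nu>/2)\<close>. The theorem needs a nonzero coupling to a component of exponent below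
  \<open>-1/2\<close>: for \<open>\<gamma> = 0\<close> the solution map is linear and bounded, and for \<open>\<nu> = 2\<surd>\<beta>\<close> (which is compatible
  with \<open>\<beta> \<noteq> \<nu>\<^sup>2\<close>) \<open>\<psi>1\<close> is freely transported and decoupled, so its exponent is irrelevant; then e.g.
  \<open>\<omega> = 0\<close>, \<open>k = s = 1\<close>, \<open>l = -1\<close> gives a smooth solution map near the origin.\<close>

end

theory Submission
  imports Defs "HOL-Probability.Probability"
begin

text \<open>A data-to-solution map that is C2 at the origin has a bounded bilinear second derivative there. To
  identify it, smooth solutions with data \<open>s (b\<^sub>0, p\<^sub>0, r\<^sub>0)\<close>, \<open>s\<close> small, are constructed on the whole of
  \<open>[0,T]\<close>, for data whose Fourier transforms are continuous and decay exponentially: solving the transport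
  equations leaves a fixed point equation for the Fourier transform of \<open>B\<close>, which is a contraction in a
  weighted supremum norm. The exponential decay rate in the weight decreases in time; this pays for the
  derivative in the transport equations. Expanding in \<open>s\<close> gives
  \<open>B = s B\<^sub>1 + s\<^sup>2 B\<^sub>2 + O(s\<^sup>3)\<close>, where \<open>B\<^sub>2\<close> is the Duhamel integral of the product of the
  free waves \<open>\<psi>\<^sub>1\<close> and \<open>B\<^sub>1\<close>.

  Boundedness of \<open>B\<^sub>2\<close> is then tested on wave packets of width \<open>d\<close>, \<open>B\<^sub>0\<close> at frequency \<open>\<eta>\<^sub>0\<close> and \<open>\<psi>\<^sub>0\<close> at
  frequencies \<open>\<plusminus>M\<close>. If the phase \<open>\<eta>(\<omega>(2\<zeta> + \<eta>) - v)\<close> of the interaction at \<open>\<zeta>\<close> near \<open>\<eta>\<^sub>0\<close> and \<open>\<eta>\<close> near \<open>M\<close>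
  is at most \<open>1/t\<close>, there is no cancellation up to time \<open>t\<close>, and boundedness forces \<open>t d\<^sup>1\<^sup>/\<^sup>2 \<le> C M\<^sup>l\<close>,
  whatever \<open>k\<close> is. For \<open>\<omega> \<noteq> 0\<close> choose \<open>\<eta>\<^sub>0\<close> resonant, \<open>\<omega>(2\<eta>\<^sub>0 + M) = v\<close>, with \<open>t = T\<close> and \<open>d \<sim> 1/M\<close>; for
  \<open>\<omega> = 0\<close> take \<open>t \<sim> 1/M\<close> and \<open>d \<sim> M\<close>. Both give \<open>M\<^sup>-\<^sup>1\<^sup>/\<^sup>2 \<le> C M\<^sup>l\<close> as \<open>M \<rightarrow> \<infinity>\<close>, so \<open>l \<ge> -1/2\<close>.\<close>

subsection \<open>Schwartz functions\<close>

text \<open>A data-to-solution map is pinned down only on data whose smooth solution lives on all of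
  \<open>[0,T]\<close>, and \<open>T\<close> is arbitrary. The construction must therefore reach
  time \<open>T\<close> by smallness of the data alone. Sobolev data would not do for a direct
  iteration: the waves are forced by a derivative of |B|^2, and for \<omega> = 0 no dispersion could
  recover it. Analytic data can afford the loss. The cubic term and the reaction of |B|^2 on the
  waves enter the equation for \<open>B\<close> at third order in \<open>s\<close>. So only free
  waves meet at second order, and \<open>q\<close> and the forcing coefficients are invisible there.
  The threshold is a count. Packets of unit norm have heights M^-k d^-1/2 and M^-l d^-1/2. Their
  convolution has height M^-k M^-l on an interval of length about d, so after time t its H^k norm is
  about t d^1/2 M^-l, the exponent k dropping out because input and output frequencies of
  \<open>B\<close> are both comparable to M. In resonance the phase varies by about M d across the
  packets, which forces d ~ 1/M for times of order one.\<close>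

lemma schwartz_coinduct:
  assumes "f \<in> S"
    and "\<And>g x. g \<in> S \<Longrightarrow> g differentiable (at x)"
    and "\<And>g. g \<in> S \<Longrightarrow> bounded (range g)"
    and "\<And>g. g \<in> S \<Longrightarrow> vderiv g \<in> S"
    and "\<And>g. g \<in> S \<Longrightarrow> (\<lambda>x. x *\<^sub>R g x) \<in> S"
  shows "schwartz f"
proof -
  \<comment> \<open>Closure under \<open>vderiv\<close> and under multiplication by \<open>x\<close>
    puts every \<open>x ^ m\<close> times an iterated derivative of \<open>f\<close> into
    \<open>S\<close>. Differentiability and boundedness on \<open>S\<close> then give all Schwartz
    seminorms, without any formula for iterated derivatives of products.\<close>
  have 1: "(vderiv ^^ n) f \<in> S" for n
    by (induction n) (simp_all add: assms(1,4))
  have 2: "(\<lambda>x. x ^ m *\<^sub>R g x) \<in> S" if "g \<in> S" for m g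
  proof (induction m)
    case (Suc m)
    from assms(5)[OF Suc] show ?case by (simp add: mult.commute)
  qed (use that in simp)
  show ?thesis
    unfolding schwartz_def by (intro allI conjI assms(2,3) 1 2)
qed

lemma vderivI:
  assumes "\<And>x. (f has_vector_derivative f' x) (at x)"
  shows "vderiv f = f'"
  using assms by (auto simp: vderiv_def fun_eq_iff vector_derivative_at)

lemma has_vector_derivative_vderiv:
  "f differentiable (at x) \<Longrightarrow> (f has_vector_derivative vderiv f x) (at x)"
  by (simp add: vderiv_def vector_derivative_works[symmetric])

lemma schwartz_differentiable: "schwartz f \<Longrightarrow> f differentiable (at x)"
  unfolding schwartz_def by (drule spec[of _ 0]) simp

lemma schwartz_vderiv: "schwartz f \<Longrightarrow> schwartz (vderiv f)"
  unfolding schwartz_def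
proof
  fix n
  assume f: "\<forall>n. (\<forall>x. (vderiv ^^ n) f differentiable at x) \<and>
    (\<forall>m. bounded (range (\<lambda>x. x ^ m *\<^sub>R (vderiv ^^ n) f x)))"
  have "(vderiv ^^ n) (vderiv f) = (vderiv ^^ Suc n) f"
    by (simp add: funpow_swap1)
  with f[rule_format, of "Suc n"]
  show "(\<forall>x. (vderiv ^^ n) (vderiv f) differentiable at x) \<and>
    (\<forall>m. bounded (range (\<lambda>x. x ^ m *\<^sub>R (vderiv ^^ n) (vderiv f) x)))"
    by (simp only:) simp
qed

lemma schwartz_has_vector_derivative:
  "schwartz f \<Longrightarrow> (f has_vector_derivative vderiv f x) (at x)"
  by (intro has_vector_derivative_vderiv schwartz_differentiable)

lemma schwartz_bounded: "schwartz f \<Longrightarrow> bounded (range (\<lambda>x. x ^ m *\<^sub>R f x))"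
  unfolding schwartz_def by (drule spec[of _ 0]) simp

text \<open>The derivative of \<open>x f\<close> is \<open>x f' + f\<close>, so sums and multiples
  by \<open>x\<close> have to be treated together. This closure is the invariant set for
  \<open>schwartz_coinduct\<close> that contains them all.\<close>

inductive_set schwartz_module :: "(real \<Rightarrow> complex) set" where
  base: "schwartz f \<Longrightarrow> f \<in> schwartz_module"
| add: "f \<in> schwartz_module \<Longrightarrow> g \<in> schwartz_module \<Longrightarrow> (\<lambda>x. f x + g x) \<in> schwartz_module"
| cmult: "f \<in> schwartz_module \<Longrightarrow> (\<lambda>x. c * f x) \<in> schwartz_module"
| xmult: "f \<in> schwartz_module \<Longrightarrow> (\<lambda>x. x *\<^sub>R f x) \<in> schwartz_module"

text \<open>The induction needs all powers \<open>m\<close> at once, because a factor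
  \<open>x\<close> is absorbed by passing from \<open>m\<close> to \<open>Suc m\<close>.\<close>

lemma schwartz_module_bounded:
  "f \<in> schwartz_module \<Longrightarrow> bounded (range (\<lambda>x. x ^ m *\<^sub>R f x))"
proof (induction arbitrary: m rule: schwartz_module.induct)
  case (base f)
  then show ?case by (rule schwartz_bounded)
next
  case (add f g)
  obtain a b where "\<And>x. norm (x ^ m *\<^sub>R f x) \<le> a" "\<And>x. norm (x ^ m *\<^sub>R g x) \<le> b"
    using add.IH[of m] unfolding bounded_iff by auto
  then have "norm (x ^ m *\<^sub>R (f x + g x)) \<le> a + b" for x
    unfolding scaleR_add_right by (rule norm_triangle_mono)
  then show ?case unfolding bounded_iff by blast
next
  case (cmult f c)
  obtain a where "\<And>x. norm (x ^ m *\<^sub>R f x) \<le> a"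
    using cmult.IH[of m] unfolding bounded_iff by auto
  then have "norm (x ^ m *\<^sub>R (c * f x)) \<le> cmod c * a" for x
    by (simp add: norm_mult mult.left_commute mult_left_mono)
  then show ?case unfolding bounded_iff by blast
next
  case (xmult f)
  from xmult.IH[of "Suc m"] show ?case by (simp add: mult.commute)
qed

lemma schwartz_module_deriv:
  "f \<in> schwartz_module \<Longrightarrow> (\<forall>x. f differentiable (at x)) \<and> vderiv f \<in> schwartz_module"
proof (induction rule: schwartz_module.induct)
  case (base f)
  then show ?case by (simp add: schwartz_differentiable schwartz_vderiv schwartz_module.base)
next
  case (add f g)
  have d: "((\<lambda>x. f x + g x) has_vector_derivative vderiv f x + vderiv g x) (at x)" for x
    by (intro has_vector_derivative_add has_vector_derivative_vderiv) (use add.IH in auto)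
  have "vderiv (\<lambda>x. f x + g x) = (\<lambda>x. vderiv f x + vderiv g x)"
    by (rule vderivI) (rule d)
  then show ?case
    using differentiableI_vector[OF d] schwartz_module.add add.IH by simp
next
  case (cmult f c)
  have d: "((\<lambda>x. c * f x) has_vector_derivative c * vderiv f x) (at x)" for x
    by (intro has_vector_derivative_mult_right has_vector_derivative_vderiv) (use cmult.IH in auto)
  have "vderiv (\<lambda>x. c * f x) = (\<lambda>x. c * vderiv f x)"
    by (rule vderivI) (rule d)
  then show ?case
    using differentiableI_vector[OF d] schwartz_module.cmult cmult.IH by simp
next
  case (xmult f)
  have d: "((\<lambda>x. x *\<^sub>R f x) has_vector_derivative x *\<^sub>R vderiv f x + 1 *\<^sub>R f x) (at x)" for x
    by (intro has_vector_derivative_scaleR has_vector_derivative_vderiv DERIV_ident)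
      (use xmult.IH in auto)
  have "vderiv (\<lambda>x. x *\<^sub>R f x) = (\<lambda>x. x *\<^sub>R vderiv f x + 1 *\<^sub>R f x)"
    by (rule vderivI) (rule d)
  then show ?case
    using differentiableI_vector[OF d] xmult schwartz_module.add[OF schwartz_module.xmult[of "vderiv f"] xmult.hyps]
    by simp
qed

lemma schwartz_module: "f \<in> schwartz_module \<Longrightarrow> schwartz f"
proof (erule schwartz_coinduct)
  fix g assume "g \<in> schwartz_module"
  from schwartz_module_bounded[OF this, of 0] show "bounded (range g)" by simp
qed (simp_all add: schwartz_module_deriv schwartz_module.xmult)

lemma schwartz_add: "schwartz f \<Longrightarrow> schwartz g \<Longrightarrow> schwartz (\<lambda>x. f x + g x)"
  and schwartz_cmult: "schwartz f \<Longrightarrow> schwartz (\<lambda>x. c * f x)"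
  and schwartz_xmult: "schwartz f \<Longrightarrow> schwartz (\<lambda>x. x *\<^sub>R f x)"
  by (rule schwartz_module, intro schwartz_module.add schwartz_module.cmult schwartz_module.xmult
      schwartz_module.base; assumption)+

lemma schwartz_cnj: "schwartz f \<Longrightarrow> schwartz (\<lambda>x. cnj (f x))"
proof (rule schwartz_coinduct[where S = "{\<lambda>x. cnj (f x) |f. schwartz f}"])
  fix g assume "g \<in> {\<lambda>x. cnj (f x) |f. schwartz f}"
  then obtain f where g: "g = (\<lambda>x. cnj (f x))" and f: "schwartz f" by auto
  have d: "(g has_vector_derivative cnj (vderiv f x)) (at x)" for x
    unfolding g by (intro has_vector_derivative_cnj schwartz_has_vector_derivative f)
  show "g differentiable at x" for x by (rule differentiableI_vector[OF d])
  show "bounded (range g)" using schwartz_bounded[OF f, of 0] unfolding bounded_iff g by auto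
  have "vderiv g = (\<lambda>x. cnj (vderiv f x))" by (rule vderivI) (rule d)
  then show "vderiv g \<in> {\<lambda>x. cnj (f x) |f. schwartz f}" using schwartz_vderiv[OF f] by auto
  show "(\<lambda>x. x *\<^sub>R g x) \<in> {\<lambda>x. cnj (f x) |f. schwartz f}"
    unfolding g using schwartz_xmult[OF f] by (auto intro!: exI[of _ "\<lambda>x. x *\<^sub>R f x"])
qed auto

lemma schwartz_cnj_iff: "schwartz (\<lambda>x. cnj (f x)) \<longleftrightarrow> schwartz f"
  using schwartz_cnj[of f] schwartz_cnj[of "\<lambda>x. cnj (f x)"] by auto

lemma has_vector_derivative_cis:
  assumes "(f has_real_derivative f') (at x)"
  shows "((\<lambda>x. cis (f x)) has_vector_derivative \<i> * of_real f' * cis (f x)) (at x)"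
  using has_derivative_cis[OF assms[THEN has_field_derivative_imp_has_derivative]]
  by (simp add: has_vector_derivative_def scaleR_conv_of_real mult_ac)

text \<open>Differentiating the quadratic phase only brings down a polynomial factor, so the
  products of the phase with Schwartz functions form an invariant set for
  \<open>schwartz_coinduct\<close>. The Schroedinger and transport symbols both have this
  form.\<close>

lemma schwartz_cis_mult:
  assumes "schwartz f"
  shows "schwartz (\<lambda>x. cis (a * x\<^sup>2 + b * x) * f x)"
proof (rule schwartz_coinduct[where S = "{\<lambda>x. cis (a * x\<^sup>2 + b * x) * f x |f. schwartz f}"])
  let ?S = "{\<lambda>x. cis (a * x\<^sup>2 + b * x) * f x |f. schwartz f}"
  fix g assume "g \<in> ?S"
  then obtain f where g: "g = (\<lambda>x. cis (a * x\<^sup>2 + b * x) * f x)" and f: "schwartz f" by auto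
  define k where "k = (\<lambda>x. 2 * \<i> * a * (x *\<^sub>R f x) + (\<i> * b * f x + vderiv f x))"
  have k: "schwartz k"
    unfolding k_def by (intro schwartz_add schwartz_cmult schwartz_xmult schwartz_vderiv f)
  have d: "(g has_vector_derivative cis (a * x\<^sup>2 + b * x) * k x) (at x)" for x
    unfolding g k_def
    by (rule has_vector_derivative_eq_rhs,
        rule has_vector_derivative_mult[OF has_vector_derivative_cis schwartz_has_vector_derivative[OF f]])
      (auto intro!: derivative_eq_intros simp: algebra_simps scaleR_conv_of_real)
  show "g differentiable at x" for x by (rule differentiableI_vector[OF d])
  show "bounded (range g)"
    using schwartz_bounded[OF f, of 0] unfolding bounded_iff g by (auto simp: norm_mult)
  have "vderiv g = (\<lambda>x. cis (a * x\<^sup>2 + b * x) * k x)" by (rule vderivI) (rule d)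
  then show "vderiv g \<in> ?S" using k by auto
  show "(\<lambda>x. x *\<^sub>R g x) \<in> ?S"
    unfolding g using schwartz_xmult[OF f] by (auto intro!: exI[of _ "\<lambda>x. x *\<^sub>R f x"])
qed (use assms in auto)

lemma integrable_inverse_1_plus_sq: "integrable lborel (\<lambda>x::real. 1 / (1 + x\<^sup>2))"
  using integrable_inverse_1_plus_square
  by (simp add: set_integrable_def inverse_eq_divide)

lemma schwartz_measurable: "schwartz f \<Longrightarrow> f \<in> borel_measurable borel"
  by (intro borel_measurable_continuous_onI continuous_at_imp_continuous_on ballI
      differentiable_imp_continuous_within schwartz_differentiable)

text \<open>The bounds for the powers 0 and 2 add up to one for \<open>1 + x^2\<close>, whose
  inverse is the integrable majorant used throughout.\<close>

lemma schwartz_decay: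
  assumes "schwartz f"
  obtains C where "C \<ge> 0" "\<And>x. norm (f x) \<le> C / (1 + x\<^sup>2)"
proof -
  obtain a b where ab: "\<And>x. norm (f x) \<le> a" "\<And>x. x\<^sup>2 * norm (f x) \<le> b"
    using schwartz_bounded[OF assms, of 0] schwartz_bounded[OF assms, of 2]
    unfolding bounded_iff by auto
  have "norm (f x) \<le> (a + b) / (1 + x\<^sup>2)" for x
    using ab[of x] by (simp add: pos_le_divide_eq add_pos_nonneg algebra_simps)
  moreover have "a + b \<ge> 0"
    using ab[of 0] norm_ge_zero[of "f 0"] by (simp del: norm_ge_zero)
  ultimately show ?thesis using that by blast
qed

lemma schwartz_integrable:
  assumes "schwartz f" shows "integrable lborel f"
proof -
  obtain C where C: "C \<ge> 0" "\<And>x. norm (f x) \<le> C / (1 + x\<^sup>2)"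
    using schwartz_decay[OF assms] by blast
  show ?thesis
  proof (rule Bochner_Integration.integrable_bound)
    show "integrable lborel (\<lambda>x. C * (1 / (1 + x\<^sup>2)))"
      by (intro integrable_mult_right integrable_inverse_1_plus_sq)
  qed (use C schwartz_measurable[OF assms] in auto)
qed

subsection \<open>The Fourier transform\<close>

text \<open>Continuity of the integrand is asked for only almost everywhere in \<open>y\<close>: in
  the Duhamel integral the indicator of \<open>{0..t}\<close> jumps at one point. The parameter
  space is first countable, so sequences suffice and the claim is dominated convergence.\<close>

lemma continuous_integral_dominated:
  fixes f :: "'a::{first_countable_topology,t2_space} \<Rightarrow> real \<Rightarrow> complex"
  assumes "a \<in> S" and meas: "\<And>x. x \<in> S \<Longrightarrow> f x \<in> borel_measurable lborel"
    and w: "integrable lborel w"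
    and bound: "\<And>x y. x \<in> S \<Longrightarrow> norm (f x y) \<le> w y"
    and cont: "AE y in lborel. continuous (at a within S) (\<lambda>x. f x y)"
  shows "continuous (at a within S) (\<lambda>x. \<integral>y. f x y \<partial>lborel)"
  unfolding continuous_within_sequentially o_def
proof (intro allI impI)
  fix x :: "nat \<Rightarrow> 'a"
  assume x: "(\<forall>n. x n \<in> S) \<and> x \<longlonglongrightarrow> a"
  show "(\<lambda>n. \<integral>y. f (x n) y \<partial>lborel) \<longlonglongrightarrow> (\<integral>y. f a y \<partial>lborel)"
  proof (rule integral_dominated_convergence[OF _ _ w])
    show "AE y in lborel. (\<lambda>n. f (x n) y) \<longlonglongrightarrow> f a y"
      using cont
    proof eventually_elim
      case (elim y)
      then show ?case
        unfolding continuous_within_sequentially o_def using x by blast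
    qed
  qed (use x assms in auto)
qed

lemma has_vector_derivative_quadratic_remainder:
  fixes f :: "real \<Rightarrow> complex"
  assumes "\<And>h. norm (f (x + h) - f x - h *\<^sub>R D) \<le> C * h\<^sup>2"
  shows "(f has_vector_derivative D) (at x)"
  unfolding has_vector_derivative_def has_derivative_at
proof (intro conjI)
  show "bounded_linear (\<lambda>h. h *\<^sub>R D)" by (rule bounded_linear_scaleR_left)
  show "(\<lambda>h. norm (f (x + h) - f x - h *\<^sub>R D) / norm h) \<midarrow>0\<rightarrow> 0"
  proof (rule Lim_null_comparison)
    show "\<forall>\<^sub>F h in at 0. norm (norm (f (x + h) - f x - h *\<^sub>R D) / norm h) \<le> C * \<bar>h\<bar>"
      unfolding eventually_at_filter
    proof (intro always_eventually allI impI)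
      fix h :: real assume "h \<noteq> 0"
      then show "norm (norm (f (x + h) - f x - h *\<^sub>R D) / norm h) \<le> C * \<bar>h\<bar>"
        using assms[of h] by (simp add: pos_divide_le_eq power2_eq_square mult.assoc flip: abs_mult)
    qed
    show "((\<lambda>h. C * \<bar>h\<bar>) \<longlongrightarrow> 0) (at 0)"
      by (auto intro!: tendsto_eq_intros)
  qed
qed

text \<open>The sign parameter treats \<open>fourier\<close> (\<open>\<sigma> = - 1\<close>) and, up
  to the factor \<open>2 * pi\<close>, \<open>inv_fourier\<close> (\<open>\<sigma> = 1\<close>) by
  one set of lemmas.\<close>

definition ft :: "real \<Rightarrow> (real \<Rightarrow> complex) \<Rightarrow> real \<Rightarrow> complex" where
  "ft \<sigma> f \<xi> = (\<integral>x. cis (\<sigma> * (x * \<xi>)) * f x \<partial>lborel)"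

lemma fourier_eq_ft: "fourier = ft (- 1)"
  by (simp add: fun_eq_iff fourier_def ft_def)

lemma inv_fourier_eq_ft: "inv_fourier f x = ft 1 f x / of_real (2 * pi)"
  by (simp add: fun_eq_iff inv_fourier_def ft_def mult.commute[of x])

lemma borel_measurable_cis [measurable (raw)]:
  assumes [measurable]: "f \<in> borel_measurable M"
  shows "(\<lambda>x. cis (f x)) \<in> borel_measurable M"
  unfolding cis_conv_exp by measurable

lemma integrable_cis_mult [simp]:
  assumes "integrable lborel f" "g \<in> borel_measurable borel"
  shows "integrable lborel (\<lambda>x. cis (g x) * f x)"
  by (rule Bochner_Integration.integrable_bound[OF assms(1)])
    (use assms in \<open>auto simp: norm_mult\<close>)

lemma ft_cmult: "ft \<sigma> (\<lambda>x. c * f x) \<xi> = c * ft \<sigma> f \<xi>"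
  by (simp add: ft_def mult.left_commute[of _ c])

lemma norm_ft_le: "norm (ft \<sigma> f \<xi>) \<le> (\<integral>x. norm (f x) \<partial>lborel)"
  unfolding ft_def by (rule order_trans[OF integral_norm_bound]) (simp add: norm_mult)

lemma continuous_on_ft:
  assumes "integrable lborel f"
  shows "continuous_on UNIV (ft \<sigma> f)"
  unfolding continuous_on_eq_continuous_within ft_def
proof (intro ballI continuous_integral_dominated)
  show "integrable lborel (\<lambda>x. norm (f x))" using assms by simp
  fix \<xi> :: real
  show "AE y in lborel. isCont (\<lambda>x. cis (\<sigma> * (y * x)) * f y) \<xi>"
    unfolding cis_conv_exp by (intro AE_I2 continuous_intros)
qed (use assms in \<open>auto simp: norm_mult\<close>)

text \<open>Differentiation under the integral by the Taylor bound
  \<open>|cis y - 1 - i y| <= y^2 / 2\<close>: since \<open>x^2 f\<close> is integrable, the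
  integrated remainder is at most a multiple of \<open>h^2\<close>.\<close>

lemma ft_has_vector_derivative:
  assumes "schwartz f"
  shows "(ft \<sigma> f has_vector_derivative ft \<sigma> (\<lambda>x. \<i> * \<sigma> * (x *\<^sub>R f x)) \<xi>) (at \<xi>)"
proof (rule has_vector_derivative_quadratic_remainder)
  fix h :: real
  let ?g = "\<lambda>x. \<i> * \<sigma> * (x *\<^sub>R f x)"
  note int = schwartz_integrable[OF assms]
  note int1 = schwartz_integrable[OF schwartz_cmult[OF schwartz_xmult[OF assms]]]
  have s2: "schwartz (\<lambda>x. x\<^sup>2 *\<^sub>R f x)"
    using schwartz_xmult[OF schwartz_xmult[OF assms]] by (simp add: power2_eq_square)
  have int2: "integrable lborel (\<lambda>x. x\<^sup>2 * norm (f x))"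
    using schwartz_integrable[OF s2, THEN integrable_norm] by simp
  have eq: "ft \<sigma> f (\<xi> + h) - ft \<sigma> f \<xi> - h *\<^sub>R ft \<sigma> ?g \<xi> =
      (\<integral>x. cis (\<sigma> * (x * (\<xi> + h))) * f x - cis (\<sigma> * (x * \<xi>)) * f x
        - h *\<^sub>R (cis (\<sigma> * (x * \<xi>)) * ?g x) \<partial>lborel)"
  proof -
    have a: "integrable lborel (\<lambda>x. cis (\<sigma> * (x * \<zeta>)) * f x)" for \<zeta>
      by (intro integrable_cis_mult int) auto
    have b: "integrable lborel (\<lambda>x. h *\<^sub>R (cis (\<sigma> * (x * \<xi>)) * ?g x))"
      by (intro integrable_scaleR_right integrable_cis_mult int1) auto
    show ?thesis
      unfolding ft_def Bochner_Integration.integral_diff[OF Bochner_Integration.integrable_diff[OF a a] b]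
        Bochner_Integration.integral_diff[OF a a]
      by (simp only: integral_scaleR_right)
  qed
  have "norm (ft \<sigma> f (\<xi> + h) - ft \<sigma> f \<xi> - h *\<^sub>R ft \<sigma> ?g \<xi>)
      \<le> (\<integral>x. (\<sigma>\<^sup>2 * h\<^sup>2 / 2) * (x\<^sup>2 * norm (f x)) \<partial>lborel)"
    unfolding eq
  proof (rule order_trans[OF integral_norm_bound integral_mono])
    show "integrable lborel (\<lambda>x. (\<sigma>\<^sup>2 * h\<^sup>2 / 2) * (x\<^sup>2 * norm (f x)))"
      using int2 by (rule integrable_mult_right)
    show "integrable lborel (\<lambda>x. norm (cis (\<sigma> * (x * (\<xi> + h))) * f x - cis (\<sigma> * (x * \<xi>)) * f x
        - h *\<^sub>R (cis (\<sigma> * (x * \<xi>)) * ?g x)))"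
      by (intro integrable_norm Bochner_Integration.integrable_diff integrable_scaleR_right integrable_cis_mult int int1) auto
    fix x :: real
    have "cis (\<sigma> * (x * (\<xi> + h))) * f x - cis (\<sigma> * (x * \<xi>)) * f x - h *\<^sub>R (cis (\<sigma> * (x * \<xi>)) * ?g x)
      = cis (\<sigma> * (x * \<xi>)) * f x * (cis (\<sigma> * x * h) - (1 + \<i> * of_real (\<sigma> * x * h)))"
      by (simp add: algebra_simps scaleR_conv_of_real flip: cis_mult)
    then have "norm (cis (\<sigma> * (x * (\<xi> + h))) * f x - cis (\<sigma> * (x * \<xi>)) * f x
        - h *\<^sub>R (cis (\<sigma> * (x * \<xi>)) * ?g x))
      = norm (f x) * norm (cis (\<sigma> * x * h) - (1 + \<i> * of_real (\<sigma> * x * h)))"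
      by (simp add: norm_mult)
    also have "\<dots> \<le> norm (f x) * ((\<sigma> * x * h)\<^sup>2 / 2)"
      using iexp_approx1[of "\<sigma> * x * h" 1]
      by (intro mult_left_mono) (simp_all add: cis_conv_exp power2_eq_square)
    finally show "norm (cis (\<sigma> * (x * (\<xi> + h))) * f x - cis (\<sigma> * (x * \<xi>)) * f x
        - h *\<^sub>R (cis (\<sigma> * (x * \<xi>)) * ?g x)) \<le> (\<sigma>\<^sup>2 * h\<^sup>2 / 2) * (x\<^sup>2 * norm (f x))"
      by (simp add: power_mult_distrib mult_ac)
  qed
  also have "\<dots> = (\<sigma>\<^sup>2 / 2 * (\<integral>x. x\<^sup>2 * norm (f x) \<partial>lborel)) * h\<^sup>2"
    by simp
  finally show "norm (ft \<sigma> f (\<xi> + h) - ft \<sigma> f \<xi> - h *\<^sub>R ft \<sigma> ?g \<xi>) \<le> \<dots>" .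
qed

section \<open>Integration by parts and invariance of the Schwartz class\<close>

lemma schwartz_tendsto_0:
  assumes "schwartz f"
  shows "(f \<longlongrightarrow> 0) at_top" "(f \<longlongrightarrow> 0) at_bot"
proof -
  obtain C where C: "C \<ge> 0" "\<And>x. norm (f x) \<le> C / (1 + x\<^sup>2)"
    using schwartz_decay[OF assms] by blast
  have "((\<lambda>x::real. C / (1 + x\<^sup>2)) \<longlongrightarrow> 0) at_top" "((\<lambda>x::real. C / (1 + x\<^sup>2)) \<longlongrightarrow> 0) at_bot"
    by real_asymp+
  then show "(f \<longlongrightarrow> 0) at_top" and "(f \<longlongrightarrow> 0) at_bot"
    using C(2) by (auto intro!: Lim_null_comparison[where g = "\<lambda>x. C / (1 + x\<^sup>2)"] always_eventually)
qed

lemma integral_vderiv_schwartz: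
  assumes "schwartz f"
  shows "(\<integral>x. vderiv f x \<partial>lborel) = 0"
proof -
  have "(LBINT x=-\<infinity>..\<infinity>. vderiv f x) = 0 - 0"
  proof (rule interval_integral_FTC_integrable)
    show "set_integrable lborel (einterval (- \<infinity>) \<infinity>) (vderiv f)"
      using schwartz_integrable[OF schwartz_vderiv[OF assms]] by (simp add: set_integrable_def)
    show "((f \<circ> real_of_ereal) \<longlongrightarrow> 0) (at_right (- \<infinity>))" "((f \<circ> real_of_ereal) \<longlongrightarrow> 0) (at_left \<infinity>)"
      by (simp_all add: ereal_tendsto_simps schwartz_tendsto_0[OF assms])
    show "isCont (vderiv f) x" for x
      by (intro differentiable_imp_continuous_within schwartz_differentiable schwartz_vderiv assms)
  qed (auto intro: schwartz_has_vector_derivative assms)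
  then show ?thesis by (simp add: interval_lebesgue_integral_def set_lebesgue_integral_def)
qed

lemma vderiv_mult_cis:
  assumes "schwartz f"
  shows "vderiv (\<lambda>x. cis (a * x) * f x) = (\<lambda>x. cis (a * x) * (\<i> * of_real a * f x + vderiv f x))"
proof (rule vderivI)
  fix x
  show "((\<lambda>x. cis (a * x) * f x) has_vector_derivative cis (a * x) * (\<i> * of_real a * f x + vderiv f x)) (at x)"
    by (rule has_vector_derivative_eq_rhs,
        rule has_vector_derivative_mult[OF has_vector_derivative_cis schwartz_has_vector_derivative[OF assms]])
      (auto intro!: derivative_eq_intros simp: algebra_simps)
qed

text \<open>Integration by parts, in the form that the derivative of the Schwartz function
  \<open>cis (a x) f x\<close> has integral zero.\<close>

lemma ft_vderiv:
  assumes "schwartz f"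
  shows "ft \<sigma> (vderiv f) \<xi> = - \<i> * \<sigma> * \<xi> * ft \<sigma> f \<xi>"
proof -
  have eq: "\<sigma> * (x * \<xi>) = 0 * x\<^sup>2 + \<sigma> * \<xi> * x" for x by simp
  have sch: "schwartz (\<lambda>x. cis (\<sigma> * \<xi> * x) * f x)"
    using schwartz_cis_mult[OF assms, of 0 "\<sigma> * \<xi>"] by simp
  have "0 = (\<integral>x. cis (\<sigma> * \<xi> * x) * (\<i> * of_real (\<sigma> * \<xi>) * f x + vderiv f x) \<partial>lborel)"
    using integral_vderiv_schwartz[OF sch] vderiv_mult_cis[OF assms, of "\<sigma> * \<xi>"] by simp
  also have "\<dots> = (\<integral>x. \<i> * of_real (\<sigma> * \<xi>) * (cis (\<sigma> * \<xi> * x) * f x) + cis (\<sigma> * \<xi> * x) * vderiv f x \<partial>lborel)"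
    by (simp add: algebra_simps)
  also have "\<dots> = \<i> * of_real (\<sigma> * \<xi>) * (\<integral>x. cis (\<sigma> * \<xi> * x) * f x \<partial>lborel) + (\<integral>x. cis (\<sigma> * \<xi> * x) * vderiv f x \<partial>lborel)"
    by (subst Bochner_Integration.integral_add)
      (auto intro!: integrable_cis_mult integrable_mult_right schwartz_integrable[OF assms]
        schwartz_integrable[OF schwartz_vderiv[OF assms]] simp del: of_real_mult)
  finally show ?thesis
    by (simp add: ft_def mult_ac add_eq_0_iff)
qed

text \<open>The transforms of Schwartz functions are the invariant set: differentiating the
  transform multiplies \<open>f\<close> by \<open>x\<close>, and multiplying the transform by its
  variable differentiates \<open>f\<close>. The second rule divides by
  \<open>\<sigma>\<close>.\<close>

lemma schwartz_ft:
  assumes "schwartz f" "\<sigma> \<noteq> 0"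
  shows "schwartz (ft \<sigma> f)"
proof (rule schwartz_coinduct[where S = "{ft \<sigma> f |f. schwartz f}"])
  fix g assume "g \<in> {ft \<sigma> f |f. schwartz f}"
  then obtain f where g: "g = ft \<sigma> f" and f: "schwartz f" by auto
  have d: "(g has_vector_derivative ft \<sigma> (\<lambda>x. \<i> * \<sigma> * (x *\<^sub>R f x)) \<xi>) (at \<xi>)" for \<xi>
    unfolding g by (rule ft_has_vector_derivative[OF f])
  show "g differentiable at x" for x by (rule differentiableI_vector[OF d])
  show "bounded (range g)" unfolding g bounded_iff using norm_ft_le by blast
  have "vderiv g = ft \<sigma> (\<lambda>x. \<i> * \<sigma> * (x *\<^sub>R f x))" by (rule vderivI) (rule d)
  then show "vderiv g \<in> {ft \<sigma> f |f. schwartz f}"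
    using schwartz_cmult[OF schwartz_xmult[OF f], of "\<i> * \<sigma>"] by auto
  have "(\<lambda>x. x *\<^sub>R g x) = ft \<sigma> (\<lambda>x. \<i> / \<sigma> * vderiv f x)"
  proof
    fix x
    have "ft \<sigma> (\<lambda>x. \<i> / \<sigma> * vderiv f x) x = \<i> / \<sigma> * ft \<sigma> (vderiv f) x"
      by (rule ft_cmult)
    then show "x *\<^sub>R g x = ft \<sigma> (\<lambda>x. \<i> / \<sigma> * vderiv f x) x"
      using assms(2) by (simp add: g ft_vderiv[OF f] scaleR_conv_of_real)
  qed
  then show "(\<lambda>x. x *\<^sub>R g x) \<in> {ft \<sigma> f |f. schwartz f}"
    using schwartz_cmult[OF schwartz_vderiv[OF f], of "\<i> / \<sigma>"] by auto
qed (use assms in auto)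

lemma schwartz_fourier: "schwartz f \<Longrightarrow> schwartz (fourier f)"
  unfolding fourier_eq_ft by (rule schwartz_ft) auto

lemma schwartz_inv_fourier: "schwartz f \<Longrightarrow> schwartz (inv_fourier f)"
proof -
  have "inv_fourier f = (\<lambda>x. 1 / (2 * pi) * ft 1 f x)"
    by (simp add: fun_eq_iff inv_fourier_eq_ft)
  then show "schwartz f \<Longrightarrow> schwartz (inv_fourier f)"
    by (simp only:) (intro schwartz_cmult schwartz_ft; simp)
qed

lemma integrable_bounded_kernel:
  fixes k :: "real \<Rightarrow> real \<Rightarrow> complex"
  assumes k: "case_prod k \<in> borel_measurable (borel \<Otimes>\<^sub>M borel)" "\<And>x y. norm (k x y) \<le> 1"
    and f: "integrable lborel f" and g: "integrable lborel g"
  shows "integrable (lborel \<Otimes>\<^sub>M lborel) (\<lambda>(x, y). k x y * f x * g y)"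
proof -
  have fg: "integrable (lborel \<Otimes>\<^sub>M lborel) (\<lambda>(x, y). f x * g y)"
    by (rule lborel_pair.Fubini_integrable) (use f g in \<open>auto simp: norm_mult\<close>)
  show ?thesis
  proof (rule Bochner_Integration.integrable_bound[OF fg])
    have "(\<lambda>z. case_prod k z * f (fst z) * g (snd z)) \<in> borel_measurable (lborel \<Otimes>\<^sub>M lborel)"
      using k(1) f g by (intro borel_measurable_times) auto
    then show "(\<lambda>(x, y). k x y * f x * g y) \<in> borel_measurable (lborel \<Otimes>\<^sub>M lborel)"
      by (simp add: case_prod_beta')
    show "AE z in lborel \<Otimes>\<^sub>M lborel. norm (case z of (x, y) \<Rightarrow> k x y * f x * g y) \<le> norm (case z of (x, y) \<Rightarrow> f x * g y)"
    proof (intro AE_I2)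
      fix z :: "real \<times> real"
      show "norm (case z of (x, y) \<Rightarrow> k x y * f x * g y) \<le> norm (case z of (x, y) \<Rightarrow> f x * g y)"
        using mult_left_le_one_le[OF _ _ k(2), of "norm (f (fst z) * g (snd z))"]
        by (cases z) (simp add: norm_mult mult.assoc)
    qed
  qed
qed

lemma Fubini_bounded_kernel:
  fixes k :: "real \<Rightarrow> real \<Rightarrow> complex"
  assumes "case_prod k \<in> borel_measurable (borel \<Otimes>\<^sub>M borel)" "\<And>x y. norm (k x y) \<le> 1"
    and "integrable lborel f" and "integrable lborel g"
  shows "(\<integral>y. (\<integral>x. k x y * f x \<partial>lborel) * g y \<partial>lborel) = (\<integral>x. f x * (\<integral>y. k x y * g y \<partial>lborel) \<partial>lborel)"
proof -
  have "(\<integral>y. (\<integral>x. k x y * f x \<partial>lborel) * g y \<partial>lborel) = (\<integral>y. (\<integral>x. k x y * f x * g y \<partial>lborel) \<partial>lborel)"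
    by simp
  also have "\<dots> = (\<integral>x. (\<integral>y. k x y * f x * g y \<partial>lborel) \<partial>lborel)"
    by (rule lborel_pair.Fubini_integral[OF integrable_bounded_kernel[OF assms]])
  also have "\<dots> = (\<integral>x. (\<integral>y. f x * (k x y * g y) \<partial>lborel) \<partial>lborel)"
    by (simp only: mult_ac)
  finally show ?thesis by simp
qed

section \<open>Gaussians and Fourier inversion\<close>

lemma abs_power_le_exp: "\<bar>x\<bar> ^ n \<le> fact n * exp \<bar>x\<bar>" for x :: real
proof -
  have "(\<Sum>k\<in>{n}. \<bar>x\<bar> ^ k /\<^sub>R fact k) \<le> exp \<bar>x\<bar>"
    unfolding exp_def by (intro sum_le_suminf summable_exp_generic) auto
  then show ?thesis by (simp add: field_simps)
qed

lemma abs_power_exp_le: "\<bar>x\<bar> ^ n * exp (- x\<^sup>2 / 2) \<le> fact n * exp (1 / 2)" for x :: real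
proof -
  have "\<bar>x\<bar> ^ n \<le> fact n * exp \<bar>x\<bar>" by (rule abs_power_le_exp)
  also have "\<dots> \<le> fact n * exp (1 / 2 + x\<^sup>2 / 2)"
  proof -
    have "0 \<le> (\<bar>x\<bar> - 1)\<^sup>2" by simp
    then have "\<bar>x\<bar> \<le> 1 / 2 + x\<^sup>2 / 2" by (simp add: power2_diff)
    then show ?thesis by simp
  qed
  finally have "\<bar>x\<bar> ^ n * exp (- x\<^sup>2 / 2) \<le> fact n * exp (1 / 2 + x\<^sup>2 / 2) * exp (- x\<^sup>2 / 2)"
    by (rule mult_right_mono) simp
  then show ?thesis by (simp add: mult.assoc flip: exp_add)
qed

text \<open>Polynomials times the Gaussian are the invariant set: the derivative replaces
  \<open>p\<close> by \<open>p' - x p\<close>.\<close>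

lemma schwartz_gaussian: "schwartz (\<lambda>x. of_real (exp (- x\<^sup>2 / 2)))"
proof (rule schwartz_coinduct[where S = "range (\<lambda>p x. of_real (poly p x * exp (- x\<^sup>2 / 2)))"])
  fix g :: "real \<Rightarrow> complex" assume "g \<in> range (\<lambda>p x. of_real (poly p x * exp (- x\<^sup>2 / 2)))"
  then obtain p where g: "g = (\<lambda>x. of_real (poly p x * exp (- x\<^sup>2 / 2)))" by auto
  have d: "(g has_vector_derivative of_real (poly (pderiv p - [:0, 1:] * p) x * exp (- x\<^sup>2 / 2))) (at x)" for x
    unfolding g
    by (rule has_vector_derivative_of_real)
      (auto intro!: derivative_eq_intros simp: algebra_simps simp flip: has_real_derivative_iff_has_vector_derivative)
  show "g differentiable at x" for x by (rule differentiableI_vector[OF d])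
  have "vderiv g = (\<lambda>x. of_real (poly (pderiv p - [:0, 1:] * p) x * exp (- x\<^sup>2 / 2)))"
    by (rule vderivI) (rule d)
  then show "vderiv g \<in> range (\<lambda>p x. of_real (poly p x * exp (- x\<^sup>2 / 2)))" by blast
  have "(\<lambda>x. x *\<^sub>R g x) = (\<lambda>x. of_real (poly ([:0, 1:] * p) x * exp (- x\<^sup>2 / 2)))"
    by (simp add: g fun_eq_iff scaleR_conv_of_real mult_ac)
  then show "(\<lambda>x. x *\<^sub>R g x) \<in> range (\<lambda>p x. of_real (poly p x * exp (- x\<^sup>2 / 2)))" by blast
  have "norm (g x) \<le> (\<Sum>i\<le>degree p. \<bar>coeff p i\<bar> * (fact i * exp (1 / 2)))" for x
  proof -
    have "norm (g x) = \<bar>\<Sum>i\<le>degree p. coeff p i * x ^ i * exp (- x\<^sup>2 / 2)\<bar>"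
      unfolding g norm_of_real by (simp only: poly_altdef sum_distrib_right)
    also have "\<dots> \<le> (\<Sum>i\<le>degree p. \<bar>coeff p i\<bar> * (\<bar>x\<bar> ^ i * exp (- x\<^sup>2 / 2)))"
      by (rule order_trans[OF sum_abs]) (simp add: abs_mult power_abs mult.assoc)
    also have "\<dots> \<le> (\<Sum>i\<le>degree p. \<bar>coeff p i\<bar> * (fact i * exp (1 / 2)))"
      by (intro sum_mono mult_left_mono abs_power_exp_le) simp
    finally show ?thesis .
  qed
  then show "bounded (range g)" unfolding bounded_iff by auto
next
  show "(\<lambda>x. complex_of_real (exp (- x\<^sup>2 / 2))) \<in> range (\<lambda>p x. of_real (poly p x * exp (- x\<^sup>2 / 2)))"
    by (rule range_eqI[of _ _ 1]) simp
qed

lemma gaussian_eq_std_normal_density: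
  "exp (- x\<^sup>2 / 2) = sqrt (2 * pi) * std_normal_density x"
  by (simp add: std_normal_density_def)

text \<open>Up to \<open>sqrt (2 * pi)\<close> the Gaussian is the standard normal density, so its
  transform is a known characteristic function.\<close>

lemma ft_gaussian:
  "ft 1 (\<lambda>x. of_real (exp (- x\<^sup>2 / 2))) t = of_real (sqrt (2 * pi) * exp (- t\<^sup>2 / 2))"
proof -
  have "of_real (exp (- t\<^sup>2 / 2)) = char std_normal_distribution t"
    by (simp add: char_std_normal_distribution)
  also have "\<dots> = (\<integral>x. std_normal_density x *\<^sub>R iexp (t * x) \<partial>lborel)"
    unfolding char_def by (subst integral_density) (auto simp: normal_density_nonneg)
  finally have *: "of_real (exp (- t\<^sup>2 / 2)) = \<dots>" .
  have "ft 1 (\<lambda>x. of_real (exp (- x\<^sup>2 / 2))) t =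
      ft 1 (\<lambda>x. of_real (sqrt (2 * pi)) * of_real (std_normal_density x)) t"
    by (simp only: gaussian_eq_std_normal_density of_real_mult)
  also have "\<dots> = of_real (sqrt (2 * pi)) * (\<integral>x. std_normal_density x *\<^sub>R iexp (t * x) \<partial>lborel)"
    by (simp add: ft_cmult) (simp add: ft_def cis_conv_exp scaleR_conv_of_real mult_ac)
  finally show ?thesis unfolding *[symmetric] by simp
qed

lemma gaussian_ft_scaled:
  assumes "n > 0"
  shows "(\<integral>\<xi>. cis (y * \<xi>) * of_real (exp (- (\<xi> / n)\<^sup>2 / 2)) \<partial>lborel)
    = of_real (n * (sqrt (2 * pi) * exp (- (n * y)\<^sup>2 / 2)))"
proof -
  have "(\<integral>\<xi>. cis (y * \<xi>) * of_real (exp (- (\<xi> / n)\<^sup>2 / 2)) \<partial>lborel)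
    = \<bar>n\<bar> *\<^sub>R (\<integral>x. cis (y * (0 + n * x)) * of_real (exp (- ((0 + n * x) / n)\<^sup>2 / 2)) \<partial>lborel)"
    by (rule lborel_integral_real_affine) (use assms in auto)
  also have "\<dots> = n *\<^sub>R ft 1 (\<lambda>x. of_real (exp (- x\<^sup>2 / 2))) (n * y)"
    using assms by (simp add: ft_def mult_ac)
  finally show ?thesis unfolding ft_gaussian by (simp add: scaleR_conv_of_real)
qed

lemma integrable_gaussian: "integrable lborel (\<lambda>x::real. exp (- x\<^sup>2 / 2))"
  unfolding gaussian_eq_std_normal_density
  using integrable_mult_right[OF integrable_std_normal_moment[of 0], of "sqrt (2 * pi)"] by simp

lemma integral_gaussian: "(\<integral>x. exp (- (x::real)\<^sup>2 / 2) \<partial>lborel) = sqrt (2 * pi)"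
  using integral_std_normal_moment_even[of 0] unfolding gaussian_eq_std_normal_density by simp

text \<open>The Gaussian factor of width \<open>n\<close> makes the double integral absolutely
  convergent, so that Fubini applies. Its own transform is a Gaussian of width \<open>1 / n\<close>
  around \<open>x\<close>, and the substitution \<open>y = x + z / n\<close> turns the result into
  an average of \<open>f\<close> near \<open>x\<close>.\<close>

lemma ft_ft_regularized:
  assumes "schwartz f" "n > 0"
  shows "(\<integral>\<xi>. cis (x * \<xi>) * ft (- 1) f \<xi> * of_real (exp (- (\<xi> / n)\<^sup>2 / 2)) \<partial>lborel)
    = of_real (sqrt (2 * pi)) * (\<integral>z. f (x + z / n) * of_real (exp (- z\<^sup>2 / 2)) \<partial>lborel)"
proof -
  let ?G = "\<lambda>\<xi>. cis (x * \<xi>) * of_real (exp (- (\<xi> / n)\<^sup>2 / 2)) :: complex"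
  let ?k = "\<lambda>y \<xi>. cis (- 1 * (y * \<xi>))"
  have "integrable lborel (\<lambda>\<xi>. complex_of_real (exp (- (0 + 1 / n * \<xi>)\<^sup>2 / 2)))"
    using assms(2) lborel_integrable_real_affine[OF integrable_gaussian, of "1 / n" 0] by simp
  then have G: "integrable lborel ?G"
    by (intro integrable_cis_mult) auto
  have "(\<integral>\<xi>. cis (x * \<xi>) * ft (- 1) f \<xi> * of_real (exp (- (\<xi> / n)\<^sup>2 / 2)) \<partial>lborel)
    = (\<integral>\<xi>. (\<integral>y. ?k y \<xi> * f y \<partial>lborel) * ?G \<xi> \<partial>lborel)"
    by (simp add: ft_def mult_ac)
  also have "\<dots> = (\<integral>y. f y * (\<integral>\<xi>. ?k y \<xi> * ?G \<xi> \<partial>lborel) \<partial>lborel)"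
    by (rule Fubini_bounded_kernel) (use G schwartz_integrable[OF assms(1)] in auto)
  also have "(\<lambda>y. \<integral>\<xi>. ?k y \<xi> * ?G \<xi> \<partial>lborel) =
     (\<lambda>y. \<integral>\<xi>. cis ((x - y) * \<xi>) * of_real (exp (- (\<xi> / n)\<^sup>2 / 2)) \<partial>lborel)"
    by (simp add: mult.assoc[symmetric] cis_mult algebra_simps)
  also have "\<dots> = (\<lambda>y. of_real (n * (sqrt (2 * pi) * exp (- (n * (x - y))\<^sup>2 / 2))))"
    by (simp only: gaussian_ft_scaled[OF assms(2)])
  also have "(\<integral>y. f y * of_real (n * (sqrt (2 * pi) * exp (- (n * (x - y))\<^sup>2 / 2))) \<partial>lborel)
    = \<bar>1 / n\<bar> *\<^sub>R (\<integral>z. f (x + 1 / n * z) * of_real (n * (sqrt (2 * pi) * exp (- (n * (x - (x + 1 / n * z)))\<^sup>2 / 2))) \<partial>lborel)"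
    by (rule lborel_integral_real_affine) (use assms in auto)
  also have "\<dots> = of_real (1 / n) * (\<integral>z. of_real (n * sqrt (2 * pi)) * (f (x + z / n) * of_real (exp (- z\<^sup>2 / 2))) \<partial>lborel)"
    using assms(2) by (simp add: scaleR_conv_of_real mult_ac)
  also have "\<dots> = of_real (1 / n) * (of_real (n * sqrt (2 * pi)) * (\<integral>z. (f (x + z / n) * of_real (exp (- z\<^sup>2 / 2))) \<partial>lborel))"
    by (simp only: integral_mult_right_zero)
  finally show ?thesis using assms(2) by simp
qed

text \<open>Let the width \<open>n\<close> in \<open>ft_ft_regularized\<close> tend to infinity.
  Dominated convergence applies on both sides, and the Gaussian integral supplies a second
  \<open>sqrt (2 * pi)\<close>, together the \<open>2 * pi\<close> of
  \<open>inv_fourier\<close>.\<close>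

theorem fourier_inversion:
  assumes "schwartz f"
  shows "inv_fourier (fourier f) x = f x"
proof -
  let ?I = "\<lambda>n. \<integral>\<xi>. cis (x * \<xi>) * ft (- 1) f \<xi> * of_real (exp (- (\<xi> / real (Suc n))\<^sup>2 / 2)) \<partial>lborel"
  let ?J = "\<lambda>n. \<integral>z. f (x + z / real (Suc n)) * of_real (exp (- z\<^sup>2 / 2)) \<partial>lborel"
  have F: "schwartz (ft (- 1) f)" by (rule schwartz_ft) (use assms in auto)
  have 1: "?I \<longlonglongrightarrow> (\<integral>\<xi>. cis (x * \<xi>) * ft (- 1) f \<xi> \<partial>lborel)"
  proof (rule integral_dominated_convergence)
    show "integrable lborel (\<lambda>\<xi>. norm (ft (- 1) f \<xi>))"
      using schwartz_integrable[OF F] by simp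
    show "AE \<xi> in lborel. (\<lambda>n. cis (x * \<xi>) * ft (- 1) f \<xi> * of_real (exp (- (\<xi> / real (Suc n))\<^sup>2 / 2)))
        \<longlonglongrightarrow> cis (x * \<xi>) * ft (- 1) f \<xi>"
    proof (intro AE_I2)
      fix \<xi> :: real
      have "(\<lambda>n. \<xi> / real (Suc n)) \<longlonglongrightarrow> 0"
        by (rule real_tendsto_divide_at_top[OF tendsto_const])
          (rule filterlim_compose[OF filterlim_real_sequentially filterlim_Suc])
      then have "(\<lambda>n. cis (x * \<xi>) * ft (- 1) f \<xi> * of_real (exp (- (\<xi> / real (Suc n))\<^sup>2 / 2)))
        \<longlonglongrightarrow> cis (x * \<xi>) * ft (- 1) f \<xi> * of_real (exp (- 0\<^sup>2 / 2))"
        by (intro tendsto_intros) auto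
      then show "(\<lambda>n. cis (x * \<xi>) * ft (- 1) f \<xi> * of_real (exp (- (\<xi> / real (Suc n))\<^sup>2 / 2)))
        \<longlonglongrightarrow> cis (x * \<xi>) * ft (- 1) f \<xi>" by simp
    qed
  qed (use schwartz_measurable[OF F] in \<open>auto simp: norm_mult mult_left_le\<close>)
  obtain C where C: "\<And>x. norm (f x) \<le> C"
    using schwartz_bounded[OF assms, of 0] unfolding bounded_iff by auto
  have 2: "?J \<longlonglongrightarrow> (\<integral>z. f x * of_real (exp (- z\<^sup>2 / 2)) \<partial>lborel)"
  proof (rule integral_dominated_convergence)
    show "integrable lborel (\<lambda>z. C * exp (- z\<^sup>2 / 2))"
      by (intro integrable_mult_right integrable_gaussian)
    show "AE z in lborel. (\<lambda>n. f (x + z / real (Suc n)) * of_real (exp (- z\<^sup>2 / 2)))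
        \<longlonglongrightarrow> f x * of_real (exp (- z\<^sup>2 / 2))"
    proof (intro AE_I2)
      fix z :: real
      have "(\<lambda>n. z / real (Suc n)) \<longlonglongrightarrow> 0"
        by (rule real_tendsto_divide_at_top[OF tendsto_const])
          (rule filterlim_compose[OF filterlim_real_sequentially filterlim_Suc])
      then have "(\<lambda>n. x + z / real (Suc n)) \<longlonglongrightarrow> x + 0"
        by (intro tendsto_intros)
      then have "(\<lambda>n. f (x + z / real (Suc n))) \<longlonglongrightarrow> f (x + 0)"
        by (rule isCont_tendsto_compose[rotated])
          (simp add: differentiable_imp_continuous_within schwartz_differentiable assms)
      then show "(\<lambda>n. f (x + z / real (Suc n)) * of_real (exp (- z\<^sup>2 / 2))) \<longlonglongrightarrow> f x * of_real (exp (- z\<^sup>2 / 2))"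
        by (intro tendsto_intros) simp
    qed
  qed (use schwartz_measurable[OF assms] C in \<open>auto simp: norm_mult intro!: mult_right_mono\<close>)
  have "?I = (\<lambda>n. of_real (sqrt (2 * pi)) * ?J n)"
    by (rule ext) (rule ft_ft_regularized[OF assms]; simp)
  with tendsto_mult[OF tendsto_const[of "of_real (sqrt (2 * pi))"] 2]
  have "?I \<longlonglongrightarrow> of_real (sqrt (2 * pi)) * (\<integral>z. f x * of_real (exp (- z\<^sup>2 / 2)) \<partial>lborel)"
    by simp
  from LIMSEQ_unique[OF 1 this]
  have "(\<integral>\<xi>. cis (x * \<xi>) * ft (- 1) f \<xi> \<partial>lborel)
      = of_real (sqrt (2 * pi)) * (\<integral>z. f x * of_real (exp (- z\<^sup>2 / 2)) \<partial>lborel)"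
    .
  also have "\<dots> = of_real (sqrt (2 * pi)) * (f x * of_real (\<integral>z. exp (- z\<^sup>2 / 2) \<partial>lborel))"
    by (simp only: integral_mult_right_zero integral_complex_of_real)
  also have "\<dots> = of_real (sqrt (2 * pi) * sqrt (2 * pi)) * f x"
    unfolding integral_gaussian by (simp only: of_real_mult mult_ac)
  also have "\<dots> = of_real (2 * pi) * f x"
    by simp
  finally show ?thesis
    by (simp add: inv_fourier_def fourier_eq_ft)
qed

lemma inv_fourier_fourier:
  assumes "schwartz f"
  shows "inv_fourier (fourier f) = f"
  using fourier_inversion[OF assms] by auto

text \<open>Uniqueness is borrowed from probability: positive and negative part have equal
  transforms, and after division by their common mass they are probability densities with the same
  characteristic function, which Levy's theorem identifies.\<close>

lemma ft_eq_0_imp_AE_eq_0_real: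
  fixes a :: "real \<Rightarrow> real"
  assumes a: "integrable lborel a" and ft0: "\<And>t. ft 1 (\<lambda>x. of_real (a x)) t = 0"
  shows "AE x in lborel. a x = 0"
proof -
  define p where "p = (\<lambda>x. max 0 (a x))"
  define n where "n = (\<lambda>x. max 0 (- a x))"
  have [measurable]: "a \<in> borel_measurable borel" using a by simp
  have int: "integrable lborel p" "integrable lborel n"
    using a unfolding p_def n_def by (auto intro: integrable_max)
  have nonneg: "p x \<ge> 0" "n x \<ge> 0" for x by (auto simp: p_def n_def)
  have [measurable]: "p \<in> borel_measurable borel" "n \<in> borel_measurable borel"
    using int by simp_all
  have apn: "a x = p x - n x" for x by (auto simp: p_def n_def)
  have ft_eq: "ft 1 (\<lambda>x. of_real (p x)) t = ft 1 (\<lambda>x. of_real (n x)) t" for t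
  proof -
    have "integrable lborel (\<lambda>x. cis (1 * (x * t)) * complex_of_real (p x))"
      "integrable lborel (\<lambda>x. cis (1 * (x * t)) * complex_of_real (n x))"
      using int by (intro integrable_cis_mult; simp)+
    then have "ft 1 (\<lambda>x. of_real (a x)) t = ft 1 (\<lambda>x. of_real (p x)) t - ft 1 (\<lambda>x. of_real (n x)) t"
      unfolding ft_def by (simp add: apn algebra_simps)
    then show ?thesis using ft0 by simp
  qed
  \<comment> \<open>At \<open>t = 0\<close> the equality of the transforms says that both parts have
    the same mass. If it vanishes, both parts vanish almost everywhere and there is nothing to
    normalise.\<close>
  define m where "m = (\<integral>x. p x \<partial>lborel)"
  have m: "m = (\<integral>x. n x \<partial>lborel)"
    using ft_eq[of 0] by (simp add: m_def ft_def)
  show ?thesis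
  proof (cases "m = 0")
    case True
    then have "AE x in lborel. p x = 0" "AE x in lborel. n x = 0"
      using integral_nonneg_eq_0_iff_AE[OF int(1)] integral_nonneg_eq_0_iff_AE[OF int(2)] nonneg
        m_def m by simp_all
    then show ?thesis by eventually_elim (simp add: apn)
  next
    case False
    have "m \<ge> 0" unfolding m_def by (simp add: nonneg)
    with False have mpos: "m > 0" by simp
    have dist: "real_distribution (density lborel (\<lambda>x. ennreal (q x / m)))"
      if "integrable lborel q" "\<And>x. q x \<ge> 0" "m = (\<integral>x. q x \<partial>lborel)" for q :: "real \<Rightarrow> real"
    proof -
      have [measurable]: "q \<in> borel_measurable borel" using that by simp
      have "(\<integral>\<^sup>+x. ennreal (q x / m) \<partial>lborel) = ennreal (\<integral>x. q x / m \<partial>lborel)"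
        using that mpos by (intro nn_integral_eq_integral) auto
      also have "\<dots> = 1" using that mpos by simp
      finally show ?thesis
        by (intro real_distribution.intro prob_spaceI real_distribution_axioms.intro)
          (auto simp: emeasure_density)
    qed
    have ch: "char (density lborel (\<lambda>x. ennreal (q x / m))) t = ft 1 (\<lambda>x. of_real (q x)) t / m"
      if "integrable lborel q" "\<And>x. q x \<ge> 0" for q :: "real \<Rightarrow> real" and t
    proof -
      have [measurable]: "q \<in> borel_measurable borel" using that by simp
      have "char (density lborel (\<lambda>x. ennreal (q x / m))) t = (\<integral>x. (q x / m) *\<^sub>R iexp (t * x) \<partial>lborel)"
        unfolding char_def using that mpos by (subst integral_density) auto
      also have "\<dots> = (\<integral>x. cis (1 * (x * t)) * of_real (q x) / m \<partial>lborel)"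
        by (simp add: cis_conv_exp scaleR_conv_of_real mult_ac)
      finally show ?thesis by (simp only: ft_def integral_divide_zero)
    qed
    have "density lborel (\<lambda>x. ennreal (p x / m)) = density lborel (\<lambda>x. ennreal (n x / m))"
    proof (intro Levy_uniqueness dist int nonneg m m_def)
      show "char (density lborel (\<lambda>x. ennreal (p x / m))) = char (density lborel (\<lambda>x. ennreal (n x / m)))"
        by (rule ext) (simp only: ch[OF int(1) nonneg(1)] ch[OF int(2) nonneg(2)] ft_eq)
    qed
    then have "AE x in lborel. ennreal (p x / m) = ennreal (n x / m)"
      by (intro sigma_finite_measure.density_unique[OF sigma_finite_lborel]) auto
    then show ?thesis
      by eventually_elim (use mpos nonneg in \<open>simp add: apn\<close>)
  qed
qed

lemma ft_cnj: "ft 1 (\<lambda>x. cnj (h x)) t = cnj (ft 1 h (- t))"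
proof -
  have "cnj (ft 1 h (- t)) = (\<integral>x. cnj (cis (1 * (x * - t)) * h x) \<partial>lborel)"
    unfolding ft_def by (simp only: Bochner_Integration.integral_cnj)
  then show ?thesis by (simp add: ft_def cis_cnj)
qed

text \<open>Real and imaginary part are combinations of \<open>h\<close> and its conjugate, whose
  transform vanishes as well by \<open>ft_cnj\<close>; the real case applies to each.\<close>

lemma ft_eq_0_imp_AE_eq_0:
  assumes h: "integrable lborel h" and ft0: "\<And>t. ft 1 h t = 0"
  shows "AE x in lborel. h x = 0"
proof -
  have i: "integrable lborel (\<lambda>x. cis (1 * (x * t)) * h x)"
    "integrable lborel (\<lambda>x. cis (1 * (x * t)) * cnj (h x))" for t
    using h by (intro integrable_cis_mult; simp)+
  have "ft 1 (\<lambda>x. of_real (Re (h x))) t = (ft 1 h t + ft 1 (\<lambda>x. cnj (h x)) t) / 2" for t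
    unfolding ft_def using i[of t]
    by (subst Bochner_Integration.integral_add[symmetric], simp, simp)
      (simp add: integral_divide_zero[symmetric] complex_add_cnj del: integral_divide_zero flip: distrib_left)
  then have re: "AE x in lborel. Re (h x) = 0"
    using h by (intro ft_eq_0_imp_AE_eq_0_real) (auto simp: ft0 ft_cnj)
  have "ft 1 (\<lambda>x. of_real (Im (h x))) t = (ft 1 h t - ft 1 (\<lambda>x. cnj (h x)) t) / (2 * \<i>)" for t
    unfolding ft_def using i[of t]
    by (subst Bochner_Integration.integral_diff[symmetric], simp, simp)
      (simp add: integral_divide_zero[symmetric] complex_diff_cnj mult.left_commute[of _ _ \<i>] mult.commute[of _ \<i>]
        del: integral_divide_zero flip: right_diff_distrib)
  then have im: "AE x in lborel. Im (h x) = 0"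
    using h by (intro ft_eq_0_imp_AE_eq_0_real) (auto simp: ft0 ft_cnj)
  from re im show ?thesis by eventually_elim (simp add: complex_eq_iff)
qed

text \<open>Densities need not be integrable, but their products with a Gaussian are. The transform
  of such a product pairs the density with the Schwartz function \<open>cis (t x)\<close> times the
  Gaussian, so it is determined by \<open>u\<close>.\<close>

lemma fourier_density_unique:
  assumes g: "fourier_density u g" and g': "fourier_density u g'"
  shows "AE x in lborel. g x = g' x"
proof -
  let ?e = "\<lambda>x::real. complex_of_real (exp (- x\<^sup>2 / 2))"
  let ?h = "\<lambda>x. (g x - g' x) * ?e x"
  have int: "integrable lborel (\<lambda>x. g x * \<phi> x)" "integrable lborel (\<lambda>x. g' x * \<phi> x)"
    and eq: "(\<integral>x. g x * \<phi> x \<partial>lborel) = (\<integral>x. g' x * \<phi> x \<partial>lborel)" if "schwartz \<phi>" for \<phi>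
    using g g' that unfolding fourier_density_def by metis+
  have "AE x in lborel. ?h x = 0"
  proof (rule ft_eq_0_imp_AE_eq_0)
    show "integrable lborel ?h"
      using int[OF schwartz_gaussian] by (simp add: left_diff_distrib)
    fix t
    have s: "schwartz (\<lambda>x. cis (0 * x\<^sup>2 + t * x) * ?e x)"
      by (intro schwartz_cis_mult schwartz_gaussian)
    have "ft 1 ?h t = (\<integral>x. g x * (cis (0 * x\<^sup>2 + t * x) * ?e x) - g' x * (cis (0 * x\<^sup>2 + t * x) * ?e x) \<partial>lborel)"
      unfolding ft_def by (rule Bochner_Integration.integral_cong) (simp_all add: algebra_simps)
    also have "\<dots> = 0"
      by (subst Bochner_Integration.integral_diff[OF int[OF s]]) (simp only: eq[OF s] diff_self)
    finally show "ft 1 ?h t = 0" .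
  qed
  then show ?thesis by eventually_elim simp
qed

subsection \<open>Seminormed spaces on carriers\<close>

text \<open>The record \<open>nvs\<close> carries no axioms. These are the ones behind all norm
  estimates below; they pass to products and to spaces of curves.\<close>

locale snvs =
  fixes X :: "'a::real_vector nvs"
  assumes zero_mem: "0 \<in> vecs X"
    and add_mem: "x \<in> vecs X \<Longrightarrow> y \<in> vecs X \<Longrightarrow> x + y \<in> vecs X"
    and scale_mem: "x \<in> vecs X \<Longrightarrow> c *\<^sub>R x \<in> vecs X"
    and nrm_nonneg: "x \<in> vecs X \<Longrightarrow> 0 \<le> nrm X x"
    and nrm_scale: "x \<in> vecs X \<Longrightarrow> nrm X (c *\<^sub>R x) = \<bar>c\<bar> * nrm X x"
    and nrm_triangle: "x \<in> vecs X \<Longrightarrow> y \<in> vecs X \<Longrightarrow> nrm X (x + y) \<le> nrm X x + nrm X y"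
begin

lemma diff_mem: "x \<in> vecs X \<Longrightarrow> y \<in> vecs X \<Longrightarrow> x - y \<in> vecs X"
  using add_mem[OF _ scale_mem, of x y "- 1"] by simp

lemma nrm_zero: "nrm X 0 = 0"
  using nrm_scale[OF zero_mem, of 0] by simp

lemma nrm_diff_triangle: "x \<in> vecs X \<Longrightarrow> y \<in> vecs X \<Longrightarrow> nrm X x \<le> nrm X (x - y) + nrm X y"
  using nrm_triangle[OF diff_mem[of x y], of y] by simp

lemma nrm_triangle_sub: "x \<in> vecs X \<Longrightarrow> y \<in> vecs X \<Longrightarrow> nrm X (x - y) \<le> nrm X x + nrm X y"
  using nrm_triangle[OF _ scale_mem, of x y "- 1"] nrm_scale[of y "- 1"] by simp

end

lemma snvs_prod_space:
  assumes "snvs X" "snvs Y"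
  shows "snvs (prod_space X Y)"
proof -
  interpret X: snvs X by fact
  interpret Y: snvs Y by fact
  show ?thesis
  proof (standard, goal_cases)
    case (6 x y)
    obtain x1 x2 y1 y2 where xy: "x = (x1, x2)" "y = (y1, y2)" by fastforce
    have m: "x1 \<in> vecs X" "y1 \<in> vecs X" "x2 \<in> vecs Y" "y2 \<in> vecs Y"
      using 6 xy by (auto simp: prod_space_def)
    have "sqrt ((nrm X (x1 + y1))\<^sup>2 + (nrm Y (x2 + y2))\<^sup>2)
      \<le> sqrt ((nrm X x1 + nrm X y1)\<^sup>2 + (nrm Y x2 + nrm Y y2)\<^sup>2)"
      using m X.nrm_triangle Y.nrm_triangle X.nrm_nonneg Y.nrm_nonneg X.add_mem Y.add_mem
      by (intro real_sqrt_le_mono add_mono power_mono) auto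
    also have "\<dots> \<le> sqrt ((nrm X x1)\<^sup>2 + (nrm Y x2)\<^sup>2) + sqrt ((nrm X y1)\<^sup>2 + (nrm Y y2)\<^sup>2)"
      by (rule real_sqrt_sum_squares_triangle_ineq)
    finally show ?case by (simp add: prod_space_def xy)
  next
    case (5 x c)
    then show ?case
      by (auto simp: prod_space_def X.nrm_scale Y.nrm_scale power_mult_distrib real_sqrt_mult simp flip: distrib_left)
  qed (auto simp: prod_space_def zero_prod_def X.zero_mem Y.zero_mem X.add_mem Y.add_mem X.scale_mem Y.scale_mem)
qed

context snvs
begin

text \<open>The real \<open>SUP\<close> of an unbounded set is arbitrary, so finiteness must come
  first. By compactness of \<open>{0..T}\<close>, finitely many intervals of oscillation below 1
  suffice.\<close>

lemma curve_space_bdd: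
  assumes "u \<in> vecs (curve_space T X)"
  shows "bdd_above ((\<lambda>t. nrm X (u t)) ` {0..T})"
proof -
  have mem: "t \<in> {0..T} \<Longrightarrow> u t \<in> vecs X" for t
    using assms by (simp add: curve_space_def)
  have "\<exists>d>0. \<forall>t'\<in>{0..T}. \<bar>t' - t\<bar> < d \<longrightarrow> nrm X (u t' - u t) < 1" if "t \<in> {0..T}" for t
    using assms that by (simp add: curve_space_def)
  then obtain d where d: "\<And>t. t \<in> {0..T} \<Longrightarrow> d t > 0"
    "\<And>t t'. t \<in> {0..T} \<Longrightarrow> t' \<in> {0..T} \<Longrightarrow> \<bar>t' - t\<bar> < d t \<Longrightarrow> nrm X (u t' - u t) < 1"
    by metis
  have cover: "{0..T} \<subseteq> (\<Union>t\<in>{0..T}. ball t (d t))"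
    using d(1) by force
  obtain C where C: "C \<subseteq> {0..T}" "finite C" "{0..T} \<subseteq> (\<Union>t\<in>C. ball t (d t))"
    using compactE_image[OF compact_Icc _ cover] by auto
  have "nrm X (u t) \<le> (\<Sum>s\<in>C. 1 + nrm X (u s))" if t: "t \<in> {0..T}" for t
  proof -
    obtain s where s: "s \<in> C" "\<bar>t - s\<bar> < d s"
      using C(3) t by (auto simp: dist_real_def abs_minus_commute subset_iff)
    have "nrm X (u t) \<le> nrm X (u t - u s) + nrm X (u s)"
      using s C t by (intro nrm_diff_triangle mem) auto
    also have "\<dots> \<le> 1 + nrm X (u s)"
      using d(2)[of s t] s C t by (simp add: less_imp_le subset_iff)
    also have "\<dots> \<le> (\<Sum>s\<in>C. 1 + nrm X (u s))"
      using C s by (intro member_le_sum) (auto intro!: add_nonneg_nonneg nrm_nonneg mem)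
    finally show ?thesis .
  qed
  then show ?thesis by (rule bdd_aboveI2)
qed

lemma curve_nrm_le:
  assumes "u \<in> vecs (curve_space T X)" "t \<in> {0..T}"
  shows "nrm X (u t) \<le> nrm (curve_space T X) u"
  unfolding curve_space_def
  using cSUP_upper[OF assms(2) curve_space_bdd[OF assms(1)]] by simp

lemma snvs_curve_space:
  assumes "T \<ge> 0"
  shows "snvs (curve_space T X)"
proof
  let ?Y = "curve_space T X"
  have ne: "{0..T} \<noteq> {}" using assms by simp
  have contD: "\<exists>d>0. \<forall>t'\<in>{0..T}. \<bar>t' - t\<bar> < d \<longrightarrow> nrm X (u t' - u t) < e"
    if "u \<in> vecs ?Y" "t \<in> {0..T}" "e > 0" for u t e
    using that by (simp add: curve_space_def)
  have memD: "u t \<in> vecs X" if "u \<in> vecs ?Y" "t \<in> {0..T}" for u t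
    using that by (simp add: curve_space_def)
  show "0 \<in> vecs ?Y" by (auto simp: curve_space_def zero_mem nrm_zero intro: exI[of _ 1])
  show add: "u + v \<in> vecs ?Y" if uv: "u \<in> vecs ?Y" "v \<in> vecs ?Y" for u v
    unfolding curve_space_def
  proof (simp, intro conjI allI impI ballI)
    show "(0 \<le> t \<longrightarrow> \<not> t \<le> T) \<Longrightarrow> u t + v t = 0" for t
      using uv by (auto simp: curve_space_def)
    show "t \<in> {0..T} \<Longrightarrow> u t + v t \<in> vecs X" for t
      using memD uv by (auto intro: add_mem)
    fix t e :: real assume t: "t \<in> {0..T}" and e: "e > 0"
    then have "e / 2 > 0" by simp
    obtain d1 where d1: "d1 > 0" "\<And>t'. t' \<in> {0..T} \<Longrightarrow> \<bar>t' - t\<bar> < d1 \<Longrightarrow> nrm X (u t' - u t) < e / 2"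
      using contD[OF uv(1) t \<open>e / 2 > 0\<close>] by blast
    obtain d2 where d2: "d2 > 0" "\<And>t'. t' \<in> {0..T} \<Longrightarrow> \<bar>t' - t\<bar> < d2 \<Longrightarrow> nrm X (v t' - v t) < e / 2"
      using contD[OF uv(2) t \<open>e / 2 > 0\<close>] by blast
    have "nrm X (u t' + v t' - (u t + v t)) < e"
      if "t' \<in> {0..T}" "\<bar>t' - t\<bar> < min d1 d2" for t'
    proof -
      have "nrm X ((u t' - u t) + (v t' - v t)) \<le> nrm X (u t' - u t) + nrm X (v t' - v t)"
        using t that uv by (intro nrm_triangle diff_mem memD)
      also have "\<dots> < e" using d1(2)[of t'] d2(2)[of t'] that by simp
      finally show ?thesis by (simp add: algebra_simps)
    qed
    then show "\<exists>d>0. \<forall>t'\<in>{0..T}. \<bar>t' - t\<bar> < d \<longrightarrow> nrm X (u t' + v t' - (u t + v t)) < e"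
      using d1(1) d2(1) by (intro exI[of _ "min d1 d2"]) auto
  qed
  show "c *\<^sub>R u \<in> vecs ?Y" if u: "u \<in> vecs ?Y" for u c
    unfolding curve_space_def
  proof (simp add: scaleR_fun_def, intro conjI allI impI ballI)
    show "(0 \<le> t \<longrightarrow> \<not> t \<le> T) \<Longrightarrow> c = 0 \<or> u t = 0" for t
      using u by (auto simp: curve_space_def)
    show "t \<in> {0..T} \<Longrightarrow> c *\<^sub>R u t \<in> vecs X" for t
      using memD u by (auto intro: scale_mem)
    fix t e :: real assume t: "t \<in> {0..T}" and e: "e > 0"
    then have "e / (\<bar>c\<bar> + 1) > 0" by simp
    then obtain d where d: "d > 0" "\<And>t'. t' \<in> {0..T} \<Longrightarrow> \<bar>t' - t\<bar> < d \<Longrightarrow> nrm X (u t' - u t) < e / (\<bar>c\<bar> + 1)"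
      using contD[OF u t] by blast
    have "nrm X (c *\<^sub>R u t' - c *\<^sub>R u t) < e" if "t' \<in> {0..T}" "\<bar>t' - t\<bar> < d" for t'
    proof -
      have m: "u t' - u t \<in> vecs X" using t that u by (intro diff_mem memD)
      have "nrm X (c *\<^sub>R u t' - c *\<^sub>R u t) = \<bar>c\<bar> * nrm X (u t' - u t)"
        using nrm_scale[OF m] by (simp add: scaleR_diff_right)
      also have "\<dots> \<le> (\<bar>c\<bar> + 1) * nrm X (u t' - u t)"
        using nrm_nonneg[OF m] by (simp add: mult_right_mono)
      also have "\<dots> < e" using mult_strict_left_mono[OF d(2)[OF that], of "\<bar>c\<bar> + 1"] by simp
      finally show ?thesis .
    qed
    then show "\<exists>d>0. \<forall>t'\<in>{0..T}. \<bar>t' - t\<bar> < d \<longrightarrow> nrm X (c *\<^sub>R u t' - c *\<^sub>R u t) < e"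
      using d(1) by blast
  qed
  have nrm_eq: "nrm ?Y u = (SUP t\<in>{0..T}. nrm X (u t))" for u
    by (simp add: curve_space_def)
  show "0 \<le> nrm ?Y u" if "u \<in> vecs ?Y" for u
    using curve_nrm_le[OF that, of 0] nrm_nonneg[OF memD[OF that, of 0]] assms by auto
  show "nrm ?Y (u + v) \<le> nrm ?Y u + nrm ?Y v" if uv: "u \<in> vecs ?Y" "v \<in> vecs ?Y" for u v
    unfolding nrm_eq[of "u + v"]
  proof (rule cSUP_least[OF ne])
    fix t assume t: "t \<in> {0..T}"
    have "nrm X ((u + v) t) \<le> nrm X (u t) + nrm X (v t)"
      using uv t by (simp add: nrm_triangle memD)
    also have "\<dots> \<le> nrm ?Y u + nrm ?Y v"
      by (intro add_mono curve_nrm_le uv t)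
    finally show "nrm X ((u + v) t) \<le> nrm ?Y u + nrm ?Y v" .
  qed
  show "nrm ?Y (c *\<^sub>R u) = \<bar>c\<bar> * nrm ?Y u" if u: "u \<in> vecs ?Y" for u c
  proof -
    have "nrm ?Y (c *\<^sub>R u) = (SUP t\<in>{0..T}. \<bar>c\<bar> * nrm X (u t))"
      unfolding nrm_eq by (intro SUP_cong) (auto simp: scaleR_fun_def nrm_scale memD[OF u])
    also have "\<dots> = \<bar>c\<bar> * (SUP t\<in>{0..T}. nrm X (u t))"
    proof (rule continuous_at_Sup_mono[of "(*) \<bar>c\<bar>" "(\<lambda>t. nrm X (u t)) ` {0..T}", symmetric, unfolded image_image])
      show "mono ((*) \<bar>c\<bar>)" by (rule monoI) (simp add: mult_left_mono)
    qed (use ne curve_space_bdd[OF u] in \<open>auto intro!: continuous_intros\<close>)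
    finally show ?thesis by (simp add: nrm_eq)
  qed
qed

end

text \<open>The operator norm is an infimum, which is meaningful only over a nonempty set. The
  constant provided by \<open>bounded_ops\<close> may be negative and is replaced by its maximum
  with 0.\<close>

lemma bounded_ops_nrm_set:
  assumes "snvs X" and A: "A \<in> vecs (bounded_ops X Y)"
  shows "\<exists>C. 0 \<le> C \<and> (\<forall>x\<in>vecs X. nrm Y (A x) \<le> C * nrm X x)"
proof -
  interpret X: snvs X by fact
  have "\<exists>C. \<forall>x\<in>vecs X. nrm Y (A x) \<le> C * nrm X x"
    using A by (simp add: bounded_ops_def)
  then obtain C where C: "\<And>x. x \<in> vecs X \<Longrightarrow> nrm Y (A x) \<le> C * nrm X x"
    by blast
  have "nrm Y (A x) \<le> max C 0 * nrm X x" if "x \<in> vecs X" for x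
    using C[OF that] X.nrm_nonneg[OF that] by (meson max.cobounded1 mult_right_mono order_trans)
  then show ?thesis by (intro exI[of _ "max C 0"]) auto
qed

text \<open>The infimum is itself admissible: for \<open>nrm X x > 0\<close> divide by it, and for
  \<open>nrm X x = 0\<close> any admissible constant gives the bound 0.\<close>

lemma bounded_ops_nrm_le:
  assumes X: "snvs X" and A: "A \<in> vecs (bounded_ops X Y)" and x: "x \<in> vecs X"
  shows "nrm Y (A x) \<le> nrm (bounded_ops X Y) A * nrm X x"
proof -
  interpret X: snvs X by fact
  let ?S = "{C. 0 \<le> C \<and> (\<forall>x\<in>vecs X. nrm Y (A x) \<le> C * nrm X x)}"
  have ne: "?S \<noteq> {}" using bounded_ops_nrm_set[OF X A] by blast
  show ?thesis
  proof (cases "nrm X x = 0")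
    case True
    from ne obtain C where "C \<in> ?S" by blast
    then show ?thesis using x True by auto
  next
    case False
    then have pos: "nrm X x > 0" using X.nrm_nonneg[OF x] by simp
    have "nrm Y (A x) / nrm X x \<le> Inf ?S"
      by (rule cInf_greatest[OF ne]) (use x pos in \<open>auto simp: pos_divide_le_eq\<close>)
    then show ?thesis using pos by (simp add: bounded_ops_def pos_divide_le_eq)
  qed
qed

lemma bounded_ops_diff_mem:
  assumes X: "snvs X" and Y: "snvs Y" and A: "A \<in> vecs (bounded_ops X Y)" and B: "B \<in> vecs (bounded_ops X Y)"
  shows "A - B \<in> vecs (bounded_ops X Y)"
proof -
  interpret X: snvs X by fact
  interpret Y: snvs Y by fact
  obtain C where C: "\<And>x. x \<in> vecs X \<Longrightarrow> nrm Y (A x) \<le> C * nrm X x"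
    using bounded_ops_nrm_set[OF X A] by blast
  obtain D where D: "\<And>x. x \<in> vecs X \<Longrightarrow> nrm Y (B x) \<le> D * nrm X x"
    using bounded_ops_nrm_set[OF X B] by blast
  have mem: "A x \<in> vecs Y" "B x \<in> vecs Y" if "x \<in> vecs X" for x
    using that A B by (auto simp: bounded_ops_def)
  have "nrm Y (A x - B x) \<le> (C + D) * nrm X x" if "x \<in> vecs X" for x
    using Y.nrm_triangle_sub[OF mem[OF that]] C[OF that] D[OF that] by (simp add: distrib_right)
  then have "\<exists>C. \<forall>x\<in>vecs X. nrm Y (A x - B x) \<le> C * nrm X x" by blast
  moreover have "A x - B x \<in> vecs Y" if "x \<in> vecs X" for x
    using mem[OF that] by (rule Y.diff_mem)
  ultimately show ?thesis
    using A B by (simp add: bounded_ops_def scaleR_diff_right)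
qed

text \<open>Along the line through \<open>h\<close> the scalar function \<open>l (f (s h))\<close>
  has second derivative \<open>l (f''(0) h h)\<close> at 0. Its quadratic coefficient is half of
  that, and the operator norm of \<open>f''(0)\<close> controls it. The constant is chosen before
  \<open>h\<close> and \<open>l\<close>; this uniformity is what the wave packets
  contradict.\<close>

lemma C2_at_second_order:
  assumes X: "snvs X" and Y: "snvs Y" and C2: "C2_at X Y f 0"
  obtains C where "\<And>h (l :: _ \<Rightarrow> complex) L a1 a2 K s0.
    \<lbrakk>h \<in> vecs X; \<And>u v. u \<in> vecs Y \<Longrightarrow> v \<in> vecs Y \<Longrightarrow> l (u - v) = l u - l v;
     \<And>c u. u \<in> vecs Y \<Longrightarrow> l (c *\<^sub>R u) = c *\<^sub>R l u;
     \<And>u. u \<in> vecs Y \<Longrightarrow> norm (l u) \<le> L * nrm Y u; L \<ge> 0; s0 > 0;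
     \<And>s. \<bar>s\<bar> < s0 \<Longrightarrow> norm (l (f (s *\<^sub>R h)) - s *\<^sub>R a1 - s\<^sup>2 *\<^sub>R a2) \<le> K * \<bar>s\<bar> ^ 3\<rbrakk>
    \<Longrightarrow> norm a2 \<le> C * L * (nrm X h)\<^sup>2"
proof -
  interpret X: snvs X by fact
  interpret Y: snvs Y by fact
  obtain r f' f'' where r: "r > 0"
    and f: "\<And>y. y \<in> vecs X \<Longrightarrow> nrm X y < r \<Longrightarrow> f y \<in> vecs Y"
    and f': "\<And>y. y \<in> vecs X \<Longrightarrow> nrm X y < r \<Longrightarrow> has_frechet_deriv X Y f (f' y) y"
    and f'': "\<And>y. y \<in> vecs X \<Longrightarrow> nrm X y < r \<Longrightarrow> has_frechet_deriv X (bounded_ops X Y) f' (f'' y) y"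
    using C2 unfolding C2_at_def by auto
  define B where "B = f'' 0"
  have B: "has_frechet_deriv X (bounded_ops X Y) f' B 0"
    unfolding B_def using f''[OF X.zero_mem] r by (simp add: X.nrm_zero)
  then have Bmem: "B \<in> vecs (bounded_ops X (bounded_ops X Y))"
    by (simp add: has_frechet_deriv_def)
  have Bx: "B x \<in> vecs (bounded_ops X Y)" if "x \<in> vecs X" for x
    using Bmem that by (simp add: bounded_ops_def)
  have f'mem: "f' y \<in> vecs (bounded_ops X Y)" if "y \<in> vecs X" "nrm X y < r" for y
    using f'[OF that] by (simp add: has_frechet_deriv_def)
  define C where "C = nrm (bounded_ops X (bounded_ops X Y)) B / 2"
  show thesis
  proof (rule that[of C])
    fix h and l :: "'b \<Rightarrow> complex" and L a1 a2 K s0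
    assume h: "h \<in> vecs X" and l_diff: "\<And>u v. u \<in> vecs Y \<Longrightarrow> v \<in> vecs Y \<Longrightarrow> l (u - v) = l u - l v"
      and l_scale: "\<And>c u. u \<in> vecs Y \<Longrightarrow> l (c *\<^sub>R u) = c *\<^sub>R l u"
      and l_bound: "\<And>u. u \<in> vecs Y \<Longrightarrow> norm (l u) \<le> L * nrm Y u" and L: "L \<ge> 0" and s0: "s0 > 0"
      and expansion: "\<And>s. \<bar>s\<bar> < s0 \<Longrightarrow> norm (l (f (s *\<^sub>R h)) - s *\<^sub>R a1 - s\<^sup>2 *\<^sub>R a2) \<le> K * \<bar>s\<bar> ^ 3"
    define H where "H = nrm X h"
    have H: "H \<ge> 0" unfolding H_def by (rule X.nrm_nonneg[OF h])
    \<comment> \<open>The denominator \<open>H + 1\<close> stays positive when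
      \<open>H = 0\<close>.\<close>
    define \<rho> where "\<rho> = r / (H + 1)"
    have \<rho>: "\<rho> > 0" unfolding \<rho>_def using r H by simp
    have mem: "s *\<^sub>R h \<in> vecs X" for s by (rule X.scale_mem[OF h])
    have nrm: "nrm X (s *\<^sub>R h) = \<bar>s\<bar> * H" for s by (simp add: X.nrm_scale[OF h] H_def)
    have lt: "nrm X (s *\<^sub>R h) < r" if "\<bar>s\<bar> < \<rho>" for s
    proof -
      have "\<bar>s\<bar> * H \<le> \<bar>s\<bar> * (H + 1)" by (simp add: mult_left_mono)
      also have "\<dots> < \<rho> * (H + 1)" using that H by (intro mult_strict_right_mono) auto
      also have "\<dots> = r" using H by (simp add: \<rho>_def)
      finally show ?thesis by (simp add: nrm)
    qed
    define g where "g = (\<lambda>s. l (f (s *\<^sub>R h)))"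
    define D where "D = (\<lambda>s. l (f' (s *\<^sub>R h) h))"
    define \<kappa> where "\<kappa> = l (B h h)"
    have opD: "A (c *\<^sub>R x) = c *\<^sub>R A x" "A x \<in> vecs Y" if "A \<in> vecs (bounded_ops X Y)" "x \<in> vecs X" for A c x
      using that by (simp_all add: bounded_ops_def)
    have deriv: "(g has_vector_derivative D s) (at s)" if s: "\<bar>s\<bar> < \<rho>" for s
      unfolding has_vector_derivative_def has_derivative_at_alt
    proof (intro conjI allI impI bounded_linear_scaleR_left)
      fix e :: real assume "e > 0"
      define e' where "e' = e / (L * H + 1)"
      have LH: "L * H \<ge> 0" using L H by simp
      then have e': "e' > 0" using \<open>e > 0\<close> by (simp add: e'_def)
      obtain d where d: "d > 0" "\<And>k. k \<in> vecs X \<Longrightarrow> nrm X k < d \<Longrightarrow>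
          nrm Y (f (s *\<^sub>R h + k) - f (s *\<^sub>R h) - f' (s *\<^sub>R h) k) \<le> e' * nrm X k"
        using f'[OF mem lt[OF s]] e' unfolding has_frechet_deriv_def by blast
      have "norm (g y - g s - (y - s) *\<^sub>R D s) \<le> e * norm (y - s)"
        if y: "norm (y - s) < min (\<rho> - \<bar>s\<bar>) (d / (H + 1))" for y
      proof -
        have y\<rho>: "\<bar>y\<bar> < \<rho>" using y by auto
        have "\<bar>y - s\<bar> * H \<le> \<bar>y - s\<bar> * (H + 1)" by (simp add: mult_left_mono)
        also have "\<dots> < d" using y H by (simp add: pos_less_divide_eq)
        finally have small: "nrm X ((y - s) *\<^sub>R h) < d" by (simp only: nrm)
        have m: "f (y *\<^sub>R h) \<in> vecs Y" "f (s *\<^sub>R h) \<in> vecs Y" "f' (s *\<^sub>R h) h \<in> vecs Y"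
          "f' (s *\<^sub>R h) ((y - s) *\<^sub>R h) \<in> vecs Y"
          by (intro f mem lt s y\<rho> opD f'mem h)+
        have "g y - g s - (y - s) *\<^sub>R D s = l (f (y *\<^sub>R h) - f (s *\<^sub>R h) - f' (s *\<^sub>R h) ((y - s) *\<^sub>R h))"
          using m by (simp add: g_def D_def l_diff l_scale Y.diff_mem opD(1)[OF f'mem[OF mem lt[OF s]] h])
        then have "norm (g y - g s - (y - s) *\<^sub>R D s) \<le> L * nrm Y (f (y *\<^sub>R h) - f (s *\<^sub>R h) - f' (s *\<^sub>R h) ((y - s) *\<^sub>R h))"
          using m by (simp add: l_bound Y.diff_mem)
        also have "\<dots> \<le> L * (e' * (\<bar>y - s\<bar> * H))"
        proof (intro mult_left_mono L)
          have "s *\<^sub>R h + (y - s) *\<^sub>R h = y *\<^sub>R h" by (simp add: algebra_simps)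
          with d(2)[OF mem small] show "nrm Y (f (y *\<^sub>R h) - f (s *\<^sub>R h) - f' (s *\<^sub>R h) ((y - s) *\<^sub>R h)) \<le> e' * (\<bar>y - s\<bar> * H)"
            by (simp only: nrm)
        qed
        also have "\<dots> = (L * H) * e' * \<bar>y - s\<bar>" by simp
        also have "\<dots> \<le> (L * H + 1) * e' * \<bar>y - s\<bar>"
          using e' by (intro mult_right_mono) auto
        also have "\<dots> = e * norm (y - s)" using LH by (simp add: e'_def)
        finally show ?thesis .
      qed
      moreover have "min (\<rho> - \<bar>s\<bar>) (d / (H + 1)) > 0" using s d H by simp
      ultimately show "\<exists>d>0. \<forall>y. norm (y - s) < d \<longrightarrow> norm (g y - g s - (y - s) *\<^sub>R D s) \<le> e * norm (y - s)"
        by blast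
    qed
    \<comment> \<open>The linear terms \<open>s a1\<close> and \<open>s D 0\<close> are not yet
      known to agree, but they are odd in \<open>s\<close>: adding the expansions at
      \<open>s\<close> and \<open>- s\<close> removes both. The limit \<open>s -> 0\<close> then
      leaves \<open>2 a2 = \<kappa>\<close> up to \<open>e\<close>.\<close>
    have key: "norm (2 *\<^sub>R a2 - \<kappa>) \<le> e" if "e > 0" for e
    proof -
      define q where "q = L * H\<^sup>2 + 1"
      define e' where "e' = e / 4 / q"
      have "L * H\<^sup>2 \<ge> 0" using L by simp
      then have q: "q > 0" by (simp add: q_def)
      then have e': "e' > 0" using \<open>e > 0\<close> by (simp add: e'_def)
      obtain d where d: "d > 0" "\<And>k. k \<in> vecs X \<Longrightarrow> nrm X k < d \<Longrightarrow>
          nrm (bounded_ops X Y) (f' (0 + k) - f' 0 - B k) \<le> e' * nrm X k"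
        using B e' unfolding has_frechet_deriv_def by blast
      have D_bound: "norm (D s - D 0 - s *\<^sub>R \<kappa>) \<le> e / 4 * \<bar>s\<bar>" if s: "\<bar>s\<bar> < \<rho>" "\<bar>s\<bar> < d / (H + 1)" for s
      proof -
        have "\<bar>s\<bar> * H \<le> \<bar>s\<bar> * (H + 1)" by (simp add: mult_left_mono)
        also have "\<dots> < d" using s H by (simp add: pos_less_divide_eq)
        finally have small: "nrm X (s *\<^sub>R h) < d" by (simp only: nrm)
        have m0: "f' 0 \<in> vecs (bounded_ops X Y)"
          using f'mem[OF X.zero_mem] r by (simp add: X.nrm_zero)
        have ops: "f' (s *\<^sub>R h) \<in> vecs (bounded_ops X Y)" "f' 0 \<in> vecs (bounded_ops X Y)"
          "B (s *\<^sub>R h) \<in> vecs (bounded_ops X Y)" "B h \<in> vecs (bounded_ops X Y)"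
          by (intro f'mem m0 mem lt s Bx h)+
        have "B (s *\<^sub>R h) = s *\<^sub>R B h"
          using Bmem h by (simp add: bounded_ops_def)
        then have "D s - D 0 - s *\<^sub>R \<kappa> = l ((f' (s *\<^sub>R h) - f' 0 - B (s *\<^sub>R h)) h)"
          using ops h by (simp add: D_def \<kappa>_def l_diff l_scale Y.diff_mem Y.scale_mem opD scaleR_fun_def)
        also have "norm \<dots> \<le> L * nrm Y ((f' (s *\<^sub>R h) - f' 0 - B (s *\<^sub>R h)) h)"
          by (intro l_bound opD(2) bounded_ops_diff_mem X Y ops h)
        also have "\<dots> \<le> L * (nrm (bounded_ops X Y) (f' (s *\<^sub>R h) - f' 0 - B (s *\<^sub>R h)) * H)"
          unfolding H_def by (intro mult_left_mono L bounded_ops_nrm_le bounded_ops_diff_mem X Y ops h)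
        also have "\<dots> \<le> L * ((e' * (\<bar>s\<bar> * H)) * H)"
          using d(2)[OF mem small] by (intro mult_left_mono mult_right_mono L H) (simp add: nrm)
        also have "\<dots> = (L * H\<^sup>2) * e' * \<bar>s\<bar>" by (simp add: power2_eq_square)
        also have "\<dots> \<le> (L * H\<^sup>2 + 1) * e' * \<bar>s\<bar>"
          using e' by (intro mult_right_mono) auto
        also have "(L * H\<^sup>2 + 1) * e' = e / 4"
          unfolding e'_def q_def[symmetric] using q by simp
        finally show ?thesis .
      qed
      \<comment> \<open>\<open>G\<close> is \<open>g\<close> minus its expected linear and quadratic
        terms. Differentiability of \<open>f'\<close> at 0 bounds its derivative by
        \<open>e / 4 * |s|\<close>, hence the mean value inequality bounds \<open>G s - G 0\<close>
        by \<open>e / 4 * s^2\<close>.\<close>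
      define G where "G = (\<lambda>s. g s - s *\<^sub>R D 0 - (s\<^sup>2 / 2) *\<^sub>R \<kappa>)"
      have G_bound: "norm (G s - G 0) \<le> e / 4 * s\<^sup>2" if s: "\<bar>s\<bar> < \<rho>" "\<bar>s\<bar> < d / (H + 1)" for s
      proof -
        have seg: "\<bar>x\<bar> \<le> \<bar>s\<bar>" if "x \<in> closed_segment 0 s" for x
          using that by (auto simp: closed_segment_eq_real_ivl split: if_splits)
        have "norm (G s - G 0 - (s - 0) *\<^sub>R (D 0 - D 0 - 0 *\<^sub>R \<kappa>)) \<le> norm (s - 0) * (e / 4 * \<bar>s\<bar>)"
        proof (rule vector_differentiable_bound_linearization[where S = "closed_segment 0 s" and f' = "\<lambda>x. D x - D 0 - x *\<^sub>R \<kappa>"])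
          fix x assume x: "x \<in> closed_segment 0 s"
          have "(g has_vector_derivative D x) (at x)"
            using seg[OF x] s by (intro deriv) simp
          then have "(G has_vector_derivative D x - D 0 - x *\<^sub>R \<kappa>) (at x)"
            unfolding G_def
          proof (rule has_vector_derivative_diff[OF has_vector_derivative_diff])
            show "((\<lambda>s. s *\<^sub>R D 0) has_vector_derivative D 0) (at x)"
              using has_vector_derivative_scaleR[OF DERIV_ident has_vector_derivative_const, of _ x] by simp
            have "((\<lambda>s::real. s\<^sup>2 / 2) has_real_derivative x) (at x)"
              by (rule DERIV_cong[OF DERIV_cdivide[OF DERIV_power[OF DERIV_ident]]]) simp
            from has_vector_derivative_scaleR[OF this has_vector_derivative_const, of \<kappa>]
            show "((\<lambda>s. (s\<^sup>2 / 2) *\<^sub>R \<kappa>) has_vector_derivative x *\<^sub>R \<kappa>) (at x)" by simp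
          qed
          then show "(G has_vector_derivative D x - D 0 - x *\<^sub>R \<kappa>) (at x within closed_segment 0 s)"
            by (rule has_vector_derivative_at_within)
          have "norm (D x - D 0 - x *\<^sub>R \<kappa>) \<le> e / 4 * \<bar>x\<bar>"
            using seg[OF x] s by (intro D_bound) auto
          also have "\<dots> \<le> e / 4 * \<bar>s\<bar>" using seg[OF x] \<open>e > 0\<close> by simp
          finally show "norm (D x - D 0 - x *\<^sub>R \<kappa> - (D 0 - D 0 - 0 *\<^sub>R \<kappa>)) \<le> e / 4 * \<bar>s\<bar>" by simp
        qed auto
        then show ?thesis by (simp add: power2_eq_square mult_ac)
      qed
      have "norm (2 *\<^sub>R a2 - \<kappa>) \<le> e / 2 + 2 * K * s"
        if s: "0 < s" "s < \<rho>" "s < d / (H + 1)" "s < s0" for s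
      proof -
        have exp0: "norm (g s - s *\<^sub>R a1 - s\<^sup>2 *\<^sub>R a2) \<le> K * s ^ 3"
          "norm (g (- s) + s *\<^sub>R a1 - s\<^sup>2 *\<^sub>R a2) \<le> K * s ^ 3" "g 0 = 0"
          using expansion[of s] expansion[of "- s"] expansion[of 0] s by (auto simp: g_def)
        have Gs: "norm (G s - G 0) \<le> e / 4 * s\<^sup>2" "norm (G (- s) - G 0) \<le> e / 4 * s\<^sup>2"
          using G_bound[of s] G_bound[of "- s"] s by auto
        have "s\<^sup>2 *\<^sub>R (2 *\<^sub>R a2 - \<kappa>) = (G s - G 0) + (G (- s) - G 0)
            - (g s - s *\<^sub>R a1 - s\<^sup>2 *\<^sub>R a2) - (g (- s) + s *\<^sub>R a1 - s\<^sup>2 *\<^sub>R a2)"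
          using exp0(3) by (simp add: G_def scaleR_conv_of_real algebra_simps)
        also have "norm \<dots> \<le> e / 4 * s\<^sup>2 + e / 4 * s\<^sup>2 + K * s ^ 3 + K * s ^ 3"
          by (rule order_trans[OF norm_triangle_ineq4 add_mono[OF order_trans[OF norm_triangle_ineq4
              add_mono[OF norm_triangle_le[OF add_mono[OF Gs]] exp0(1)]] exp0(2)]])
        finally have "s\<^sup>2 * norm (2 *\<^sub>R a2 - \<kappa>) \<le> s\<^sup>2 * (e / 2 + 2 * K * s)"
          unfolding norm_scaleR by (simp add: algebra_simps power2_eq_square power3_eq_cube)
        then show ?thesis using s by simp
      qed
      note bound = this
      have "\<forall>\<^sub>F s in at_right 0. 0 < s \<and> s < \<rho> \<and> s < d / (H + 1) \<and> s < s0"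
        using \<rho> d H s0 by (intro eventually_conj eventually_at_right_less order_tendstoD[OF tendsto_ident_at]) auto
      then have "\<forall>\<^sub>F s in at_right 0. norm (2 *\<^sub>R a2 - \<kappa>) \<le> e / 2 + 2 * K * s"
        by (rule eventually_mono) (use bound in blast)
      moreover have "((\<lambda>s. e / 2 + 2 * K * s) \<longlongrightarrow> e / 2 + 2 * K * 0) (at_right 0)"
        by (intro tendsto_intros)
      ultimately have "norm (2 *\<^sub>R a2 - \<kappa>) \<le> e / 2 + 2 * K * 0"
        by (intro tendsto_lowerbound) auto
      then show ?thesis using \<open>e > 0\<close> by simp
    qed
    have "norm (2 *\<^sub>R a2 - \<kappa>) \<le> 0" by (rule field_le_epsilon) (use key in simp)
    then have "2 *\<^sub>R a2 = \<kappa>" by simp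
    then have "2 * norm a2 = norm \<kappa>" by (metis norm_scaleR abs_numeral)
    also have "\<dots> \<le> L * nrm Y (B h h)"
      unfolding \<kappa>_def by (intro l_bound opD(2) Bx h)
    also have "\<dots> \<le> L * (nrm (bounded_ops X Y) (B h) * H)"
      unfolding H_def by (intro mult_left_mono L bounded_ops_nrm_le X Bx h)
    also have "\<dots> \<le> L * ((nrm (bounded_ops X (bounded_ops X Y)) B * H) * H)"
      unfolding H_def by (intro mult_left_mono mult_right_mono L bounded_ops_nrm_le X Bmem h X.nrm_nonneg)
    finally show "norm a2 \<le> C * L * (nrm X h)\<^sup>2"
      by (simp add: C_def H_def power2_eq_square mult_ac)
  qed
qed

subsection \<open>Sobolev spaces\<close>

lemma scaleR_fun_apply [simp]: "(c *\<^sub>R f) x = c *\<^sub>R f x"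
  by (simp add: scaleR_fun_def)

text \<open>The integral of \<open>(f - c g)^2\<close> is a nonnegative polynomial in
  \<open>c\<close> of degree at most 2; its value at \<open>c = P / B\<close> gives the
  inequality.\<close>

lemma Cauchy_Schwarz_integral:
  fixes f g :: "real \<Rightarrow> real"
  assumes [measurable]: "f \<in> borel_measurable lborel" "g \<in> borel_measurable lborel"
    and f: "integrable lborel (\<lambda>x. (f x)\<^sup>2)" and g: "integrable lborel (\<lambda>x. (g x)\<^sup>2)"
  shows "integrable lborel (\<lambda>x. f x * g x)"
    and "(\<integral>x. f x * g x \<partial>lborel) \<le> sqrt (\<integral>x. (f x)\<^sup>2 \<partial>lborel) * sqrt (\<integral>x. (g x)\<^sup>2 \<partial>lborel)"
proof -
  show fg: "integrable lborel (\<lambda>x. f x * g x)"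
  proof (rule Bochner_Integration.integrable_bound)
    show "integrable lborel (\<lambda>x. (f x)\<^sup>2 + (g x)\<^sup>2)" using f g by simp
    have "\<bar>a * b\<bar> \<le> a\<^sup>2 + b\<^sup>2" for a b :: real
    proof -
      have "0 \<le> (\<bar>a\<bar> - \<bar>b\<bar>)\<^sup>2" by simp
      then have "2 * (\<bar>a\<bar> * \<bar>b\<bar>) \<le> a\<^sup>2 + b\<^sup>2" by (simp add: power2_diff)
      moreover have "0 \<le> \<bar>a\<bar> * \<bar>b\<bar>" by simp
      ultimately show ?thesis unfolding abs_mult by linarith
    qed
    then show "AE x in lborel. norm (f x * g x) \<le> norm ((f x)\<^sup>2 + (g x)\<^sup>2)" by simp
  qed simp
  define A P B where "A = (\<integral>x. (f x)\<^sup>2 \<partial>lborel)" and "P = (\<integral>x. f x * g x \<partial>lborel)"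
    and "B = (\<integral>x. (g x)\<^sup>2 \<partial>lborel)"
  have nonneg: "A \<ge> 0" "B \<ge> 0" by (simp_all add: A_def B_def)
  have q: "0 \<le> A - 2 * c * P + c\<^sup>2 * B" for c
  proof -
    have "0 \<le> (\<integral>x. (f x - c * g x)\<^sup>2 \<partial>lborel)" by simp
    also have "(\<lambda>x. (f x - c * g x)\<^sup>2) = (\<lambda>x. (f x)\<^sup>2 - 2 * c * (f x * g x) + c\<^sup>2 * (g x)\<^sup>2)"
      by (simp add: fun_eq_iff power2_eq_square algebra_simps)
    finally show ?thesis using f g fg by (simp add: A_def B_def P_def)
  qed
  have "P\<^sup>2 \<le> A * B"
  proof (cases "B = 0")
    case True
    \<comment> \<open>For \<open>B = 0\<close> the polynomial is affine in \<open>c\<close>; at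
      \<open>c = (A + 1) / (2 * P)\<close> it would equal -1.\<close>
    have "P = 0"
    proof (rule ccontr)
      assume "P \<noteq> 0"
      with q[of "(A + 1) / (2 * P)"] True show False by (simp add: field_simps)
    qed
    then show ?thesis using nonneg by simp
  next
    case False
    then have "B > 0" using nonneg by simp
    have "0 \<le> B * (A - 2 * (P / B) * P + (P / B)\<^sup>2 * B)"
      using q[of "P / B"] \<open>B > 0\<close> by simp
    also have "\<dots> = A * B - P\<^sup>2" using \<open>B > 0\<close> by (simp add: field_simps power2_eq_square)
    finally show ?thesis by simp
  qed
  then have "P \<le> sqrt (A * B)" by (rule real_le_rsqrt)
  then show "(\<integral>x. f x * g x \<partial>lborel) \<le> sqrt (\<integral>x. (f x)\<^sup>2 \<partial>lborel) * sqrt (\<integral>x. (g x)\<^sup>2 \<partial>lborel)"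
    by (simp add: A_def B_def P_def real_sqrt_mult)
qed

definition dens :: "distr \<Rightarrow> real \<Rightarrow> complex" where
  "dens u = (SOME g. fourier_density u g)"

definition wL2 :: "real \<Rightarrow> (real \<Rightarrow> complex) \<Rightarrow> real \<Rightarrow> real" where
  "wL2 k g \<xi> = (1 + \<xi>\<^sup>2) powr k * (cmod (g \<xi>))\<^sup>2"

lemma sobolev_alt:
  "vecs (sobolev k) = {u. tempered u \<and> (\<exists>g. fourier_density u g \<and> integrable lborel (wL2 k g))}"
  "nrm (sobolev k) u = sqrt (\<integral>\<xi>. wL2 k (dens u) \<xi> \<partial>lborel)"
  by (simp_all add: sobolev_def wL2_def[abs_def] dens_def Let_def)

lemma fourier_density_dens: "fourier_density u g \<Longrightarrow> fourier_density u (dens u)"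
  unfolding dens_def by (rule someI[of "fourier_density u"])

lemma dens_AE: "fourier_density u g \<Longrightarrow> AE x in lborel. dens u x = g x"
  by (rule fourier_density_unique[OF fourier_density_dens])

lemma fourier_density_measurable: "fourier_density u g \<Longrightarrow> g \<in> borel_measurable borel"
  by (simp add: fourier_density_def)

lemma wL2_measurable [measurable]:
  "g \<in> borel_measurable borel \<Longrightarrow> wL2 k g \<in> borel_measurable borel"
  unfolding wL2_def[abs_def] by measurable

lemma wL2_nonneg: "0 \<le> wL2 k g x"
  by (simp add: wL2_def)

lemma wL2_integral_cong:
  assumes "AE x in lborel. g x = h x" "g \<in> borel_measurable borel" "h \<in> borel_measurable borel"
  shows "integrable lborel (wL2 k g) \<longleftrightarrow> integrable lborel (wL2 k h)"
    and "(\<integral>x. wL2 k g x \<partial>lborel) = (\<integral>x. wL2 k h x \<partial>lborel)"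
proof -
  have "AE x in lborel. wL2 k g x = wL2 k h x"
    using assms(1) by eventually_elim (simp add: wL2_def)
  with assms(2,3) show "integrable lborel (wL2 k g) \<longleftrightarrow> integrable lborel (wL2 k h)"
    "(\<integral>x. wL2 k g x \<partial>lborel) = (\<integral>x. wL2 k h x \<partial>lborel)"
    by (auto intro: integrable_cong_AE[THEN iffD1] integrable_cong_AE[THEN iffD2] intro!: integral_cong_AE)
qed

lemma sobolev_nrm_eq:
  assumes "fourier_density u g"
  shows "nrm (sobolev k) u = sqrt (\<integral>\<xi>. wL2 k g \<xi> \<partial>lborel)"
  using wL2_integral_cong(2)[OF dens_AE[OF assms]] fourier_density_measurable[OF assms]
    fourier_density_measurable[OF fourier_density_dens[OF assms]]
  by (simp add: sobolev_alt)

lemma sobolevD: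
  assumes "u \<in> vecs (sobolev k)"
  shows "tempered u" "fourier_density u (dens u)" "integrable lborel (wL2 k (dens u))"
    "dens u \<in> borel_measurable borel"
proof -
  obtain g where g: "tempered u" "fourier_density u g" "integrable lborel (wL2 k g)"
    using assms by (auto simp: sobolev_alt)
  show "tempered u" "fourier_density u (dens u)" "dens u \<in> borel_measurable borel"
    using g fourier_density_dens fourier_density_measurable by blast+
  then show "integrable lborel (wL2 k (dens u))"
    using wL2_integral_cong(1)[OF dens_AE[OF g(2)]] g fourier_density_measurable[OF g(2)] by simp
qed

lemma fourier_density_add:
  assumes "fourier_density u g" "fourier_density v h"
  shows "fourier_density (u + v) (\<lambda>x. g x + h x)"
  using assms unfolding fourier_density_def by (auto simp: distrib_right)

lemma fourier_density_scaleR: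
  assumes "fourier_density u g"
  shows "fourier_density (c *\<^sub>R u) (\<lambda>x. c *\<^sub>R g x)"
  using assms unfolding fourier_density_def by auto

section \<open>Tempered distributions and Sobolev spaces as seminormed spaces\<close>

lemma le_schwartz_seminorm:
  assumes "schwartz \<phi>"
  shows "norm (x ^ m *\<^sub>R (vderiv ^^ n) \<phi> x) \<le> schwartz_seminorm m n \<phi>"
proof -
  have "bounded (range (\<lambda>x. x ^ m *\<^sub>R (vderiv ^^ n) \<phi> x))"
    using assms by (simp add: schwartz_def)
  then obtain a where "\<And>x. norm (x ^ m *\<^sub>R (vderiv ^^ n) \<phi> x) \<le> a"
    unfolding bounded_iff by blast
  then have "bdd_above (range (\<lambda>x. norm (x ^ m *\<^sub>R (vderiv ^^ n) \<phi> x)))"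
    by (rule bdd_aboveI2)
  from cSUP_upper[OF UNIV_I this, of x] show ?thesis
    unfolding schwartz_seminorm_def .
qed

lemma schwartz_seminorm_nonneg: "schwartz \<phi> \<Longrightarrow> 0 \<le> schwartz_seminorm m n \<phi>"
  using order_trans[OF norm_ge_zero le_schwartz_seminorm] .

lemma schwartz_seminorm_sum_mono:
  assumes "schwartz \<phi>" "N \<le> N'"
  shows "(\<Sum>m\<le>N. \<Sum>n\<le>N. schwartz_seminorm m n \<phi>) \<le> (\<Sum>m\<le>N'. \<Sum>n\<le>N'. schwartz_seminorm m n \<phi>)"
proof -
  have "(\<Sum>m\<le>N. \<Sum>n\<le>N. schwartz_seminorm m n \<phi>) \<le> (\<Sum>m\<le>N. \<Sum>n\<le>N'. schwartz_seminorm m n \<phi>)"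
    using assms by (intro sum_mono sum_mono2) (auto intro: schwartz_seminorm_nonneg)
  also have "\<dots> \<le> (\<Sum>m\<le>N'. \<Sum>n\<le>N'. schwartz_seminorm m n \<phi>)"
    using assms by (intro sum_mono2) (auto intro!: schwartz_seminorm_nonneg sum_nonneg)
  finally show ?thesis .
qed

text \<open>Two bounds of different order \<open>N\<close> can be added only after passing to a
  common order, which takes a nonnegative constant and monotonicity of the seminorm sums.\<close>

lemma tempered_bound_nonneg:
  assumes "\<exists>C N. \<forall>\<phi>. schwartz \<phi> \<longrightarrow> norm (u \<phi>) \<le> C * (\<Sum>m\<le>N. \<Sum>n\<le>N. schwartz_seminorm m n \<phi>)"
  shows "\<exists>C N. C \<ge> 0 \<and> (\<forall>\<phi> N'. schwartz \<phi> \<longrightarrow> N \<le> N' \<longrightarrow>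
    norm (u \<phi>) \<le> C * (\<Sum>m\<le>N'. \<Sum>n\<le>N'. schwartz_seminorm m n \<phi>))"
proof -
  obtain C N where C: "\<And>\<phi>. schwartz \<phi> \<Longrightarrow> norm (u \<phi>) \<le> C * (\<Sum>m\<le>N. \<Sum>n\<le>N. schwartz_seminorm m n \<phi>)"
    using assms by blast
  have "norm (u \<phi>) \<le> \<bar>C\<bar> * (\<Sum>m\<le>N'. \<Sum>n\<le>N'. schwartz_seminorm m n \<phi>)"
    if s: "schwartz \<phi>" "N \<le> N'" for \<phi> N'
  proof -
    have "norm (u \<phi>) \<le> C * (\<Sum>m\<le>N. \<Sum>n\<le>N. schwartz_seminorm m n \<phi>)" by (rule C[OF s(1)])
    also have "\<dots> \<le> \<bar>C\<bar> * (\<Sum>m\<le>N. \<Sum>n\<le>N. schwartz_seminorm m n \<phi>)"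
      by (intro mult_right_mono sum_nonneg schwartz_seminorm_nonneg s) simp
    also have "\<dots> \<le> \<bar>C\<bar> * (\<Sum>m\<le>N'. \<Sum>n\<le>N'. schwartz_seminorm m n \<phi>)"
      by (intro mult_left_mono schwartz_seminorm_sum_mono s) simp
    finally show ?thesis .
  qed
  then show ?thesis by (intro exI[of _ "\<bar>C\<bar>"] exI[of _ N]) auto
qed

lemma temperedI:
  assumes "\<And>\<phi>. \<not> schwartz \<phi> \<Longrightarrow> u \<phi> = 0"
    and "\<And>\<phi> \<eta>. schwartz \<phi> \<Longrightarrow> schwartz \<eta> \<Longrightarrow> u (\<lambda>x. \<phi> x + \<eta> x) = u \<phi> + u \<eta>"
    and "\<And>c \<phi>. schwartz \<phi> \<Longrightarrow> u (\<lambda>x. c * \<phi> x) = c * u \<phi>"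
    and "\<And>\<phi>. schwartz \<phi> \<Longrightarrow> norm (u \<phi>) \<le> C * (\<Sum>m\<le>N. \<Sum>n\<le>N. schwartz_seminorm m n \<phi>)"
  shows "tempered u"
  unfolding tempered_def by (intro conjI exI[of _ C] exI[of _ N] allI impI assms)

lemma temperedD:
  assumes "tempered u"
  shows "\<And>\<phi>. \<not> schwartz \<phi> \<Longrightarrow> u \<phi> = 0"
    and "\<And>\<phi> \<eta>. schwartz \<phi> \<Longrightarrow> schwartz \<eta> \<Longrightarrow> u (\<lambda>x. \<phi> x + \<eta> x) = u \<phi> + u \<eta>"
    and "\<And>c \<phi>. schwartz \<phi> \<Longrightarrow> u (\<lambda>x. c * \<phi> x) = c * u \<phi>"
    and "\<exists>C N. \<forall>\<phi>. schwartz \<phi> \<longrightarrow> norm (u \<phi>) \<le> C * (\<Sum>m\<le>N. \<Sum>n\<le>N. schwartz_seminorm m n \<phi>)"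
  using assms unfolding tempered_def by simp_all

lemma tempered_add:
  assumes u: "tempered u" and v: "tempered v"
  shows "tempered (u + v)"
proof -
  obtain C N where C: "C \<ge> 0" "\<And>\<phi> N'. schwartz \<phi> \<Longrightarrow> N \<le> N' \<Longrightarrow>
    norm (u \<phi>) \<le> C * (\<Sum>m\<le>N'. \<Sum>n\<le>N'. schwartz_seminorm m n \<phi>)"
    using tempered_bound_nonneg[OF temperedD(4)[OF u]] by blast
  obtain D M where D: "D \<ge> 0" "\<And>\<phi> N'. schwartz \<phi> \<Longrightarrow> M \<le> N' \<Longrightarrow>
    norm (v \<phi>) \<le> D * (\<Sum>m\<le>N'. \<Sum>n\<le>N'. schwartz_seminorm m n \<phi>)"
    using tempered_bound_nonneg[OF temperedD(4)[OF v]] by blast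
  show ?thesis
  proof (rule temperedI)
    show "norm ((u + v) \<phi>) \<le> (C + D) * (\<Sum>m\<le>max N M. \<Sum>n\<le>max N M. schwartz_seminorm m n \<phi>)"
      if "schwartz \<phi>" for \<phi>
      unfolding plus_fun_apply distrib_right
      by (intro norm_triangle_mono C(2) D(2) that) simp_all
  qed (simp_all add: temperedD[OF u] temperedD[OF v] distrib_left)
qed

lemma tempered_scaleR:
  assumes u: "tempered u"
  shows "tempered (c *\<^sub>R u)"
proof -
  obtain C N where C: "C \<ge> 0" "\<And>\<phi> N'. schwartz \<phi> \<Longrightarrow> N \<le> N' \<Longrightarrow>
    norm (u \<phi>) \<le> C * (\<Sum>m\<le>N'. \<Sum>n\<le>N'. schwartz_seminorm m n \<phi>)"
    using tempered_bound_nonneg[OF temperedD(4)[OF u]] by blast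
  show ?thesis
  proof (rule temperedI)
    show "norm ((c *\<^sub>R u) \<phi>) \<le> (\<bar>c\<bar> * C) * (\<Sum>m\<le>N. \<Sum>n\<le>N. schwartz_seminorm m n \<phi>)"
      if "schwartz \<phi>" for \<phi>
      unfolding scaleR_fun_apply norm_scaleR mult.assoc
      by (intro mult_left_mono C(2) that) simp_all
  qed (simp_all add: temperedD[OF u] scaleR_add_right)
qed

lemma wL2_scaleR: "wL2 k (\<lambda>x. c *\<^sub>R g x) x = c\<^sup>2 * wL2 k g x"
  by (simp add: wL2_def power_mult_distrib)

lemma wL2_eq_square: "wL2 k g x = ((1 + x\<^sup>2) powr (k / 2) * cmod (g x))\<^sup>2"
proof -
  have "(1 + x\<^sup>2) powr k = ((1 + x\<^sup>2) powr (k / 2))\<^sup>2"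
    by (simp add: power2_eq_square flip: powr_add)
  then show ?thesis by (simp add: wL2_def power_mult_distrib)
qed

text \<open>Minkowski's inequality: expand the square and estimate the mixed term by
  Cauchy-Schwarz.\<close>

lemma wL2_triangle:
  assumes [measurable]: "g \<in> borel_measurable borel" "h \<in> borel_measurable borel"
    and g: "integrable lborel (wL2 k g)" and h: "integrable lborel (wL2 k h)"
  shows "integrable lborel (wL2 k (\<lambda>x. g x + h x))"
    and "sqrt (\<integral>x. wL2 k (\<lambda>x. g x + h x) x \<partial>lborel)
      \<le> sqrt (\<integral>x. wL2 k g x \<partial>lborel) + sqrt (\<integral>x. wL2 k h x \<partial>lborel)"
proof -
  define G where "G = (\<lambda>x. (1 + x\<^sup>2) powr (k / 2) * cmod (g x))"
  define H where "H = (\<lambda>x. (1 + x\<^sup>2) powr (k / 2) * cmod (h x))"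
  have [measurable]: "G \<in> borel_measurable borel" "H \<in> borel_measurable borel"
    unfolding G_def H_def by measurable
  have G: "wL2 k g = (\<lambda>x. (G x)\<^sup>2)" and H: "wL2 k h = (\<lambda>x. (H x)\<^sup>2)"
    by (simp_all add: fun_eq_iff wL2_eq_square G_def H_def)
  have GH: "integrable lborel (\<lambda>x. G x * H x)"
    "(\<integral>x. G x * H x \<partial>lborel) \<le> sqrt (\<integral>x. (G x)\<^sup>2 \<partial>lborel) * sqrt (\<integral>x. (H x)\<^sup>2 \<partial>lborel)"
    using g h by (intro Cauchy_Schwarz_integral; simp add: G H)+
  have int: "integrable lborel (\<lambda>x. (G x)\<^sup>2 + 2 * (G x * H x) + (H x)\<^sup>2)"
    using g h GH(1) by (simp add: G H)
  have le: "wL2 k (\<lambda>x. g x + h x) x \<le> (G x)\<^sup>2 + 2 * (G x * H x) + (H x)\<^sup>2" for x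
  proof -
    have "wL2 k (\<lambda>x. g x + h x) x \<le> (G x + H x)\<^sup>2"
      unfolding wL2_eq_square G_def H_def distrib_left[symmetric]
      by (intro power_mono mult_left_mono norm_triangle_ineq) auto
    then show ?thesis by (simp add: power2_sum)
  qed
  show int': "integrable lborel (wL2 k (\<lambda>x. g x + h x))"
    by (rule Bochner_Integration.integrable_bound[OF int])
      (use le wL2_nonneg in \<open>auto intro!: AE_I2 order_trans[OF le abs_ge_self] simp: abs_of_nonneg\<close>)
  have "(\<integral>x. wL2 k (\<lambda>x. g x + h x) x \<partial>lborel) \<le> (\<integral>x. (G x)\<^sup>2 + 2 * (G x * H x) + (H x)\<^sup>2 \<partial>lborel)"
    by (intro integral_mono int' int le)
  also have "\<dots> = (\<integral>x. (G x)\<^sup>2 \<partial>lborel) + 2 * (\<integral>x. G x * H x \<partial>lborel) + (\<integral>x. (H x)\<^sup>2 \<partial>lborel)"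
    using g h GH(1) by (simp add: G H)
  also have "\<dots> \<le> (sqrt (\<integral>x. (G x)\<^sup>2 \<partial>lborel) + sqrt (\<integral>x. (H x)\<^sup>2 \<partial>lborel))\<^sup>2"
    using GH(2) by (simp add: power2_sum)
  finally show "sqrt (\<integral>x. wL2 k (\<lambda>x. g x + h x) x \<partial>lborel)
      \<le> sqrt (\<integral>x. wL2 k g x \<partial>lborel) + sqrt (\<integral>x. wL2 k h x \<partial>lborel)"
    unfolding G H by (intro real_le_lsqrt) (auto intro!: add_nonneg_nonneg)
qed

lemma sobolevI:
  "tempered u \<Longrightarrow> fourier_density u g \<Longrightarrow> integrable lborel (wL2 k g) \<Longrightarrow> u \<in> vecs (sobolev k)"
  by (auto simp: sobolev_alt)

lemma snvs_sobolev: "snvs (sobolev k)"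
proof
  show "0 \<in> vecs (sobolev k)"
  proof (rule sobolevI)
    show "tempered 0"
      by (rule temperedI[of _ 0 0]) simp_all
    show "fourier_density 0 (\<lambda>_. 0)" by (simp add: fourier_density_def)
    show "integrable lborel (wL2 k (\<lambda>_. 0))" by (simp add: wL2_def[abs_def])
  qed
next
  fix u v assume u: "u \<in> vecs (sobolev k)" and v: "v \<in> vecs (sobolev k)"
  note U = sobolevD[OF u] and V = sobolevD[OF v]
  note W = fourier_density_add[OF U(2) V(2)] and T = wL2_triangle[OF U(4) V(4) U(3) V(3)]
  show "u + v \<in> vecs (sobolev k)"
    using tempered_add[OF U(1) V(1)] W T(1) by (rule sobolevI)
  show "nrm (sobolev k) (u + v) \<le> nrm (sobolev k) u + nrm (sobolev k) v"
    unfolding sobolev_nrm_eq[OF W] sobolev_nrm_eq[OF U(2)] sobolev_nrm_eq[OF V(2)] by (rule T(2))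
next
  fix u c assume u: "u \<in> vecs (sobolev k)"
  note U = sobolevD[OF u]
  note W = fourier_density_scaleR[OF U(2), of c]
  show "c *\<^sub>R u \<in> vecs (sobolev k)"
    using U(3) by (intro sobolevI[OF tempered_scaleR[OF U(1)] W]) (simp add: wL2_scaleR[abs_def])
  show "nrm (sobolev k) (c *\<^sub>R u) = \<bar>c\<bar> * nrm (sobolev k) u"
    unfolding sobolev_nrm_eq[OF W] sobolev_nrm_eq[OF U(2)] by (simp add: wL2_scaleR[abs_def] real_sqrt_mult)
  show "0 \<le> nrm (sobolev k) u"
    unfolding sobolev_nrm_eq[OF U(2)] by (simp add: wL2_nonneg)
qed

lemma snvs_real_sobolev: "snvs (real_sobolev k)"
proof -
  interpret S: snvs "sobolev k" by (rule snvs_sobolev)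
  show ?thesis
    by standard (simp_all add: real_sobolev_def real_distr_def S.zero_mem S.add_mem S.scale_mem
      S.nrm_nonneg S.nrm_scale S.nrm_triangle)
qed

lemma snvs_zr_space: "snvs (zr_space k l s)"
  unfolding zr_space_def by (intro snvs_prod_space snvs_sobolev snvs_real_sobolev)

text \<open>Unlike in the pairing of distributions, \<open>\<phi>\<close>, which lives on the Fourier side, need not be Schwartz.\<close>

definition dens_pairing :: "(real \<Rightarrow> complex) \<Rightarrow> distr \<Rightarrow> complex" where
  "dens_pairing \<phi> u = (\<integral>x. dens u x * \<phi> x \<partial>lborel)"

text \<open>Duality of \<open>H^k\<close> and \<open>H^-k\<close>: the weight
  \<open>(1 + x^2) powr (k / 2)\<close> and its inverse are given to the two factors before
  Cauchy-Schwarz. This provides functionals on the solution space with an explicit norm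
  bound.\<close>

lemma dens_pairing_bound:
  assumes u: "u \<in> vecs (sobolev k)" and [measurable]: "\<phi> \<in> borel_measurable borel"
    and \<phi>: "integrable lborel (wL2 (- k) \<phi>)"
  shows "integrable lborel (\<lambda>x. dens u x * \<phi> x)"
    and "norm (dens_pairing \<phi> u) \<le> sqrt (\<integral>x. wL2 (- k) \<phi> x \<partial>lborel) * nrm (sobolev k) u"
proof -
  note U = sobolevD[OF u]
  note [measurable] = U(4)
  define G where "G = (\<lambda>x. (1 + x\<^sup>2) powr (k / 2) * cmod (dens u x))"
  define H where "H = (\<lambda>x. (1 + x\<^sup>2) powr (- k / 2) * cmod (\<phi> x))"
  have [measurable]: "G \<in> borel_measurable borel" "H \<in> borel_measurable borel"
    unfolding G_def H_def by measurable
  have G: "wL2 k (dens u) = (\<lambda>x. (G x)\<^sup>2)" and H: "wL2 (- k) \<phi> = (\<lambda>x. (H x)\<^sup>2)"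
    by (simp_all add: fun_eq_iff wL2_eq_square G_def H_def)
  have GH: "integrable lborel (\<lambda>x. G x * H x)"
    "(\<integral>x. G x * H x \<partial>lborel) \<le> sqrt (\<integral>x. (G x)\<^sup>2 \<partial>lborel) * sqrt (\<integral>x. (H x)\<^sup>2 \<partial>lborel)"
    using U \<phi> by (intro Cauchy_Schwarz_integral; simp add: G H)+
  have eq: "norm (dens u x * \<phi> x) = G x * H x" for x
  proof -
    have "(1 + x\<^sup>2) powr (k / 2) * (1 + x\<^sup>2) powr (- k / 2) = 1"
      using sum_power2_gt_zero_iff[of 1 x] by (simp flip: powr_add)
    then show ?thesis by (simp add: G_def H_def norm_mult)
  qed
  show int: "integrable lborel (\<lambda>x. dens u x * \<phi> x)"
    by (rule Bochner_Integration.integrable_bound[OF GH(1)]) (auto simp: eq)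
  have "norm (dens_pairing \<phi> u) \<le> (\<integral>x. norm (dens u x * \<phi> x) \<partial>lborel)"
    unfolding dens_pairing_def by (rule integral_norm_bound)
  also have "\<dots> \<le> sqrt (\<integral>x. wL2 (- k) \<phi> x \<partial>lborel) * nrm (sobolev k) u"
    unfolding eq sobolev_nrm_eq[OF U(2)] G H using GH(2) by (simp add: mult.commute)
  finally show "norm (dens_pairing \<phi> u) \<le> sqrt (\<integral>x. wL2 (- k) \<phi> x \<partial>lborel) * nrm (sobolev k) u" .
qed

lemma dens_pairing_eq:
  assumes "fourier_density u g" and [measurable]: "\<phi> \<in> borel_measurable borel"
  shows "dens_pairing \<phi> u = (\<integral>x. g x * \<phi> x \<partial>lborel)"
proof -
  have [measurable]: "g \<in> borel_measurable borel" "dens u \<in> borel_measurable borel"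
    using assms(1) fourier_density_measurable fourier_density_dens by blast+
  show ?thesis
    unfolding dens_pairing_def
    by (rule integral_cong_AE) (use dens_AE[OF assms(1)] in \<open>auto elim!: eventually_mono\<close>)
qed

lemma dens_pairing_linear:
  assumes u: "u \<in> vecs (sobolev k)" and v: "v \<in> vecs (sobolev k)"
    and \<phi>: "\<phi> \<in> borel_measurable borel" "integrable lborel (wL2 (- k) \<phi>)"
  shows "dens_pairing \<phi> (u - v) = dens_pairing \<phi> u - dens_pairing \<phi> v"
    and "dens_pairing \<phi> (c *\<^sub>R u) = c *\<^sub>R dens_pairing \<phi> u"
proof -
  note U = sobolevD(2)[OF u] and V = sobolevD(2)[OF v]
  have d: "fourier_density (u - v) (\<lambda>x. dens u x + (- 1) *\<^sub>R dens v x)"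
    using fourier_density_add[OF U fourier_density_scaleR[OF V, of "- 1"]] by simp
  show "dens_pairing \<phi> (u - v) = dens_pairing \<phi> u - dens_pairing \<phi> v"
    unfolding dens_pairing_eq[OF d \<phi>(1)] unfolding dens_pairing_def
    using dens_pairing_bound(1)[OF u \<phi>] dens_pairing_bound(1)[OF v \<phi>] by (simp add: left_diff_distrib)
  show "dens_pairing \<phi> (c *\<^sub>R u) = c *\<^sub>R dens_pairing \<phi> u"
    unfolding dens_pairing_eq[OF fourier_density_scaleR[OF U] \<phi>(1)] unfolding dens_pairing_def
    by simp
qed

text \<open>The distribution with Fourier transform \<open>g\<close>.\<close>

definition fdistr :: "(real \<Rightarrow> complex) \<Rightarrow> distr" where
  "fdistr g = (\<lambda>\<phi>. if schwartz \<phi> then \<integral>\<xi>. g \<xi> * inv_fourier \<phi> \<xi> \<partial>lborel else 0)"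

section \<open>Distributions with integrable Fourier transform\<close>

lemma norm_inv_fourier_le: "norm (inv_fourier f x) \<le> (\<integral>x. norm (f x) \<partial>lborel) / (2 * pi)"
  unfolding inv_fourier_eq_ft norm_divide using norm_ft_le[of 1 f x]
  by (simp add: divide_right_mono)

lemma inv_fourier_measurable:
  "integrable lborel f \<Longrightarrow> inv_fourier f \<in> borel_measurable borel"
  unfolding inv_fourier_eq_ft[abs_def]
  by (intro borel_measurable_divide borel_measurable_continuous_onI continuous_on_ft) auto

lemma continuous_on_inv_fourier:
  "integrable lborel f \<Longrightarrow> continuous_on UNIV (inv_fourier f)"
  unfolding inv_fourier_eq_ft[abs_def] by (intro continuous_intros continuous_on_ft) auto

lemma integrable_mult_inv_fourier:
  assumes g: "integrable lborel g" and f: "integrable lborel f"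
  shows "integrable lborel (\<lambda>\<xi>. g \<xi> * inv_fourier f \<xi>)"
proof (rule Bochner_Integration.integrable_bound)
  let ?C = "(\<integral>x. norm (f x) \<partial>lborel) / (2 * pi)"
  show "integrable lborel (\<lambda>\<xi>. ?C * norm (g \<xi>))" using g by simp
  show "(\<lambda>\<xi>. g \<xi> * inv_fourier f \<xi>) \<in> borel_measurable lborel"
    using g inv_fourier_measurable[OF f] by simp
  have "norm (g \<xi> * inv_fourier f \<xi>) \<le> norm (?C * norm (g \<xi>))" for \<xi>
    using mult_left_mono[OF norm_inv_fourier_le[of f \<xi>] norm_ge_zero[of "g \<xi>"]]
    by (simp add: norm_mult abs_mult mult.commute)
  then show "AE \<xi> in lborel. norm (g \<xi> * inv_fourier f \<xi>) \<le> norm (?C * norm (g \<xi>))" by simp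
qed

lemma inv_fourier_add:
  assumes "integrable lborel f" "integrable lborel g"
  shows "inv_fourier (\<lambda>x. f x + g x) \<xi> = inv_fourier f \<xi> + inv_fourier g \<xi>"
proof -
  have "integrable lborel (\<lambda>x. cis (1 * (x * \<xi>)) * f x)" "integrable lborel (\<lambda>x. cis (1 * (x * \<xi>)) * g x)"
    using assms by (intro integrable_cis_mult; simp)+
  then show ?thesis
    unfolding inv_fourier_eq_ft ft_def by (simp add: distrib_left add_divide_distrib)
qed

lemma inv_fourier_cmult: "inv_fourier (\<lambda>x. c * f x) \<xi> = c * inv_fourier f \<xi>"
  by (simp add: inv_fourier_eq_ft ft_cmult)

lemma schwartz_integral_norm_le:
  assumes "schwartz \<phi>"
  shows "(\<integral>x. norm (\<phi> x) \<partial>lborel) \<le> (\<integral>x. 1 / (1 + x\<^sup>2) \<partial>lborel) *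
    (\<Sum>m\<le>2. \<Sum>n\<le>2. schwartz_seminorm m n \<phi>)"
proof -
  let ?S = "\<Sum>m\<le>2. \<Sum>n\<le>2. schwartz_seminorm m n \<phi>"
  have S: "schwartz_seminorm 0 0 \<phi> + schwartz_seminorm 2 0 \<phi> \<le> ?S"
    by (simp add: numeral_2_eq_2 schwartz_seminorm_nonneg[OF assms] add_nonneg_nonneg)
  have "norm (\<phi> x) \<le> ?S * (1 / (1 + x\<^sup>2))" for x
  proof -
    have "norm (\<phi> x) * (1 + x\<^sup>2) \<le> ?S"
      using le_schwartz_seminorm[OF assms, of x 0 0] le_schwartz_seminorm[OF assms, of x 2 0] S
      by (simp add: algebra_simps)
    then show ?thesis using sum_power2_gt_zero_iff[of 1 x] by (simp add: pos_le_divide_eq)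
  qed
  then have "(\<integral>x. norm (\<phi> x) \<partial>lborel) \<le> (\<integral>x. ?S * (1 / (1 + x\<^sup>2)) \<partial>lborel)"
    by (intro integral_mono integrable_norm schwartz_integrable assms integrable_mult_right
        integrable_inverse_1_plus_sq)
  then show ?thesis by (simp add: mult.commute del: times_divide_eq_right times_divide_eq_left)
qed

text \<open>The inverse transform of \<open>\<phi>\<close> is bounded by a multiple of the
  \<open>L^1\<close> norm of \<open>\<phi>\<close>, which seminorms of orders at most 2 control;
  integrability of \<open>g\<close> does the rest.\<close>

lemma tempered_fdistr:
  assumes g: "integrable lborel g"
  shows "tempered (fdistr g)"
proof (rule temperedI)
  note int = integrable_mult_inv_fourier[OF g schwartz_integrable]
  show "fdistr g (\<lambda>x. \<phi> x + \<eta> x) = fdistr g \<phi> + fdistr g \<eta>" if "schwartz \<phi>" "schwartz \<eta>" for \<phi> \<eta>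
    using that int by (simp add: fdistr_def schwartz_add inv_fourier_add schwartz_integrable distrib_left)
  show "fdistr g (\<lambda>x. c * \<phi> x) = c * fdistr g \<phi>" if "schwartz \<phi>" for c \<phi>
    using that by (simp add: fdistr_def schwartz_cmult inv_fourier_cmult mult.left_commute[of _ c])
  define I where "I = (\<integral>x. 1 / (1 + (x::real)\<^sup>2) \<partial>lborel)"
  show "norm (fdistr g \<phi>) \<le> ((\<integral>x. norm (g x) \<partial>lborel) * (I / (2 * pi))) * (\<Sum>m\<le>2. \<Sum>n\<le>2. schwartz_seminorm m n \<phi>)"
    if s: "schwartz \<phi>" for \<phi>
  proof -
    let ?S = "\<Sum>m\<le>2. \<Sum>n\<le>2. schwartz_seminorm m n \<phi>"
    have b: "norm (inv_fourier \<phi> \<xi>) \<le> I / (2 * pi) * ?S" for \<xi>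
    proof -
      have "norm (inv_fourier \<phi> \<xi>) \<le> (\<integral>x. norm (\<phi> x) \<partial>lborel) / (2 * pi)"
        by (rule norm_inv_fourier_le)
      also have "\<dots> \<le> (I * ?S) / (2 * pi)"
        unfolding I_def by (intro divide_right_mono schwartz_integral_norm_le[OF s]) simp
      finally show ?thesis by simp
    qed
    have "norm (fdistr g \<phi>) \<le> (\<integral>\<xi>. norm (g \<xi> * inv_fourier \<phi> \<xi>) \<partial>lborel)"
      using s unfolding fdistr_def by (simp only: if_True integral_norm_bound)
    also have "\<dots> \<le> (\<integral>\<xi>. norm (g \<xi>) * (I / (2 * pi) * ?S) \<partial>lborel)"
      using g by (intro integral_mono integrable_norm int s integrable_mult_left)
        (simp_all add: norm_mult mult_left_mono b del: times_divide_eq_left times_divide_eq_right)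
    also have "\<dots> = ((\<integral>x. norm (g x) \<partial>lborel) * (I / (2 * pi))) * ?S"
      by (simp only: integral_mult_left_zero mult.assoc)
    finally show ?thesis .
  qed
qed (simp add: fdistr_def)

lemma fourier_density_fdistr:
  assumes "integrable lborel g"
  shows "fourier_density (fdistr g) g"
  unfolding fourier_density_def
proof (intro conjI allI impI)
  fix \<phi> assume s: "schwartz \<phi>"
  note F = schwartz_fourier[OF s]
  show "integrable lborel (\<lambda>\<xi>. g \<xi> * \<phi> \<xi>)"
    using integrable_mult_inv_fourier[OF assms schwartz_integrable[OF F]]
    by (simp add: inv_fourier_fourier[OF s])
  show "fdistr g (fourier \<phi>) = (\<integral>\<xi>. g \<xi> * \<phi> \<xi> \<partial>lborel)"
    by (simp add: fdistr_def F inv_fourier_fourier[OF s])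
qed (use assms in simp)

lemma fdistr_mem_sobolev:
  "integrable lborel g \<Longrightarrow> integrable lborel (wL2 k g) \<Longrightarrow> fdistr g \<in> vecs (sobolev k)"
  by (intro sobolevI[OF tempered_fdistr fourier_density_fdistr])

lemma nrm_fdistr:
  "integrable lborel g \<Longrightarrow> nrm (sobolev k) (fdistr g) = sqrt (\<integral>\<xi>. wL2 k g \<xi> \<partial>lborel)"
  by (intro sobolev_nrm_eq fourier_density_fdistr)

lemma cnj_inv_fourier: "cnj (inv_fourier f x) = inv_fourier (\<lambda>\<xi>. cnj (f (- \<xi>))) x"
proof -
  have "(\<integral>\<xi>. cis (x * \<xi>) * cnj (f (- \<xi>)) \<partial>lborel) = (\<integral>\<xi>. cis (- (x * \<xi>)) * cnj (f \<xi>) \<partial>lborel)"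
    using lborel_integral_real_affine[of "- 1" "\<lambda>\<xi>. cis (x * \<xi>) * cnj (f (- \<xi>))" 0] by simp
  also have "\<dots> = cnj (\<integral>\<xi>. cis (x * \<xi>) * f \<xi> \<partial>lborel)"
    by (simp add: cis_cnj flip: Bochner_Integration.integral_cnj)
  finally show ?thesis by (simp add: inv_fourier_def)
qed

text \<open>Hermitian symmetry is the Fourier side of being real: conjugating a test function
  conjugates and reflects its inverse transform, and the substitution
  \<open>\<xi> -> - \<xi>\<close> moves the reflection to \<open>g\<close>.\<close>

lemma real_distr_fdistr:
  assumes "\<And>\<xi>. g (- \<xi>) = cnj (g \<xi>)"
  shows "real_distr (fdistr g)"
  unfolding real_distr_def
proof
  fix \<phi>
  show "fdistr g (\<lambda>x. cnj (\<phi> x)) = cnj (fdistr g \<phi>)"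
  proof (cases "schwartz \<phi>")
    case True
    have eq: "inv_fourier (\<lambda>x. cnj (\<phi> x)) \<xi> = cnj (inv_fourier \<phi> (- \<xi>))" for \<xi>
      by (simp add: inv_fourier_def cis_cnj flip: Bochner_Integration.integral_cnj)
    have "fdistr g (\<lambda>x. cnj (\<phi> x)) = (\<integral>\<xi>. g \<xi> * cnj (inv_fourier \<phi> (- \<xi>)) \<partial>lborel)"
      using True by (simp add: fdistr_def schwartz_cnj_iff eq)
    also have "\<dots> = (\<integral>\<xi>. cnj (g \<xi> * inv_fourier \<phi> \<xi>) \<partial>lborel)"
      using lborel_integral_real_affine[of "- 1" "\<lambda>\<xi>. g \<xi> * cnj (inv_fourier \<phi> (- \<xi>))" 0] assms by simp
    finally show ?thesis using True by (simp only: fdistr_def if_True Bochner_Integration.integral_cnj)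
  qed (simp add: fdistr_def schwartz_cnj_iff)
qed

lemma fdistr_diff:
  assumes "integrable lborel g" "integrable lborel h"
  shows "fdistr g - fdistr h = fdistr (\<lambda>\<xi>. g \<xi> - h \<xi>)"
proof
  fix \<phi>
  show "(fdistr g - fdistr h) \<phi> = fdistr (\<lambda>\<xi>. g \<xi> - h \<xi>) \<phi>"
    using integrable_mult_inv_fourier[OF assms(1) schwartz_integrable, of \<phi>]
      integrable_mult_inv_fourier[OF assms(2) schwartz_integrable, of \<phi>]
    by (simp add: fdistr_def left_diff_distrib)
qed

lemma fdistr_scaleR: "c *\<^sub>R fdistr g = fdistr (\<lambda>\<xi>. c *\<^sub>R g \<xi>)"
  by (auto simp: fun_eq_iff fdistr_def)

text \<open>The bridge between functions of \<open>x\<close>, in which the system is stated, and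
  densities, in which it is solved. Fubini moves the transform from \<open>g\<close> to the test
  function.\<close>

lemma regular_distr_inv_fourier:
  assumes "integrable lborel g"
  shows "regular_distr (inv_fourier g) = fdistr g"
proof
  fix \<phi>
  show "regular_distr (inv_fourier g) \<phi> = fdistr g \<phi>"
  proof (cases "schwartz \<phi>")
    case True
    have "(\<integral>y. (\<integral>x. cis (y * x) * g x \<partial>lborel) * \<phi> y \<partial>lborel) = (\<integral>x. g x * (\<integral>y. cis (y * x) * \<phi> y \<partial>lborel) \<partial>lborel)"
      by (rule Fubini_bounded_kernel) (use assms schwartz_integrable[OF True] in auto)
    then show ?thesis using True by (simp add: regular_distr_def fdistr_def inv_fourier_def mult.commute)
  qed (simp add: regular_distr_def fdistr_def)
qed

text \<open>With this phase, \<open>m\<close> times a Schwartz function is again Schwartz, so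
  Fourier inversion undoes the outer transform in \<open>fourier_multiplier\<close>.\<close>

lemma fourier_multiplier_fdistr:
  assumes "m = (\<lambda>\<xi>. cis (a * \<xi>\<^sup>2 + b * \<xi>))"
  shows "fourier_multiplier m (fdistr g) = fdistr (\<lambda>\<xi>. m \<xi> * g \<xi>)"
proof
  fix \<phi>
  show "fourier_multiplier m (fdistr g) \<phi> = fdistr (\<lambda>\<xi>. m \<xi> * g \<xi>) \<phi>"
  proof (cases "schwartz \<phi>")
    case True
    have s: "schwartz (\<lambda>\<xi>. m \<xi> * inv_fourier \<phi> \<xi>)"
      unfolding assms by (intro schwartz_cis_mult schwartz_inv_fourier True)
    show ?thesis
      using True by (simp add: fourier_multiplier_def fdistr_def schwartz_fourier[OF s]
          inv_fourier_fourier[OF s] mult_ac)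
  qed (simp add: fourier_multiplier_def fdistr_def)
qed

lemma distr_deriv_fdistr: "distr_deriv (fdistr g) = fdistr (\<lambda>\<xi>. \<i> * of_real \<xi> * g \<xi>)"
proof
  fix \<phi>
  show "distr_deriv (fdistr g) \<phi> = fdistr (\<lambda>\<xi>. \<i> * of_real \<xi> * g \<xi>) \<phi>"
  proof (cases "schwartz \<phi>")
    case True
    have "inv_fourier (vderiv \<phi>) \<xi> = - (\<i> * of_real \<xi> * inv_fourier \<phi> \<xi>)" for \<xi>
      unfolding inv_fourier_eq_ft ft_vderiv[OF True] by simp
    then show ?thesis
      using True by (simp add: distr_deriv_def fdistr_def schwartz_vderiv mult_ac)
  qed (simp add: distr_deriv_def fdistr_def)
qed

subsection \<open>Weighted spaces of curves on the Fourier side\<close>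

locale horizon =
  fixes T :: real
  assumes T_nonneg: "0 \<le> T"
begin

text \<open>The decay rate shrinks as \<open>t\<close> grows: integrating \<open>\<bar>\<xi>\<bar> W t \<xi>\<close> in time gives back \<open>W t \<xi>\<close>,
  which absorbs the derivative in the transport equations.\<close>

definition W :: "real \<Rightarrow> real \<Rightarrow> real" where
  "W t \<xi> = exp (- ((1 + T - t) * \<bar>\<xi>\<bar>)) / (1 + \<xi>\<^sup>2)"

abbreviation dom :: "(real \<times> real) set" where "dom \<equiv> {0..T} \<times> UNIV"

text \<open>Joint continuity in time and frequency makes every slice measurable and lets the
  operations below be treated by one dominated convergence lemma.\<close>

definition joint_cont :: "(real \<Rightarrow> real \<Rightarrow> complex) \<Rightarrow> bool" where
  "joint_cont f \<longleftrightarrow> continuous_on dom (\<lambda>p. f (fst p) (snd p))"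

text \<open>Norms are used as predicates with an explicit constant: no supremum has to be shown
  finite. Times outside \<open>{0..T}\<close> are not seen, so the equations obtained below hold on
  \<open>{0..T}\<close>.\<close>

definition weight_bdd :: "real \<Rightarrow> (real \<Rightarrow> real \<Rightarrow> complex) \<Rightarrow> bool" where
  "weight_bdd C f \<longleftrightarrow> (\<forall>t\<in>{0..T}. \<forall>\<xi>. cmod (f t \<xi>) \<le> C * W t \<xi>)"

definition weight_dist :: "real \<Rightarrow> (real \<Rightarrow> real \<Rightarrow> complex) \<Rightarrow> (real \<Rightarrow> real \<Rightarrow> complex) \<Rightarrow> bool" where
  "weight_dist C f g \<longleftrightarrow> weight_bdd C (\<lambda>t \<xi>. f t \<xi> - g t \<xi>)"

definition weighted :: "real \<Rightarrow> (real \<Rightarrow> real \<Rightarrow> complex) \<Rightarrow> bool" where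
  "weighted C f \<longleftrightarrow> joint_cont f \<and> weight_bdd C f"

lemma one_plus_sq_pos: "0 < 1 + (x::real)\<^sup>2"
  using sum_power2_gt_zero_iff[of 1 x] by simp

lemma W_pos: "0 < W t \<xi>"
  by (simp add: W_def one_plus_sq_pos)

lemma W_le: "t \<le> T \<Longrightarrow> W t \<xi> \<le> 1 / (1 + \<xi>\<^sup>2)"
  unfolding W_def using one_plus_sq_pos[of \<xi>] by (intro divide_right_mono) auto

lemma W_le_1: "t \<le> T \<Longrightarrow> W t \<xi> \<le> 1"
  by (rule order_trans[OF W_le]) (simp_all add: one_plus_sq_pos)

lemma W_mono: "t \<le> t' \<Longrightarrow> W t \<xi> \<le> W t' \<xi>"
  unfolding W_def using one_plus_sq_pos[of \<xi>] by (intro divide_right_mono) (auto intro!: mult_right_mono)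

lemma abs_W_le_1: "t \<le> T \<Longrightarrow> \<bar>\<xi>\<bar> * W t \<xi> \<le> 1"
proof -
  assume t: "t \<le> T"
  have "0 \<le> (\<bar>\<xi>\<bar> - 1)\<^sup>2" by simp
  then have "\<bar>\<xi>\<bar> \<le> 1 + \<xi>\<^sup>2" using abs_ge_zero[of \<xi>] unfolding power2_diff power2_abs one_power2 by linarith
  then have "\<bar>\<xi>\<bar> * (1 / (1 + \<xi>\<^sup>2)) \<le> 1" using one_plus_sq_pos[of \<xi>] by simp
  then show ?thesis using mult_left_mono[OF W_le[OF t, of \<xi>] abs_ge_zero[of \<xi>]] by linarith
qed

text \<open>The exponentials are submultiplicative by the triangle inequality, as the decay rate is
  nonnegative. The rational factors supply integrability in \<open>\<eta>\<close> uniformly in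
  \<open>\<xi>\<close>; pure exponentials would lose a factor \<open>|\<xi>|\<close> under
  convolution.\<close>

lemma W_conv:
  assumes "t \<le> T"
  shows "W t \<eta> * W t (\<xi> - \<eta>) \<le> 2 * W t \<xi> * (1 / (1 + \<eta>\<^sup>2) + 1 / (1 + (\<xi> - \<eta>)\<^sup>2))"
proof -
  let ?b = "\<xi> - \<eta>"
  have "\<bar>\<xi>\<bar> \<le> \<bar>\<eta>\<bar> + \<bar>?b\<bar>" by simp
  from mult_left_mono[OF this, of "1 + T - t"] assms
  have e: "exp (- ((1 + T - t) * \<bar>\<eta>\<bar>)) * exp (- ((1 + T - t) * \<bar>?b\<bar>)) \<le> exp (- ((1 + T - t) * \<bar>\<xi>\<bar>))"
    by (simp add: distrib_left flip: exp_add)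
  have pos: "0 < 1 + \<eta>\<^sup>2" "0 < 1 + ?b\<^sup>2" "0 < 1 + \<xi>\<^sup>2" by (rule one_plus_sq_pos)+
  have "0 \<le> (\<eta> - ?b)\<^sup>2" by simp
  then have "1 + \<xi>\<^sup>2 \<le> 2 * ((1 + \<eta>\<^sup>2) + (1 + ?b\<^sup>2))"
    by (simp add: power2_eq_square algebra_simps)
  then have "1 / ((1 + \<eta>\<^sup>2) * (1 + ?b\<^sup>2)) \<le> 2 * ((1 + \<eta>\<^sup>2) + (1 + ?b\<^sup>2)) / (1 + \<xi>\<^sup>2) / ((1 + \<eta>\<^sup>2) * (1 + ?b\<^sup>2))"
    using pos by (intro divide_right_mono) (simp_all add: pos_le_divide_eq)
  also have "\<dots> = 2 / (1 + \<xi>\<^sup>2) * (1 / (1 + \<eta>\<^sup>2) + 1 / (1 + ?b\<^sup>2))"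
  proof -
    have "2 * (a + b) / c / (a * b) = 2 / c * (1 / a + 1 / b)" if "a > 0" "b > 0" "c > 0" for a b c :: real
      using that by (simp add: field_simps)
    from this[OF pos] show ?thesis .
  qed
  finally have r: "1 / ((1 + \<eta>\<^sup>2) * (1 + ?b\<^sup>2)) \<le> 2 / (1 + \<xi>\<^sup>2) * (1 / (1 + \<eta>\<^sup>2) + 1 / (1 + ?b\<^sup>2))" .
  have "W t \<eta> * W t ?b = (exp (- ((1 + T - t) * \<bar>\<eta>\<bar>)) * exp (- ((1 + T - t) * \<bar>?b\<bar>))) * (1 / ((1 + \<eta>\<^sup>2) * (1 + ?b\<^sup>2)))"
    by (simp add: W_def)
  also have "\<dots> \<le> exp (- ((1 + T - t) * \<bar>\<xi>\<bar>)) * (2 / (1 + \<xi>\<^sup>2) * (1 / (1 + \<eta>\<^sup>2) + 1 / (1 + ?b\<^sup>2)))"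
    using pos by (intro mult_mono e r) auto
  also have "\<dots> = 2 * W t \<xi> * (1 / (1 + \<eta>\<^sup>2) + 1 / (1 + ?b\<^sup>2))" by (simp add: W_def)
  finally show ?thesis .
qed

lemma zero_mem_Icc: "0 \<in> {0..T}" using T_nonneg by simp

lemma weight_bdd_nonneg: "weight_bdd C f \<Longrightarrow> 0 \<le> C"
proof -
  assume "weight_bdd C f"
  then have "0 \<le> C * W 0 0"
    using zero_mem_Icc norm_ge_zero order_trans unfolding weight_bdd_def by blast
  then show ?thesis using W_pos[of 0 0] by (simp add: zero_le_mult_iff)
qed

lemma wbD: "weight_bdd C f \<Longrightarrow> t \<in> {0..T} \<Longrightarrow> cmod (f t \<xi>) \<le> C * W t \<xi>"
  by (simp add: weight_bdd_def)

lemma weight_bdd_mono: "weight_bdd C f \<Longrightarrow> C \<le> D \<Longrightarrow> weight_bdd D f"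
  unfolding weight_bdd_def using W_pos by (meson less_imp_le mult_right_mono order_trans)

lemma weight_bdd_le: "weight_bdd C f \<Longrightarrow> t \<in> {0..T} \<Longrightarrow> cmod (f t \<xi>) \<le> C"
  using wbD[of C f t \<xi>] mult_left_mono[OF W_le_1 weight_bdd_nonneg, of t C f \<xi>] by simp

lemma weight_bdd_le_inverse: "weight_bdd C f \<Longrightarrow> t \<in> {0..T} \<Longrightarrow> cmod (f t \<xi>) \<le> C * (1 / (1 + \<xi>\<^sup>2))"
  using wbD[of C f t \<xi>] mult_left_mono[OF W_le weight_bdd_nonneg, of t C f \<xi>] by (simp del: times_divide_eq_right)

lemma weight_bdd_add: "weight_bdd C f \<Longrightarrow> weight_bdd D g \<Longrightarrow> weight_bdd (C + D) (\<lambda>t \<xi>. f t \<xi> + g t \<xi>)"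
  unfolding weight_bdd_def distrib_right by (intro ballI allI norm_triangle_mono) auto

lemma weight_bdd_cmult: "weight_bdd C f \<Longrightarrow> weight_bdd (cmod c * C) (\<lambda>t \<xi>. c * f t \<xi>)"
  unfolding weight_bdd_def norm_mult mult.assoc by (intro ballI allI mult_left_mono) auto

lemma joint_cont_add: "joint_cont f \<Longrightarrow> joint_cont g \<Longrightarrow> joint_cont (\<lambda>t \<xi>. f t \<xi> + g t \<xi>)"
  unfolding joint_cont_def by (intro continuous_intros)

lemma joint_cont_diff: "joint_cont f \<Longrightarrow> joint_cont g \<Longrightarrow> joint_cont (\<lambda>t \<xi>. f t \<xi> - g t \<xi>)"
  unfolding joint_cont_def by (intro continuous_intros)

lemma joint_cont_cmult: "joint_cont f \<Longrightarrow> joint_cont (\<lambda>t \<xi>. c * f t \<xi>)"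
  unfolding joint_cont_def by (intro continuous_intros)

lemma weighted_add: "weighted C f \<Longrightarrow> weighted D g \<Longrightarrow> weighted (C + D) (\<lambda>t \<xi>. f t \<xi> + g t \<xi>)"
  unfolding weighted_def by (simp add: joint_cont_add weight_bdd_add)

lemma weighted_cmult: "weighted C f \<Longrightarrow> weighted (cmod c * C) (\<lambda>t \<xi>. c * f t \<xi>)"
  unfolding weighted_def by (simp add: joint_cont_cmult weight_bdd_cmult)

lemma weighted_mono: "weighted C f \<Longrightarrow> C \<le> D \<Longrightarrow> weighted D f"
  unfolding weighted_def by (auto intro: weight_bdd_mono)

lemma weight_dist_add: "weight_dist C f f' \<Longrightarrow> weight_dist D g g' \<Longrightarrow> weight_dist (C + D) (\<lambda>t \<xi>. f t \<xi> + g t \<xi>) (\<lambda>t \<xi>. f' t \<xi> + g' t \<xi>)"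
  using weight_bdd_add unfolding weight_dist_def by (simp add: add_diff_add)

lemma weight_dist_cmult: "weight_dist C f f' \<Longrightarrow> weight_dist (cmod c * C) (\<lambda>t \<xi>. c * f t \<xi>) (\<lambda>t \<xi>. c * f' t \<xi>)"
  using weight_bdd_cmult unfolding weight_dist_def by (simp flip: right_diff_distrib)

lemma weight_dist_mono: "weight_dist C f g \<Longrightarrow> C \<le> D \<Longrightarrow> weight_dist D f g"
  unfolding weight_dist_def by (rule weight_bdd_mono)

lemma weight_dist_refl: "weight_dist 0 f f"
  by (simp add: weight_dist_def weight_bdd_def)

lemma joint_cont_compose:
  assumes "joint_cont f" "continuous_on S g" "continuous_on S h" "\<And>x. x \<in> S \<Longrightarrow> g x \<in> {0..T}"
  shows "continuous_on S (\<lambda>x. f (g x) (h x))"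
proof -
  have "continuous_on S (\<lambda>x. (\<lambda>p. f (fst p) (snd p)) (g x, h x))"
    using assms by (intro continuous_on_compose2[OF assms(1)[unfolded joint_cont_def]] continuous_intros) auto
  then show ?thesis by simp
qed

lemma joint_cont_slice: "joint_cont f \<Longrightarrow> t \<in> {0..T} \<Longrightarrow> continuous_on UNIV (f t)"
  using joint_cont_compose[of f UNIV "\<lambda>_. t" "\<lambda>x. x"] by (simp add: continuous_on_id)

lemma joint_cont_slice_time: "joint_cont f \<Longrightarrow> continuous_on {0..T} (\<lambda>t. f t \<xi>)"
  using joint_cont_compose[of f "{0..T}" "\<lambda>t. t" "\<lambda>_. \<xi>"] by (simp add: continuous_on_id)

lemma joint_cont_measurable: "joint_cont f \<Longrightarrow> t \<in> {0..T} \<Longrightarrow> f t \<in> borel_measurable borel"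
  using joint_cont_slice by (rule borel_measurable_continuous_onI)

lemma weighted_integrable:
  assumes "weighted C f" "t \<in> {0..T}"
  shows "integrable lborel (f t)"
proof (rule Bochner_Integration.integrable_bound)
  show "integrable lborel (\<lambda>x. C * (1 / (1 + x\<^sup>2)))"
    by (intro integrable_mult_right integrable_inverse_1_plus_sq)
  show "f t \<in> borel_measurable lborel"
    using joint_cont_measurable assms by (simp add: weighted_def)
  show "AE x in lborel. norm (f t x) \<le> norm (C * (1 / (1 + x\<^sup>2)))"
    using assms weight_bdd_le_inverse[THEN order_trans[OF _ abs_ge_self]]
    by (auto simp: weighted_def simp del: times_divide_eq_right)
qed

text \<open>Complex conjugation on the physical side, see \<open>inv_fourier_adj\<close>.\<close>

definition adj :: "(real \<Rightarrow> real \<Rightarrow> complex) \<Rightarrow> real \<Rightarrow> real \<Rightarrow> complex" where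
  "adj f t \<xi> = cnj (f t (- \<xi>))"

lemma weighted_adj: "weighted C f \<Longrightarrow> weighted C (adj f)"
proof -
  assume f: "weighted C f"
  have "continuous_on dom (\<lambda>p. f (fst p) (- snd p))"
    using f unfolding weighted_def by (intro joint_cont_compose continuous_intros) auto
  then have "joint_cont (adj f)" unfolding joint_cont_def adj_def by (intro continuous_intros)
  moreover have "W t (- \<xi>) = W t \<xi>" for t \<xi> by (simp add: W_def)
  ultimately show ?thesis
    using f unfolding weighted_def weight_bdd_def adj_def by (metis complex_mod_cnj)
qed

lemma weight_dist_adj: "weight_dist C f g \<Longrightarrow> weight_dist C (adj f) (adj g)"
proof -
  assume f: "weight_dist C f g"
  have "W t (- \<xi>) = W t \<xi>" for t \<xi> by (simp add: W_def)
  then show ?thesis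
    using f unfolding weight_dist_def weight_bdd_def adj_def by (metis complex_cnj_diff complex_mod_cnj)
qed

text \<open>The factor \<open>1 / (2 * pi)\<close> makes this the transform of the pointwise product
  for the convention of \<open>inv_fourier\<close>.\<close>

definition convol :: "(real \<Rightarrow> real \<Rightarrow> complex) \<Rightarrow> (real \<Rightarrow> real \<Rightarrow> complex) \<Rightarrow> real \<Rightarrow> real \<Rightarrow> complex" where
  "convol f g t \<xi> = (\<integral>\<eta>. f t \<eta> * g t (\<xi> - \<eta>) \<partial>lborel) / of_real (2 * pi)"

text \<open>The 2 in \<open>W_conv\<close> times two integrals of equal value, over the
  \<open>2 * pi\<close> of \<open>convol\<close>.\<close>

definition K :: real where
  "K = 4 * (\<integral>x. 1 / (1 + x\<^sup>2) \<partial>lborel) / (2 * pi)"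

lemma K_nonneg: "0 \<le> K"
  unfolding K_def by (intro divide_nonneg_nonneg mult_nonneg_nonneg integral_nonneg) (auto intro: less_imp_le[OF one_plus_sq_pos])

lemma convol_integrand_bound:
  assumes "weight_bdd A f" "weight_bdd B g" "t \<in> {0..T}"
  shows "cmod (f t \<eta> * g t (\<xi> - \<eta>)) \<le> A * B * (1 / (1 + \<eta>\<^sup>2))"
proof -
  have "cmod (f t \<eta> * g t (\<xi> - \<eta>)) \<le> (A * (1 / (1 + \<eta>\<^sup>2))) * B"
    unfolding norm_mult using assms weight_bdd_nonneg
    by (intro mult_mono weight_bdd_le weight_bdd_le_inverse) (auto intro!: mult_nonneg_nonneg divide_nonneg_nonneg simp del: times_divide_eq_right)
  then show ?thesis by (simp add: mult_ac)
qed

lemma convol_integrable: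
  assumes f: "weighted A f" and g: "weighted B g" and t: "t \<in> {0..T}"
  shows "integrable lborel (\<lambda>\<eta>. f t \<eta> * g t (\<xi> - \<eta>))"
proof (rule Bochner_Integration.integrable_bound)
  show "integrable lborel (\<lambda>x. A * B * (1 / (1 + x\<^sup>2)))"
    by (intro integrable_mult_right integrable_inverse_1_plus_sq)
  have [measurable]: "f t \<in> borel_measurable borel" "g t \<in> borel_measurable borel"
    using f g t by (auto simp: weighted_def joint_cont_measurable)
  show "(\<lambda>\<eta>. f t \<eta> * g t (\<xi> - \<eta>)) \<in> borel_measurable lborel" by measurable
  show "AE x in lborel. norm (f t x * g t (\<xi> - x)) \<le> norm (A * B * (1 / (1 + x\<^sup>2)))"
    using f g t convol_integrand_bound[THEN order_trans[OF _ abs_ge_self]]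
    by (auto simp: weighted_def simp del: times_divide_eq_right)
qed

text \<open>The weighted functions form an algebra under convolution: the bound is
  \<open>W_conv\<close> integrated in \<open>\<eta>\<close>. Continuity uses the cruder majorant
  \<open>A * B / (1 + \<eta>^2)\<close>, which does not depend on time or on
  \<open>\<xi>\<close>.\<close>

lemma weighted_convol:
  assumes f: "weighted A f" and g: "weighted B g"
  shows "weighted (K * A * B) (convol f g)"
  unfolding weighted_def
proof
  have fc: "joint_cont f" "weight_bdd A f" and gc: "joint_cont g" "weight_bdd B g" using f g by (auto simp: weighted_def)
  have AB: "0 \<le> A" "0 \<le> B" using weight_bdd_nonneg fc gc by auto
  show "joint_cont (convol f g)"
    unfolding joint_cont_def continuous_on_eq_continuous_within convol_def
  proof (intro ballI continuous_intros)
    fix a assume a: "a \<in> dom"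
    show "continuous (at a within dom) (\<lambda>p. \<integral>\<eta>. f (fst p) \<eta> * g (fst p) (snd p - \<eta>) \<partial>lborel)"
    proof (rule continuous_integral_dominated[OF a])
      show "integrable lborel (\<lambda>x. A * B * (1 / (1 + x\<^sup>2)))"
        by (intro integrable_mult_right integrable_inverse_1_plus_sq)
      fix p :: "real \<times> real" assume p: "p \<in> dom"
      have [measurable]: "f (fst p) \<in> borel_measurable borel" "g (fst p) \<in> borel_measurable borel"
        using fc gc p by (auto simp: joint_cont_measurable)
      show "(\<lambda>\<eta>. f (fst p) \<eta> * g (fst p) (snd p - \<eta>)) \<in> borel_measurable lborel" by measurable
      show "cmod (f (fst p) \<eta> * g (fst p) (snd p - \<eta>)) \<le> A * B * (1 / (1 + \<eta>\<^sup>2))" for \<eta>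
        using p by (intro convol_integrand_bound fc gc) auto
    next
      have "continuous_on dom (\<lambda>p. f (fst p) \<eta>)" for \<eta>
        by (intro joint_cont_compose fc continuous_intros) auto
      moreover have "continuous_on dom (\<lambda>p. g (fst p) (snd p - \<eta>))" for \<eta>
        by (intro joint_cont_compose gc continuous_intros) auto
      ultimately show "AE \<eta> in lborel. continuous (at a within dom) (\<lambda>p. f (fst p) \<eta> * g (fst p) (snd p - \<eta>))"
        using a by (intro AE_I2 continuous_intros) (auto simp: continuous_on_eq_continuous_within)
    qed
  qed simp
  show "weight_bdd (K * A * B) (convol f g)"
    unfolding weight_bdd_def
  proof (intro ballI allI)
    fix t \<xi> :: real assume t: "t \<in> {0..T}"
    have i1: "integrable lborel (\<lambda>\<eta>. 1 / (1 + (\<xi> - \<eta>)\<^sup>2))"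
      and i2: "(\<integral>\<eta>. 1 / (1 + (\<xi> - \<eta>)\<^sup>2) \<partial>lborel) = (\<integral>x. 1 / (1 + x\<^sup>2) \<partial>lborel)"
      using lborel_integrable_real_affine[OF integrable_inverse_1_plus_sq, of "- 1" \<xi>]
        lborel_integral_real_affine[of "- 1" "\<lambda>x. 1 / (1 + x\<^sup>2)" \<xi>] by simp_all
    have "cmod (\<integral>\<eta>. f t \<eta> * g t (\<xi> - \<eta>) \<partial>lborel) \<le> (\<integral>\<eta>. cmod (f t \<eta> * g t (\<xi> - \<eta>)) \<partial>lborel)"
      by (rule integral_norm_bound)
    also have "\<dots> \<le> (\<integral>\<eta>. (A * B) * (2 * W t \<xi>) * (1 / (1 + \<eta>\<^sup>2) + 1 / (1 + (\<xi> - \<eta>)\<^sup>2)) \<partial>lborel)"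
    proof (intro integral_mono integrable_norm convol_integrable[OF f g t] integrable_mult_right
        Bochner_Integration.integrable_add i1 integrable_inverse_1_plus_sq)
      fix \<eta> :: real
      have "cmod (f t \<eta> * g t (\<xi> - \<eta>)) \<le> (A * W t \<eta>) * (B * W t (\<xi> - \<eta>))"
        unfolding norm_mult using fc gc t AB W_pos
        by (intro mult_mono wbD mult_nonneg_nonneg less_imp_le[OF W_pos]) auto
      also have "\<dots> = (A * B) * (W t \<eta> * W t (\<xi> - \<eta>))" by simp
      also have "\<dots> \<le> (A * B) * (2 * W t \<xi> * (1 / (1 + \<eta>\<^sup>2) + 1 / (1 + (\<xi> - \<eta>)\<^sup>2)))"
        using AB t by (intro mult_left_mono W_conv) auto
      finally show "cmod (f t \<eta> * g t (\<xi> - \<eta>)) \<le> (A * B) * (2 * W t \<xi>) * (1 / (1 + \<eta>\<^sup>2) + 1 / (1 + (\<xi> - \<eta>)\<^sup>2))"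
        by (simp add: mult.assoc)
    qed
    also have "\<dots> = (A * B) * (2 * W t \<xi>) * (2 * (\<integral>x. 1 / (1 + x\<^sup>2) \<partial>lborel))"
      using i1 integrable_inverse_1_plus_sq by (simp add: i2)
    finally have le: "cmod (\<integral>\<eta>. f t \<eta> * g t (\<xi> - \<eta>) \<partial>lborel)
        \<le> (A * B) * (2 * W t \<xi>) * (2 * (\<integral>x. 1 / (1 + x\<^sup>2) \<partial>lborel))" .
    have "cmod (convol f g t \<xi>) = cmod (\<integral>\<eta>. f t \<eta> * g t (\<xi> - \<eta>) \<partial>lborel) / (2 * pi)"
      by (simp add: convol_def norm_divide)
    also have "\<dots> \<le> (A * B) * (2 * W t \<xi>) * (2 * (\<integral>x. 1 / (1 + x\<^sup>2) \<partial>lborel)) / (2 * pi)"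
      by (rule divide_right_mono[OF le]) simp
    finally have "cmod (convol f g t \<xi>) \<le> (A * B) * (2 * W t \<xi>) * (2 * (\<integral>x. 1 / (1 + x\<^sup>2) \<partial>lborel)) / (2 * pi)" .
    then show "cmod (convol f g t \<xi>) \<le> K * A * B * W t \<xi>"
      by (simp add: K_def mult_ac)
  qed
qed

text \<open>Telescoping: \<open>f g - f' g' = (f - f') g + f' (g - g')\<close>.\<close>

lemma weight_dist_convol:
  assumes f: "weighted A f" "weighted B f'" and g: "weighted C g" "weighted E g'" and d: "weight_dist D f f'" "weight_dist G g g'"
  shows "weight_dist (K * D * C + K * B * G) (convol f g) (convol f' g')"
proof -
  have 1: "weighted D (\<lambda>t \<xi>. f t \<xi> - f' t \<xi>)" and 2: "weighted G (\<lambda>t \<xi>. g t \<xi> - g' t \<xi>)"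
    using f g d by (auto simp: weighted_def weight_dist_def joint_cont_diff)
  have "convol f g t \<xi> - convol f' g' t \<xi> = convol (\<lambda>t \<xi>. f t \<xi> - f' t \<xi>) g t \<xi> + convol f' (\<lambda>t \<xi>. g t \<xi> - g' t \<xi>) t \<xi>"
    if t: "t \<in> {0..T}" for t \<xi>
  proof -
    have "(\<integral>\<eta>. f t \<eta> * g t (\<xi> - \<eta>) \<partial>lborel) - (\<integral>\<eta>. f' t \<eta> * g' t (\<xi> - \<eta>) \<partial>lborel) =
        (\<integral>\<eta>. (f t \<eta> - f' t \<eta>) * g t (\<xi> - \<eta>) \<partial>lborel) + (\<integral>\<eta>. f' t \<eta> * (g t (\<xi> - \<eta>) - g' t (\<xi> - \<eta>)) \<partial>lborel)"
      using convol_integrable[OF f(1) g(1) t] convol_integrable[OF f(2) g(2) t] convol_integrable[OF f(2) g(1) t]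
      by (simp add: left_diff_distrib right_diff_distrib)
    then show ?thesis unfolding convol_def by (simp flip: diff_divide_distrib add_divide_distrib)
  qed
  moreover have "weight_bdd (K * D * C + K * B * G)
      (\<lambda>t \<xi>. convol (\<lambda>t \<xi>. f t \<xi> - f' t \<xi>) g t \<xi> + convol f' (\<lambda>t \<xi>. g t \<xi> - g' t \<xi>) t \<xi>)"
    using weighted_convol[OF 1 g(1)] weighted_convol[OF f(2) 2] unfolding weighted_def by (intro weight_bdd_add) auto
  ultimately show ?thesis unfolding weight_dist_def weight_bdd_def by simp
qed

section \<open>Free evolution and Duhamel integral on weighted functions\<close>

definition free :: "(real \<Rightarrow> real) \<Rightarrow> (real \<Rightarrow> complex) \<Rightarrow> real \<Rightarrow> real \<Rightarrow> complex" where
  "free m g t \<xi> = cis (- (t * m \<xi>)) * g \<xi>"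

text \<open>A Lebesgue integral over the whole line with an indicator: the domain of integration
  does not vary with \<open>t\<close>, as dominated convergence and Fubini require.\<close>

definition duhamel_int :: "(real \<Rightarrow> real) \<Rightarrow> (real \<Rightarrow> real \<Rightarrow> complex) \<Rightarrow> real \<Rightarrow> real \<Rightarrow> complex" where
  "duhamel_int m f t \<xi> = (\<integral>\<tau>. indicator {0..t} \<tau> *\<^sub>R (cis (- ((t - \<tau>) * m \<xi>)) * f \<tau> \<xi>) \<partial>lborel)"

lemma weighted_free:
  assumes m: "continuous_on UNIV m" and g: "continuous_on UNIV g" and bound: "\<And>\<xi>. cmod (g \<xi>) \<le> H * W 0 \<xi>"
  shows "weighted H (free m g)"
  unfolding weighted_def
proof
  have "continuous_on dom (\<lambda>p. m (snd p))" "continuous_on dom (\<lambda>p. g (snd p))"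
    by (auto intro!: continuous_on_compose2[OF m] continuous_on_compose2[OF g] continuous_intros)
  then show "joint_cont (free m g)"
    unfolding joint_cont_def free_def cis_conv_exp by (intro continuous_intros)
  show "weight_bdd H (free m g)"
    unfolding weight_bdd_def
  proof (intro ballI allI)
    fix t \<xi> assume t: "t \<in> {0..T}"
    have "0 \<le> H * W 0 0" using bound[of 0] norm_ge_zero order_trans by blast
    then have "H \<ge> 0" using W_pos[of 0 0] by (simp add: zero_le_mult_iff)
    have "cmod (free m g t \<xi>) \<le> H * W 0 \<xi>" using bound by (simp add: free_def norm_mult)
    also have "\<dots> \<le> H * W t \<xi>" using t \<open>H \<ge> 0\<close> by (intro mult_left_mono W_mono) auto
    finally show "cmod (free m g t \<xi>) \<le> H * W t \<xi>" .
  qed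
qed

lemma duhamel_int_integrable:
  assumes f: "joint_cont f" and t: "t \<in> {0..T}"
  shows "integrable lborel (\<lambda>\<tau>. indicator {0..t} \<tau> *\<^sub>R (cis (- ((t - \<tau>) * m \<xi>)) * f \<tau> \<xi>))"
  unfolding cis_conv_exp
  by (intro borel_integrable_compact[unfolded set_integrable_def] compact_Icc continuous_intros
      continuous_on_subset[OF joint_cont_slice_time[OF f]]) (use t in auto)

text \<open>The bound \<open>C\<close> is a plain one instead of a weighted one, so that integrands
  carrying the factor \<open>\<xi>\<close> are covered too.\<close>

lemma joint_cont_duhamel_int:
  assumes m: "continuous_on UNIV m" and f: "joint_cont f"
    and bound: "\<And>t \<xi>. t \<in> {0..T} \<Longrightarrow> cmod (f t \<xi>) \<le> C"
  shows "joint_cont (duhamel_int m f)"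
  unfolding joint_cont_def continuous_on_eq_continuous_within duhamel_int_def
proof (intro ballI)
  fix a assume a: "a \<in> dom"
  show "continuous (at a within dom) (\<lambda>p. \<integral>\<tau>. indicator {0..fst p} \<tau> *\<^sub>R (cis (- ((fst p - \<tau>) * m (snd p))) * f \<tau> (snd p)) \<partial>lborel)"
  proof (rule continuous_integral_dominated[OF a])
    show "integrable lborel (\<lambda>\<tau>. C * indicator {0..T} \<tau> :: real)"
      by (intro integrable_mult_right) (simp add: integrable_indicator_iff emeasure_lborel_Icc_eq)
    fix p :: "real \<times> real" assume p: "p \<in> dom"
    show "(\<lambda>\<tau>. indicator {0..fst p} \<tau> *\<^sub>R (cis (- ((fst p - \<tau>) * m (snd p))) * f \<tau> (snd p))) \<in> borel_measurable lborel"
      by (rule borel_measurable_integrable[OF duhamel_int_integrable[OF f]]) (use p in auto)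
    show "cmod (indicator {0..fst p} \<tau> *\<^sub>R (cis (- ((fst p - \<tau>) * m (snd p))) * f \<tau> (snd p))) \<le> C * indicator {0..T} \<tau>" for \<tau>
      using p bound[of \<tau> "snd p"] order_trans[OF norm_ge_zero bound[of 0 0]] T_nonneg
      by (auto simp: indicator_def norm_mult)
  next
    \<comment> \<open>Only at \<open>\<tau> = fst a\<close> can the indicator jump as the time
      varies near \<open>a\<close>; for every other \<open>\<tau>\<close> it is locally
      constant.\<close>
    have "AE \<tau> in lborel. \<tau> \<noteq> fst a" by (rule AE_lborel_singleton)
    then show "AE \<tau> in lborel. continuous (at a within dom)
        (\<lambda>p. indicator {0..fst p} \<tau> *\<^sub>R (cis (- ((fst p - \<tau>) * m (snd p))) * f \<tau> (snd p)))"
    proof eventually_elim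
      fix \<tau> :: real assume ne: "\<tau> \<noteq> fst a"
      show "continuous (at a within dom) (\<lambda>p. indicator {0..fst p} \<tau> *\<^sub>R (cis (- ((fst p - \<tau>) * m (snd p))) * f \<tau> (snd p)))"
      proof (cases "\<tau> \<in> {0..T}")
        case False
        have "continuous_on dom (\<lambda>p. indicator {0..fst p} \<tau> *\<^sub>R (cis (- ((fst p - \<tau>) * m (snd p))) * f \<tau> (snd p)))"
          by (rule continuous_on_eq[OF continuous_on_const[of _ 0]]) (use False in \<open>auto simp: indicator_def\<close>)
        then show ?thesis using a unfolding continuous_on_eq_continuous_within by blast
      next
        case True
        have fst_lim: "((\<lambda>p. fst p) \<longlongrightarrow> fst a) (at a within dom)"
          by (intro tendsto_intros)
        have "\<forall>\<^sub>F p in at a within dom. indicator {0..fst p} \<tau> = (indicator {0..fst a} \<tau> :: real)"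
        proof (cases "\<tau> < fst a")
          case True
          from order_tendstoD(1)[OF fst_lim this] show ?thesis
            by eventually_elim (use True in \<open>auto simp: indicator_def\<close>)
        next
          case False
          with ne have "fst a < \<tau>" by simp
          from order_tendstoD(2)[OF fst_lim this] show ?thesis
            by eventually_elim (use \<open>fst a < \<tau>\<close> in \<open>auto simp: indicator_def\<close>)
        qed
        then have 1: "continuous (at a within dom) (\<lambda>p. indicator {0..fst p} \<tau> :: real)"
          unfolding continuous_within by (rule tendsto_eventually)
        have "continuous_on dom (\<lambda>p. m (snd p))"
          by (auto intro!: continuous_on_compose2[OF m] continuous_intros)
        moreover have "continuous_on dom (\<lambda>p. f \<tau> (snd p))"
          using True by (intro joint_cont_compose f continuous_intros) auto
        ultimately have "continuous_on dom (\<lambda>p. cis (- ((fst p - \<tau>) * m (snd p))) * f \<tau> (snd p))"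
          unfolding cis_conv_exp by (intro continuous_intros)
        then have "continuous (at a within dom) (\<lambda>p. cis (- ((fst p - \<tau>) * m (snd p))) * f \<tau> (snd p))"
          using a unfolding continuous_on_eq_continuous_within by blast
        with 1 show ?thesis by (rule continuous_scaleR)
      qed
    qed
  qed
qed

lemma norm_duhamel_int_le:
  assumes f: "joint_cont f" and t: "t \<in> {0..T}"
    and g: "integrable lborel (\<lambda>\<tau>. indicator {0..t} \<tau> *\<^sub>R g \<tau>)"
    and bound: "\<And>\<tau>. \<tau> \<in> {0..t} \<Longrightarrow> cmod (f \<tau> \<xi>) \<le> g \<tau>"
  shows "cmod (duhamel_int m f t \<xi>) \<le> (\<integral>\<tau>. indicator {0..t} \<tau> *\<^sub>R g \<tau> \<partial>lborel)"
  unfolding duhamel_int_def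
  by (rule order_trans[OF integral_norm_bound integral_mono[OF integrable_norm[OF duhamel_int_integrable[OF f t]] g]])
    (use bound in \<open>auto simp: indicator_def norm_mult\<close>)

text \<open>\<open>W\<close> grows in time, so earlier values are bounded by the final weight and
  the integral costs a factor \<open>T\<close>.\<close>

lemma weight_bdd_duhamel_int:
  assumes f: "weighted C f"
  shows "weight_bdd (T * C) (duhamel_int m f)"
  unfolding weight_bdd_def
proof (intro ballI allI)
  fix t \<xi> assume t: "t \<in> {0..T}"
  have f': "joint_cont f" "weight_bdd C f" "C \<ge> 0" using f weight_bdd_nonneg by (auto simp: weighted_def)
  have "cmod (duhamel_int m f t \<xi>) \<le> (\<integral>\<tau>. indicator {0..t} \<tau> *\<^sub>R (C * W t \<xi>) \<partial>lborel)"
  proof (rule norm_duhamel_int_le[OF f'(1) t])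
    show "integrable lborel (\<lambda>\<tau>. indicator {0..t} \<tau> *\<^sub>R (C * W t \<xi>))"
      by (intro integrable_scaleR_left) (simp add: integrable_indicator_iff emeasure_lborel_Icc_eq)
    fix \<tau> assume \<tau>: "\<tau> \<in> {0..t}"
    have "cmod (f \<tau> \<xi>) \<le> C * W \<tau> \<xi>" using \<tau> t by (intro wbD f') auto
    also have "\<dots> \<le> C * W t \<xi>" using \<tau> f' by (intro mult_left_mono W_mono) auto
    finally show "cmod (f \<tau> \<xi>) \<le> C * W t \<xi>" .
  qed
  also have "\<dots> = t * (C * W t \<xi>)" using t by simp
  also have "\<dots> \<le> T * (C * W t \<xi>)"
    using t f' W_pos by (intro mult_right_mono mult_nonneg_nonneg) (auto intro: less_imp_le)
  finally show "cmod (duhamel_int m f t \<xi>) \<le> T * C * W t \<xi>" by (simp add: mult.assoc)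
qed

lemma weighted_duhamel_int:
  assumes m: "continuous_on UNIV m" and f: "weighted C f"
  shows "weighted (T * C) (duhamel_int m f)"
  unfolding weighted_def
proof
  show "joint_cont (duhamel_int m f)"
    by (rule joint_cont_duhamel_int[OF m, where C = C]) (use f weight_bdd_le in \<open>auto simp: weighted_def\<close>)
qed (rule weight_bdd_duhamel_int[OF f])

lemma W_has_derivative: "((\<lambda>\<tau>. W \<tau> \<xi>) has_real_derivative \<bar>\<xi>\<bar> * W \<tau> \<xi>) (at \<tau> within S)"
  unfolding W_def using one_plus_sq_pos[of \<xi>] by (auto intro!: derivative_eq_intros)

lemma joint_cont_mult_xi: "joint_cont f \<Longrightarrow> joint_cont (\<lambda>t \<xi>. c * of_real \<xi> * f t \<xi>)"
  unfolding joint_cont_def by (intro continuous_intros)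

text \<open>The majorant \<open>C * |\<xi>| * W\<close> is the time derivative of
  \<open>C * W\<close>, so it integrates to a difference of values of \<open>C * W\<close>. The
  constant survives unchanged, without even a factor \<open>T\<close>.\<close>

lemma weighted_duhamel_int_deriv:
  assumes m: "continuous_on UNIV m" and f: "weighted C f"
  shows "weighted C (duhamel_int m (\<lambda>t \<xi>. \<i> * of_real \<xi> * f t \<xi>))"
  unfolding weighted_def
proof
  have f': "joint_cont f" "weight_bdd C f" "C \<ge> 0" using f weight_bdd_nonneg by (auto simp: weighted_def)
  note joint_cont = joint_cont_mult_xi[OF f'(1), of \<i>]
  have bound: "cmod (\<i> * of_real \<xi> * f t \<xi>) \<le> C * (\<bar>\<xi>\<bar> * W t \<xi>)" if "t \<in> {0..T}" for t \<xi>
    using mult_left_mono[OF wbD[OF f'(2) that, of \<xi>] abs_ge_zero[of \<xi>]] by (simp add: norm_mult mult_ac)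
  show "joint_cont (duhamel_int m (\<lambda>t \<xi>. \<i> * of_real \<xi> * f t \<xi>))"
  proof (rule joint_cont_duhamel_int[OF m joint_cont])
    fix t \<xi> assume "t \<in> {0..T}"
    then show "cmod (\<i> * of_real \<xi> * f t \<xi>) \<le> C * 1"
      by (intro order_trans[OF bound] mult_left_mono abs_W_le_1 f') auto
  qed
  show "weight_bdd C (duhamel_int m (\<lambda>t \<xi>. \<i> * of_real \<xi> * f t \<xi>))"
    unfolding weight_bdd_def
  proof (intro ballI allI)
    fix t \<xi> assume t: "t \<in> {0..T}"
    have hi: "has_bochner_integral lborel (\<lambda>\<tau>. indicator {0..t} \<tau> *\<^sub>R (C * (\<bar>\<xi>\<bar> * W \<tau> \<xi>))) (C * W t \<xi> - C * W 0 \<xi>)"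
    proof (rule has_bochner_integral_FTC_Icc)
      show "0 \<le> t" using t by simp
      show "((\<lambda>\<tau>. C * W \<tau> \<xi>) has_vector_derivative C * (\<bar>\<xi>\<bar> * W \<tau> \<xi>)) (at \<tau> within {0..t})" for \<tau>
        using DERIV_cmult[OF W_has_derivative[of \<xi> \<tau> "{0..t}"], of C]
        by (simp add: has_real_derivative_iff_has_vector_derivative)
      show "continuous_on {0..t} (\<lambda>\<tau>. C * (\<bar>\<xi>\<bar> * W \<tau> \<xi>))"
        unfolding W_def using one_plus_sq_pos[of \<xi>] by (intro continuous_intros) auto
    qed
    have "cmod (duhamel_int m (\<lambda>t \<xi>. \<i> * of_real \<xi> * f t \<xi>) t \<xi>) \<le> (\<integral>\<tau>. indicator {0..t} \<tau> *\<^sub>R (C * (\<bar>\<xi>\<bar> * W \<tau> \<xi>)) \<partial>lborel)"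
      using t hi by (intro norm_duhamel_int_le[OF joint_cont t] bound) (auto simp: has_bochner_integral_iff)
    also have "\<dots> = C * W t \<xi> - C * W 0 \<xi>" by (rule has_bochner_integral_integral_eq[OF hi])
    also have "\<dots> \<le> C * W t \<xi>" using f' W_pos[of 0 \<xi>] by simp
    finally show "cmod (duhamel_int m (\<lambda>t \<xi>. \<i> * of_real \<xi> * f t \<xi>) t \<xi>) \<le> C * W t \<xi>" .
  qed
qed

lemma duhamel_int_diff:
  assumes "joint_cont f" "joint_cont g" "t \<in> {0..T}"
  shows "duhamel_int m f t \<xi> - duhamel_int m g t \<xi> = duhamel_int m (\<lambda>t \<xi>. f t \<xi> - g t \<xi>) t \<xi>"
  unfolding duhamel_int_def
  using duhamel_int_integrable[OF assms(1,3), of m \<xi>] duhamel_int_integrable[OF assms(2,3), of m \<xi>]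
  by (simp add: right_diff_distrib scaleR_diff_right)

lemma weight_dist_duhamel_int:
  assumes f: "joint_cont f" "joint_cont g" and d: "weight_dist D f g"
  shows "weight_dist (T * D) (duhamel_int m f) (duhamel_int m g)"
  using weight_bdd_duhamel_int[of D "\<lambda>t \<xi>. f t \<xi> - g t \<xi>" m] f d joint_cont_diff[OF f]
  unfolding weight_dist_def weighted_def by (simp add: weight_bdd_def duhamel_int_diff)

lemma weight_dist_duhamel_int_deriv:
  assumes m: "continuous_on UNIV m" and f: "joint_cont f" "joint_cont g" and d: "weight_dist D f g"
  shows "weight_dist D (duhamel_int m (\<lambda>t \<xi>. \<i> * of_real \<xi> * f t \<xi>)) (duhamel_int m (\<lambda>t \<xi>. \<i> * of_real \<xi> * g t \<xi>))"
proof -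
  have "weighted D (duhamel_int m (\<lambda>t \<xi>. \<i> * of_real \<xi> * (f t \<xi> - g t \<xi>)))"
    using f d by (intro weighted_duhamel_int_deriv m) (simp add: weighted_def weight_dist_def joint_cont_diff)
  then show ?thesis
    unfolding weight_dist_def weighted_def weight_bdd_def
    by (simp add: duhamel_int_diff[OF joint_cont_mult_xi[OF f(1)] joint_cont_mult_xi[OF f(2)]] right_diff_distrib)
qed

text \<open>Completeness for the sequences that occur. The pointwise limit inherits joint continuity
  because \<open>W <= 1\<close> turns the weighted rate into a uniform one; the factor 2 is the sum
  of the geometric series.\<close>

lemma geometric_limit:
  assumes weighted: "\<And>n. weighted R (b n)" and step: "\<And>n. weight_dist (R / 2 ^ n) (b (Suc n)) (b n)"
  shows "\<exists>l. weighted R l \<and> (\<forall>n. weight_dist (2 * R / 2 ^ n) (b n) l)"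
proof -
  have R: "R \<ge> 0" using weighted[of 0] weight_bdd_nonneg by (auto simp: weighted_def)
  \<comment> \<open>The induction carries the exact partial sum \<open>1 - 1 / 2 ^ j\<close>; the
    bare bound \<open>2 * R / 2 ^ n\<close> would not be inductive.\<close>
  have le: "cmod (b (n + j) t \<xi> - b n t \<xi>) \<le> (2 * R / 2 ^ n) * (1 - 1 / 2 ^ j) * W t \<xi>" if t: "t \<in> {0..T}" for n j t \<xi>
  proof (induction j)
    case (Suc j)
    have "cmod (b (n + Suc j) t \<xi> - b n t \<xi>) \<le> cmod (b (Suc (n + j)) t \<xi> - b (n + j) t \<xi>) + cmod (b (n + j) t \<xi> - b n t \<xi>)"
      using norm_triangle_ineq[of "b (Suc (n + j)) t \<xi> - b (n + j) t \<xi>" "b (n + j) t \<xi> - b n t \<xi>"] by simp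
    also have "\<dots> \<le> R / 2 ^ (n + j) * W t \<xi> + (2 * R / 2 ^ n) * (1 - 1 / 2 ^ j) * W t \<xi>"
      using step[of "n + j"] t unfolding weight_dist_def by (intro add_mono Suc wbD[of _ "\<lambda>t \<xi>. b (Suc (n + j)) t \<xi> - b (n + j) t \<xi>"]) auto
    also have "\<dots> = (2 * R / 2 ^ n) * (1 - 1 / 2 ^ Suc j) * W t \<xi>"
      by (simp add: power_add field_simps)
    finally show ?case .
  qed simp
  have le': "cmod (b m t \<xi> - b n t \<xi>) \<le> (2 * R / 2 ^ n) * W t \<xi>" if t: "t \<in> {0..T}" and mn: "n \<le> m" for n m t \<xi>
  proof -
    have "cmod (b m t \<xi> - b n t \<xi>) \<le> (2 * R / 2 ^ n) * (1 - 1 / 2 ^ (m - n)) * W t \<xi>"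
      using le[OF t, of n "m - n" \<xi>] mn by simp
    also have "\<dots> \<le> (2 * R / 2 ^ n) * 1 * W t \<xi>"
      using R W_pos by (intro mult_right_mono mult_left_mono) (auto intro: less_imp_le)
    finally show ?thesis by simp
  qed
  have lim0: "(\<lambda>n. 2 * R / 2 ^ n * c) \<longlonglongrightarrow> 0" for c
  proof -
    have "(\<lambda>n. 2 * R * (1 / 2 :: real) ^ n * c) \<longlonglongrightarrow> 2 * R * 0 * c"
      by (intro tendsto_mult tendsto_const LIMSEQ_power_zero) simp
    then show ?thesis by (simp add: power_one_over)
  qed
  have conv: "convergent (\<lambda>n. b n t \<xi>)" if t: "t \<in> {0..T}" for t \<xi>
  proof (rule Cauchy_convergent, rule CauchyI')
    fix e :: real assume "e > 0"
    from order_tendstoD(2)[OF lim0[of "W t \<xi>"] this]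
    obtain N where N: "\<And>n. n \<ge> N \<Longrightarrow> 2 * R / 2 ^ n * W t \<xi> < e"
      unfolding eventually_sequentially by blast
    show "\<exists>M. \<forall>m\<ge>M. \<forall>n>m. dist (b m t \<xi>) (b n t \<xi>) < e"
    proof (intro exI allI impI)
      fix m n assume "N \<le> m" "m < n"
      then have "cmod (b n t \<xi> - b m t \<xi>) \<le> 2 * R / 2 ^ m * W t \<xi>"
        by (intro le'[OF t]) simp
      also have "\<dots> < e" by (rule N) fact
      finally show "dist (b m t \<xi>) (b n t \<xi>) < e" by (simp add: dist_norm norm_minus_commute)
    qed
  qed
  define l where "l = (\<lambda>t \<xi>. lim (\<lambda>n. b n t \<xi>))"
  have lim: "(\<lambda>n. b n t \<xi>) \<longlonglongrightarrow> l t \<xi>" if "t \<in> {0..T}" for t \<xi>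
    using conv[OF that] by (simp add: l_def convergent_LIMSEQ_iff)
  have bl: "cmod (b n t \<xi> - l t \<xi>) \<le> (2 * R / 2 ^ n) * W t \<xi>" if t: "t \<in> {0..T}" for n t \<xi>
  proof (rule LIMSEQ_le_const2)
    show "(\<lambda>m. cmod (b n t \<xi> - b m t \<xi>)) \<longlonglongrightarrow> cmod (b n t \<xi> - l t \<xi>)"
      by (intro tendsto_intros lim t)
    show "\<exists>N. \<forall>m\<ge>N. cmod (b n t \<xi> - b m t \<xi>) \<le> 2 * R / 2 ^ n * W t \<xi>"
    proof (intro exI allI impI)
      fix m assume "n \<le> m"
      from le'[OF t this] show "cmod (b n t \<xi> - b m t \<xi>) \<le> 2 * R / 2 ^ n * W t \<xi>"
        by (simp add: norm_minus_commute)
    qed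
  qed
  have "joint_cont l"
    unfolding joint_cont_def
  proof (rule uniform_limit_theorem[OF _ _ trivial_limit_sequentially])
    show "\<forall>\<^sub>F n in sequentially. continuous_on dom (\<lambda>p. b n (fst p) (snd p))"
      using weighted by (simp add: weighted_def joint_cont_def)
    show "uniform_limit dom (\<lambda>n p. b n (fst p) (snd p)) (\<lambda>p. l (fst p) (snd p)) sequentially"
    proof (rule uniform_limitI)
      fix e :: real assume "e > 0"
      from order_tendstoD(2)[OF lim0[of 1] this]
      show "\<forall>\<^sub>F n in sequentially. \<forall>p\<in>dom. dist (b n (fst p) (snd p)) (l (fst p) (snd p)) < e"
      proof eventually_elim
        case (elim n)
        show ?case
        proof
          fix p assume p: "p \<in> dom"
          have "cmod (b n (fst p) (snd p) - l (fst p) (snd p)) \<le> (2 * R / 2 ^ n) * W (fst p) (snd p)"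
            using p by (intro bl) auto
          also have "\<dots> \<le> (2 * R / 2 ^ n) * 1"
            using p R by (intro mult_left_mono W_le_1) auto
          finally show "dist (b n (fst p) (snd p)) (l (fst p) (snd p)) < e"
            using elim by (simp add: dist_norm)
        qed
      qed
    qed
  qed
  moreover have "weight_bdd R l"
    unfolding weight_bdd_def
  proof (intro ballI allI)
    fix t \<xi> assume t: "t \<in> {0..T}"
    show "cmod (l t \<xi>) \<le> R * W t \<xi>"
    proof (rule LIMSEQ_le_const2[OF tendsto_norm[OF lim[OF t]]])
      show "\<exists>N. \<forall>n\<ge>N. cmod (b n t \<xi>) \<le> R * W t \<xi>"
        using weighted t by (auto simp: weighted_def weight_bdd_def)
    qed
  qed
  ultimately show ?thesis
    using bl by (auto simp: weighted_def weight_dist_def weight_bdd_def)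
qed

text \<open>Banach's theorem with factor 1/2, iterated from 0. The first step has size at most
  \<open>R\<close>, so the steps decay at the rate that \<open>geometric_limit\<close>
  expects.\<close>

lemma contraction_fixpoint:
  assumes R: "R \<ge> 0" and F: "\<And>b. weighted R b \<Longrightarrow> weighted R (F b)"
    and contr: "\<And>b b' D. weighted R b \<Longrightarrow> weighted R b' \<Longrightarrow> weight_dist D b b' \<Longrightarrow> weight_dist (D / 2) (F b) (F b')"
  obtains b where "weighted R b" "\<And>t \<xi>. t \<in> {0..T} \<Longrightarrow> F b t \<xi> = b t \<xi>"
proof -
  define b where "b = (\<lambda>n. (F ^^ n) (\<lambda>_ _. 0))"
  have zero: "weighted R (\<lambda>_ _. 0)"
    using R less_imp_le[OF W_pos] by (auto simp: weighted_def joint_cont_def weight_bdd_def intro!: mult_nonneg_nonneg)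
  have weighted: "weighted R (b n)" for n
    by (induction n) (simp_all add: b_def zero F)
  have step: "weight_dist (R / 2 ^ n) (b (Suc n)) (b n)" for n
  proof (induction n)
    case 0
    have "b 0 = (\<lambda>_ _. 0)" by (simp add: b_def)
    then show ?case using weighted[of 1] by (simp add: weight_dist_def weighted_def)
  next
    case (Suc n)
    have "weight_dist (R / 2 ^ n / 2) (F (b (Suc n))) (F (b n))" by (intro contr weighted Suc)
    then show ?case by (simp add: b_def mult.commute)
  qed
  obtain l where l: "weighted R l" "\<And>n. weight_dist (2 * R / 2 ^ n) (b n) l"
    using geometric_limit[OF weighted step] by blast
  have "F l t \<xi> = l t \<xi>" if t: "t \<in> {0..T}" for t \<xi>
  proof -
    have "cmod (F l t \<xi> - l t \<xi>) \<le> 4 * R * W t \<xi> * (1 / 2) ^ n" for n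
    proof -
      have "weight_dist (2 * R / 2 ^ n / 2) (F (b n)) (F l)" by (intro contr weighted l)
      then have "cmod (b (Suc n) t \<xi> - F l t \<xi>) \<le> 2 * R / 2 ^ n / 2 * W t \<xi>"
        using t by (simp add: b_def weight_dist_def weight_bdd_def)
      moreover have "cmod (b (Suc n) t \<xi> - l t \<xi>) \<le> 2 * R / 2 ^ Suc n * W t \<xi>"
        using l(2)[of "Suc n"] t by (simp add: weight_dist_def weight_bdd_def)
      ultimately have "cmod ((b (Suc n) t \<xi> - l t \<xi>) - (b (Suc n) t \<xi> - F l t \<xi>))
          \<le> 2 * R / 2 ^ Suc n * W t \<xi> + 2 * R / 2 ^ n / 2 * W t \<xi>"
        by (rule order_trans[OF norm_triangle_ineq4 add_mono, rotated])
      also have "\<dots> \<le> 4 * R * W t \<xi> * (1 / 2) ^ n"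
        using R less_imp_le[OF W_pos[of t \<xi>]] by (simp add: power_one_over field_simps)
      finally show ?thesis by simp
    qed
    moreover have "(\<lambda>n. 4 * R * W t \<xi> * (1 / 2) ^ n) \<longlonglongrightarrow> 4 * R * W t \<xi> * 0"
      by (intro tendsto_mult tendsto_const LIMSEQ_power_zero) simp
    ultimately have "cmod (F l t \<xi> - l t \<xi>) \<le> 4 * R * W t \<xi> * 0"
      by (intro LIMSEQ_le_const) auto
    then show ?thesis by simp
  qed
  with l(1) show thesis by (rule that)
qed

end

subsection \<open>The system on the Fourier side\<close>

text \<open>\<open>v1\<close>, \<open>v2\<close> are the wave speeds, \<open>a1\<close>,
  \<open>a2\<close>, \<open>p\<close> the signed coefficients of the products in the first equation,
  and \<open>c1\<close>, \<open>c2\<close> those of the forcings after division by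
  \<open>\<theta>\<close>. \<open>b0\<close>, \<open>p0\<close>, \<open>r0\<close> are the Fourier
  transforms of the data, to be scaled by \<open>s\<close>.\<close>

locale fourier_zr = horizon +
  fixes \<omega> v1 v2 a1 a2 p c1 c2 H :: real and b0 p0 r0 :: "real \<Rightarrow> complex"
  assumes b0: "continuous_on UNIV b0" "\<And>\<xi>. cmod (b0 \<xi>) \<le> H * W 0 \<xi>"
    and p0: "continuous_on UNIV p0" "\<And>\<xi>. cmod (p0 \<xi>) \<le> H * W 0 \<xi>"
    and r0: "continuous_on UNIV r0" "\<And>\<xi>. cmod (r0 \<xi>) \<le> H * W 0 \<xi>"
begin

abbreviation free_B :: "real \<Rightarrow> real \<Rightarrow> complex" where
  "free_B \<equiv> free (\<lambda>\<xi>. \<omega> * \<xi>\<^sup>2) b0"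

text \<open>The transform of \<open>|B|^2\<close> when \<open>b\<close> is that of
  \<open>B\<close>.\<close>

definition sq :: "(real \<Rightarrow> real \<Rightarrow> complex) \<Rightarrow> real \<Rightarrow> real \<Rightarrow> complex" where
  "sq b = convol b (adj b)"

text \<open>The transport equation solved explicitly for given \<open>b\<close>; this eliminates
  both waves from the system.\<close>

definition wave :: "real \<Rightarrow> real \<Rightarrow> (real \<Rightarrow> complex) \<Rightarrow> real \<Rightarrow> (real \<Rightarrow> real \<Rightarrow> complex) \<Rightarrow> real \<Rightarrow> real \<Rightarrow> complex" where
  "wave v c g s b t \<xi> = of_real s * free (\<lambda>\<xi>. v * \<xi>) g t \<xi>
    + of_real c * duhamel_int (\<lambda>\<xi>. v * \<xi>) (\<lambda>t \<xi>. \<i> * of_real \<xi> * sq b t \<xi>) t \<xi>"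

text \<open>The transform of the total factor that multiplies \<open>B\<close> on the right of the
  first equation; \<open>picard\<close> is the Duhamel map with this potential.\<close>

definition potential :: "real \<Rightarrow> (real \<Rightarrow> real \<Rightarrow> complex) \<Rightarrow> real \<Rightarrow> real \<Rightarrow> complex" where
  "potential s b t \<xi> = of_real a1 * wave v1 c1 p0 s b t \<xi> + of_real a2 * wave v2 c2 r0 s b t \<xi>
    + of_real p * sq b t \<xi>"

definition picard :: "real \<Rightarrow> (real \<Rightarrow> real \<Rightarrow> complex) \<Rightarrow> real \<Rightarrow> real \<Rightarrow> complex" where
  "picard s b t \<xi> = of_real s * free_B t \<xi> + - \<i> * duhamel_int (\<lambda>\<xi>. \<omega> * \<xi>\<^sup>2) (convol (potential s b) b) t \<xi>"

text \<open>The part of the potential that is of first order in the data: free waves, without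
  forcing and without \<open>|B|^2\<close>.\<close>

definition potential_lin :: "real \<Rightarrow> real \<Rightarrow> complex" where
  "potential_lin t \<xi> = of_real a1 * free (\<lambda>\<xi>. v1 * \<xi>) p0 t \<xi> + of_real a2 * free (\<lambda>\<xi>. v2 * \<xi>) r0 t \<xi>"

text \<open>The coefficient of \<open>s^2\<close> in the expansion of \<open>b\<close>, that is,
  half of the second derivative in the direction of the data.\<close>

definition quad :: "real \<Rightarrow> real \<Rightarrow> complex" where
  "quad t \<xi> = - \<i> * duhamel_int (\<lambda>\<xi>. \<omega> * \<xi>\<^sup>2) (convol potential_lin free_B) t \<xi>"

text \<open>\<open>A\<close> dominates all coefficients, \<open>R * L\<close> bounds a wave and
  \<open>R * G\<close> the potential, and \<open>R * D * G'\<close> bounds the distance of two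
  potentials whose arguments are \<open>D\<close> apart.\<close>

definition A :: real where "A = \<bar>a1\<bar> + \<bar>a2\<bar> + \<bar>p\<bar> + \<bar>c1\<bar> + \<bar>c2\<bar>"
definition L :: real where "L = 1 + A * K"
definition G :: real where "G = 2 * A * L + A * K"
definition G' :: real where "G' = 4 * A\<^sup>2 * K + 2 * A * K"

lemma A_bounds: "\<bar>a1\<bar> \<le> A" "\<bar>a2\<bar> \<le> A" "\<bar>p\<bar> \<le> A" "\<bar>c1\<bar> \<le> A" "\<bar>c2\<bar> \<le> A" "0 \<le> A"
  by (simp_all add: A_def)

lemma const_nonneg: "0 \<le> L" "0 \<le> G" "0 \<le> G'"
  using A_bounds(6) K_nonneg by (simp_all add: L_def G_def G'_def)

lemma continuous_symbols: "continuous_on UNIV (\<lambda>\<xi>::real. c * \<xi>\<^sup>2)" "continuous_on UNIV (\<lambda>\<xi>::real. c * \<xi>)" for c :: real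
  by (intro continuous_intros)+

lemma H_nonneg: "0 \<le> H"
  using order_trans[OF norm_ge_zero b0(2)[of 0]] W_pos[of 0 0] by (simp add: zero_le_mult_iff)

section \<open>Bounds for the fixed point map\<close>

lemma weighted_free_B: "weighted H free_B"
  by (rule weighted_free[OF continuous_symbols(1) b0])

lemma weighted_sq: "weighted R b \<Longrightarrow> weighted (K * R * R) (sq b)"
  unfolding sq_def by (intro weighted_convol weighted_adj)

lemma weight_dist_sq: "weighted R b \<Longrightarrow> weighted R b' \<Longrightarrow> weight_dist D b b' \<Longrightarrow> weight_dist (K * D * R + K * R * D) (sq b) (sq b')"
  unfolding sq_def by (intro weight_dist_convol[of R b R b' R "adj b" R "adj b'"] weighted_adj weight_dist_adj)

lemma weighted_potential_lin: "weighted (2 * A * H) potential_lin"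
proof (rule weighted_mono)
  show "weighted (cmod (of_real a1) * H + cmod (of_real a2) * H) potential_lin"
    unfolding potential_lin_def[abs_def] by (intro weighted_add weighted_cmult weighted_free continuous_symbols(2) p0 r0)
  have "\<bar>a1\<bar> * H \<le> A * H" "\<bar>a2\<bar> * H \<le> A * H"
    by (intro mult_right_mono A_bounds H_nonneg)+
  then show "cmod (of_real a1) * H + cmod (of_real a2) * H \<le> 2 * A * H"
    by (simp add: algebra_simps)
qed

text \<open>The ball has twice the radius \<open>|s| * H\<close> of the free solution. With
  \<open>R <= 1\<close>, quadratic terms in \<open>R\<close> are absorbed into linear ones.\<close>

context
  fixes s R :: real
  assumes R: "R = 2 * \<bar>s\<bar> * H" "R \<le> 1"
begin

lemma R_nonneg: "0 \<le> R"
  using H_nonneg by (simp add: R)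

lemma KRR_le: "K * R * R \<le> K * R"
  using R_nonneg R(2) K_nonneg by (intro mult_left_le) auto

lemma weighted_wave:
  assumes g: "continuous_on UNIV g" "\<And>\<xi>. cmod (g \<xi>) \<le> H * W 0 \<xi>" and c: "\<bar>c\<bar> \<le> A" and b: "weighted R b"
  shows "weighted (R * L) (wave v c g s b)"
proof (rule weighted_mono)
  show "weighted (cmod (of_real s) * H + cmod (of_real c) * (K * R * R)) (wave v c g s b)"
    unfolding wave_def[abs_def]
    by (intro weighted_add weighted_cmult weighted_free[OF continuous_symbols(2) g] weighted_duhamel_int_deriv[OF continuous_symbols(2)] weighted_sq b)
  have "\<bar>c\<bar> * (K * R * R) \<le> A * (K * R)"
    by (rule mult_mono[OF c KRR_le]) (use A_bounds R_nonneg K_nonneg in auto)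
  moreover have "\<bar>s\<bar> * H \<le> R"
    using R_nonneg by (simp add: R)
  ultimately show "cmod (of_real s) * H + cmod (of_real c) * (K * R * R) \<le> R * L"
    by (simp add: L_def algebra_simps)
qed

text \<open>Only the forcing depends on \<open>b\<close>; the free waves cancel.\<close>

lemma weight_dist_wave:
  assumes c: "\<bar>c\<bar> \<le> A" and b: "weighted R b" "weighted R b'" "weight_dist D b b'"
  shows "weight_dist (A * (2 * K * R * D)) (wave v c g s b) (wave v c g s b')"
proof (rule weight_dist_mono)
  show "weight_dist (0 + cmod (of_real c) * (K * D * R + K * R * D)) (wave v c g s b) (wave v c g s b')"
    unfolding wave_def[abs_def]
    by (intro weight_dist_add weight_dist_refl weight_dist_cmult weight_dist_duhamel_int_deriv continuous_symbols(2) weight_dist_sq b)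
      (use weighted_sq[OF b(1)] weighted_sq[OF b(2)] in \<open>auto simp: weighted_def\<close>)
  have "0 \<le> D" using b(3) weight_bdd_nonneg by (auto simp: weight_dist_def)
  then have "\<bar>c\<bar> * (2 * K * R * D) \<le> A * (2 * K * R * D)"
    using c R_nonneg K_nonneg by (intro mult_right_mono) auto
  then show "0 + cmod (of_real c) * (K * D * R + K * R * D) \<le> A * (2 * K * R * D)"
    by (simp add: algebra_simps)
qed

lemma weighted_potential:
  assumes b: "weighted R b"
  shows "weighted (R * G) (potential s b)"
proof (rule weighted_mono)
  show "weighted (cmod (of_real a1) * (R * L) + cmod (of_real a2) * (R * L) + cmod (of_real p) * (K * R * R)) (potential s b)"
    unfolding potential_def[abs_def]
    by (intro weighted_add weighted_cmult weighted_wave p0 r0 b weighted_sq A_bounds)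
  have "\<bar>p\<bar> * (K * R * R) \<le> A * (K * R)"
    by (rule mult_mono[OF A_bounds(3) KRR_le]) (use A_bounds R_nonneg K_nonneg in auto)
  moreover have "\<bar>a1\<bar> * (R * L) \<le> A * (R * L)" "\<bar>a2\<bar> * (R * L) \<le> A * (R * L)"
    using R_nonneg const_nonneg by (intro mult_right_mono A_bounds; simp)+
  ultimately show "cmod (of_real a1) * (R * L) + cmod (of_real a2) * (R * L) + cmod (of_real p) * (K * R * R) \<le> R * G"
    by (simp add: G_def algebra_simps)
qed

lemma weight_dist_potential:
  assumes b: "weighted R b" "weighted R b'" "weight_dist D b b'"
  shows "weight_dist (R * D * G') (potential s b) (potential s b')"
proof (rule weight_dist_mono)
  show "weight_dist (cmod (of_real a1) * (A * (2 * K * R * D)) + cmod (of_real a2) * (A * (2 * K * R * D))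
      + cmod (of_real p) * (K * D * R + K * R * D)) (potential s b) (potential s b')"
    unfolding potential_def[abs_def]
    by (intro weight_dist_add weight_dist_cmult weight_dist_wave b weight_dist_sq A_bounds)
  have D: "0 \<le> D" using b(3) weight_bdd_nonneg by (auto simp: weight_dist_def)
  have "\<bar>p\<bar> * (2 * K * R * D) \<le> A * (2 * K * R * D)"
    using D R_nonneg K_nonneg by (intro mult_right_mono A_bounds) simp
  moreover have "\<bar>a1\<bar> * (A * (2 * K * R * D)) \<le> A * (A * (2 * K * R * D))"
    "\<bar>a2\<bar> * (A * (2 * K * R * D)) \<le> A * (A * (2 * K * R * D))"
    using D R_nonneg K_nonneg A_bounds(6) by (intro mult_right_mono A_bounds; simp)+
  ultimately show "cmod (of_real a1) * (A * (2 * K * R * D)) + cmod (of_real a2) * (A * (2 * K * R * D))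
      + cmod (of_real p) * (K * D * R + K * R * D) \<le> R * D * G'"
    by (simp add: G'_def algebra_simps power2_eq_square)
qed

lemma weighted_nonlin:
  assumes b: "weighted R b"
  shows "weighted (T * (K * (R * G) * R)) (duhamel_int (\<lambda>\<xi>. \<omega> * \<xi>\<^sup>2) (convol (potential s b) b))"
  by (intro weighted_duhamel_int continuous_symbols weighted_convol weighted_potential b)

text \<open>Everything beyond the free evolution contains the potential times \<open>b\<close>,
  hence is of order \<open>R^2\<close>.\<close>

lemma weight_dist_picard_free:
  assumes b: "weighted R b"
  shows "weight_dist (T * (K * (R * G) * R)) (picard s b) (\<lambda>t \<xi>. of_real s * free_B t \<xi>)"
  using weight_bdd_cmult[of _ _ "- \<i>"] weighted_nonlin[OF b] by (simp add: weight_dist_def picard_def weighted_def weight_bdd_def norm_mult)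

text \<open>Smallness of \<open>R\<close>, that is of \<open>s\<close>, for the given
  \<open>T\<close>. The share of \<open>G\<close> lets \<open>picard\<close> map the ball to itself;
  the sum \<open>G + G'\<close> makes it contract by 1/2.\<close>

context
  assumes small: "T * K * R * (G + G') \<le> 1 / 2"
begin

lemma TKRG: "T * K * R * G \<le> 1 / 2"
proof -
  have "0 \<le> T * K * R * G'"
    using T_nonneg K_nonneg R_nonneg const_nonneg by simp
  then show ?thesis using small by (simp add: distrib_left)
qed

lemma weighted_picard:
  assumes b: "weighted R b"
  shows "weighted R (picard s b)"
proof (rule weighted_mono)
  show "weighted (cmod (of_real s) * H + cmod (- \<i>) * (T * (K * (R * G) * R))) (picard s b)"
    unfolding picard_def[abs_def] by (intro weighted_add weighted_cmult weighted_free_B weighted_nonlin b)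
  have "(T * K * R * G) * R \<le> 1 / 2 * R" by (intro mult_right_mono TKRG R_nonneg)
  then show "cmod (of_real s) * H + cmod (- \<i>) * (T * (K * (R * G) * R)) \<le> R"
    by (simp add: R(1) mult_ac)
qed

lemma weight_dist_picard:
  assumes b: "weighted R b" "weighted R b'" "weight_dist D b b'"
  shows "weight_dist (D / 2) (picard s b) (picard s b')"
proof (rule weight_dist_mono)
  show "weight_dist (0 + cmod (- \<i>) * (T * (K * (R * D * G') * R + K * (R * G) * D))) (picard s b) (picard s b')"
    unfolding picard_def[abs_def]
    by (intro weight_dist_add weight_dist_refl weight_dist_cmult weight_dist_duhamel_int weight_dist_convol[where A = "R * G" and B = "R * G" and C = R and E = R] weight_dist_potential weighted_potential b)
      (use weighted_convol[OF weighted_potential[OF b(1)] b(1)] weighted_convol[OF weighted_potential[OF b(2)] b(2)] in \<open>auto simp: weighted_def\<close>)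
  have D: "0 \<le> D" using b(3) weight_bdd_nonneg by (auto simp: weight_dist_def)
  have "T * K * R * G' * D * R \<le> T * K * R * G' * D"
    using T_nonneg K_nonneg R_nonneg const_nonneg D R(2) by (intro mult_left_le) auto
  moreover have "(T * K * R * (G + G')) * D \<le> 1 / 2 * D" by (intro mult_right_mono small D)
  ultimately show "0 + cmod (- \<i>) * (T * (K * (R * D * G') * R + K * (R * G) * D)) \<le> D / 2"
    by (simp add: algebra_simps)
qed

lemma picard_fixpoint:
  obtains b where "weighted R b" "\<And>t \<xi>. t \<in> {0..T} \<Longrightarrow> picard s b t \<xi> = b t \<xi>"
  using contraction_fixpoint[of R "picard s", OF R_nonneg weighted_picard weight_dist_picard] by blast

end

text \<open>What distinguishes the potential from its linear part always contains
  \<open>sq b\<close>, which is of order \<open>R^2\<close>.\<close>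

lemma weight_dist_potential_lin:
  assumes b: "weighted R b"
  shows "weight_dist ((2 * A\<^sup>2 * K + A * K) * R * R) (potential s b) (\<lambda>t \<xi>. of_real s * potential_lin t \<xi>)"
proof -
  have wave: "weight_dist (A * (K * R * R)) (wave v c g s b) (\<lambda>t \<xi>. of_real s * free (\<lambda>\<xi>. v * \<xi>) g t \<xi>)" if "\<bar>c\<bar> \<le> A" for v c g
  proof -
    have "weighted (cmod (of_real c) * (K * R * R)) (\<lambda>t \<xi>. of_real c * duhamel_int (\<lambda>\<xi>. v * \<xi>) (\<lambda>t \<xi>. \<i> * of_real \<xi> * sq b t \<xi>) t \<xi>)"
      by (intro weighted_cmult weighted_duhamel_int_deriv continuous_symbols(2) weighted_sq b)
    then have "weighted (A * (K * R * R)) (\<lambda>t \<xi>. of_real c * duhamel_int (\<lambda>\<xi>. v * \<xi>) (\<lambda>t \<xi>. \<i> * of_real \<xi> * sq b t \<xi>) t \<xi>)"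
      by (rule weighted_mono) (use that K_nonneg R_nonneg in \<open>auto intro!: mult_right_mono\<close>)
    then show ?thesis by (simp add: weight_dist_def wave_def weighted_def)
  qed
  have sq0: "weight_dist (K * R * R) (sq b) (\<lambda>t \<xi>. 0)"
    using weighted_sq[OF b] by (simp add: weight_dist_def weighted_def)
  have "weight_dist (cmod (of_real a1) * (A * (K * R * R)) + cmod (of_real a2) * (A * (K * R * R)) + cmod (of_real p) * (K * R * R))
      (potential s b) (\<lambda>t \<xi>. of_real a1 * (of_real s * free (\<lambda>\<xi>. v1 * \<xi>) p0 t \<xi>)
        + of_real a2 * (of_real s * free (\<lambda>\<xi>. v2 * \<xi>) r0 t \<xi>) + of_real p * 0)"
    unfolding potential_def[abs_def] by (intro weight_dist_add weight_dist_cmult wave sq0 A_bounds)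
  then have "weight_dist (\<bar>a1\<bar> * (A * (K * R * R)) + \<bar>a2\<bar> * (A * (K * R * R)) + \<bar>p\<bar> * (K * R * R))
      (potential s b) (\<lambda>t \<xi>. of_real s * potential_lin t \<xi>)"
    by (simp add: potential_lin_def algebra_simps)
  then show ?thesis
  proof (rule weight_dist_mono)
    have KRR: "0 \<le> K * R * R" using K_nonneg R_nonneg by simp
    have "\<bar>a1\<bar> * (A * (K * R * R)) \<le> A * (A * (K * R * R))" "\<bar>a2\<bar> * (A * (K * R * R)) \<le> A * (A * (K * R * R))"
      "\<bar>p\<bar> * (K * R * R) \<le> A * (K * R * R)"
      using KRR A_bounds(6) by (intro mult_right_mono A_bounds; simp)+
    then show "\<bar>a1\<bar> * (A * (K * R * R)) + \<bar>a2\<bar> * (A * (K * R * R)) + \<bar>p\<bar> * (K * R * R)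
        \<le> (2 * A\<^sup>2 * K + A * K) * R * R"
      by (simp add: algebra_simps power2_eq_square)
  qed
qed

text \<open>In the product of potential and \<open>b\<close> both factors are replaced by their
  linear parts. The first replacement costs \<open>R^2\<close> times the size \<open>R\<close> of
  \<open>b\<close>, the second costs \<open>|s|\<close> times the distance of \<open>b\<close> to
  the free evolution, again of order \<open>R^2\<close>. The total is cubic.\<close>

lemma weight_dist_quad:
  assumes b: "weighted R b" and fix_b: "\<And>t \<xi>. t \<in> {0..T} \<Longrightarrow> picard s b t \<xi> = b t \<xi>"
  shows "weight_dist (T * (K * ((2 * A\<^sup>2 * K + A * K) * R * R) * R + K * (\<bar>s\<bar> * (2 * A * H)) * (T * (K * (R * G) * R))))
    b (\<lambda>t \<xi>. of_real s * free_B t \<xi> + of_real (s\<^sup>2) * quad t \<xi>)"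
proof -
  let ?B = "\<lambda>t \<xi>. of_real s * free_B t \<xi>" and ?P = "\<lambda>t \<xi>. of_real s * potential_lin t \<xi>"
  let ?m = "\<lambda>\<xi>. \<omega> * \<xi>\<^sup>2"
  let ?D = "K * ((2 * A\<^sup>2 * K + A * K) * R * R) * R + K * (\<bar>s\<bar> * (2 * A * H)) * (T * (K * (R * G) * R))"
  have dB: "weight_dist (T * (K * (R * G) * R)) b ?B"
    using weight_dist_picard_free[OF b] fix_b by (simp add: weight_dist_def weight_bdd_def)
  have cB: "weighted R ?B"
    using weighted_cmult[OF weighted_free_B, of "of_real s"] by (rule weighted_mono) (use R_nonneg in \<open>simp add: R\<close>)
  have cP: "weighted (\<bar>s\<bar> * (2 * A * H)) ?P"
    using weighted_cmult[OF weighted_potential_lin, of "of_real s"] by simp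
  have d: "weight_dist ?D (convol (potential s b) b) (convol ?P ?B)"
    by (rule weight_dist_convol[OF weighted_potential[OF b] cP b cB weight_dist_potential_lin[OF b] dB])
  have "joint_cont (convol (potential s b) b)" "joint_cont (convol ?P ?B)"
    using weighted_convol[OF weighted_potential[OF b] b] weighted_convol[OF cP cB] by (simp_all add: weighted_def)
  from weight_dist_cmult[OF weight_dist_duhamel_int[OF this d, of ?m], of "- \<i>"]
  have "weight_dist (T * ?D) (\<lambda>t \<xi>. - \<i> * duhamel_int ?m (convol (potential s b) b) t \<xi>) (\<lambda>t \<xi>. - \<i> * duhamel_int ?m (convol ?P ?B) t \<xi>)"
    by simp
  moreover have "duhamel_int ?m (convol ?P ?B) t \<xi> = of_real (s\<^sup>2) * duhamel_int ?m (convol potential_lin free_B) t \<xi>" for t \<xi>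
  proof -
    have "convol ?P ?B t \<xi> = of_real (s\<^sup>2) * convol potential_lin free_B t \<xi>" for t \<xi>
    proof -
      have "(\<integral>\<eta>. ?P t \<eta> * ?B t (\<xi> - \<eta>) \<partial>lborel) = (\<integral>\<eta>. of_real (s\<^sup>2) * (potential_lin t \<eta> * free_B t (\<xi> - \<eta>)) \<partial>lborel)"
        by (simp add: power2_eq_square mult_ac)
      then show ?thesis by (simp only: convol_def integral_mult_right_zero) simp
    qed
    then have "duhamel_int ?m (convol ?P ?B) t \<xi> = (\<integral>\<tau>. of_real (s\<^sup>2) * (indicator {0..t} \<tau> *\<^sub>R (cis (- ((t - \<tau>) * ?m \<xi>)) * convol potential_lin free_B \<tau> \<xi>)) \<partial>lborel)"
      by (simp add: duhamel_int_def mult_ac)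
    then show ?thesis by (simp only: integral_mult_right_zero duhamel_int_def)
  qed
  ultimately have "weight_dist (T * ?D) (\<lambda>t \<xi>. - \<i> * duhamel_int ?m (convol (potential s b) b) t \<xi>) (\<lambda>t \<xi>. of_real (s\<^sup>2) * quad t \<xi>)"
    by (simp add: quad_def mult_ac)
  then have "weight_dist (0 + T * ?D) (picard s b) (\<lambda>t \<xi>. of_real s * free_B t \<xi> + of_real (s\<^sup>2) * quad t \<xi>)"
    unfolding picard_def[abs_def] by (intro weight_dist_add weight_dist_refl)
  then show ?thesis using fix_b by (simp add: weight_dist_def weight_bdd_def)
qed

end

text \<open>Since \<open>R = 2 * |s| * H\<close> is proportional to \<open>|s|\<close>, the bound of
  \<open>weight_dist_quad\<close> is exactly a constant times \<open>|s|^3\<close>.\<close>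

theorem small_solutions:
  obtains C s0 where "s0 > 0" "\<And>s. \<bar>s\<bar> < s0 \<Longrightarrow> \<exists>R b. weighted R b \<and> (\<forall>t\<in>{0..T}. \<forall>\<xi>. picard s b t \<xi> = b t \<xi>)
    \<and> weight_dist (C * \<bar>s\<bar> ^ 3) b (\<lambda>t \<xi>. of_real s * free_B t \<xi> + of_real (s\<^sup>2) * quad t \<xi>)"
proof -
  \<comment> \<open>\<open>|s| * M <= 1\<close> has to yield \<open>R <= 1\<close> and the smallness
    condition: the first two summands are these requirements divided by \<open>|s|\<close>, and the
    1 keeps \<open>M\<close> positive.\<close>
  define M where "M = 2 * H + T * K * (2 * H) * (G + G') * 2 + 1"
  have nn: "0 \<le> T * K * (2 * H) * (G + G')"
    using T_nonneg K_nonneg H_nonneg const_nonneg by simp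
  have M: "M > 0" unfolding M_def using nn H_nonneg by linarith
  define C where "C = T * (K * ((2 * A\<^sup>2 * K + A * K) * (2 * H) * (2 * H)) * (2 * H)
      + K * (2 * A * H) * (T * (K * ((2 * H) * G) * (2 * H))))"
  show thesis
  proof (rule that[of "1 / M" C])
    show "1 / M > 0" using M by simp
    fix s :: real assume s: "\<bar>s\<bar> < 1 / M"
    define R where "R = 2 * \<bar>s\<bar> * H"
    have sM: "\<bar>s\<bar> * M \<le> 1" using s M by (simp add: pos_less_divide_eq)
    have "\<bar>s\<bar> * (2 * H) \<le> \<bar>s\<bar> * M" "\<bar>s\<bar> * (T * K * (2 * H) * (G + G') * 2) \<le> \<bar>s\<bar> * M"
      unfolding M_def using nn H_nonneg by (intro mult_left_mono abs_ge_zero; linarith)+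
    then have R1: "R \<le> 1" and small: "T * K * R * (G + G') \<le> 1 / 2"
      using sM by (simp_all add: R_def mult_ac)
    obtain b where b: "weighted R b" "\<And>t \<xi>. t \<in> {0..T} \<Longrightarrow> picard s b t \<xi> = b t \<xi>"
      using picard_fixpoint[OF R_def R1 small] by blast
    have "T * (K * ((2 * A\<^sup>2 * K + A * K) * (2 * x * H) * (2 * x * H)) * (2 * x * H)
        + K * (x * (2 * A * H)) * (T * (K * (2 * x * H * G) * (2 * x * H)))) = C * x ^ 3" for x :: real
      by (simp add: C_def power3_eq_cube algebra_simps)
    from this[of "\<bar>s\<bar>"]
    have "T * (K * ((2 * A\<^sup>2 * K + A * K) * R * R) * R + K * (\<bar>s\<bar> * (2 * A * H)) * (T * (K * (R * G) * R)))
        = C * \<bar>s\<bar> ^ 3"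
      by (simp only: R_def)
    note wdq = weight_dist_quad[OF R_def R1 b, unfolded this]
    show "\<exists>R b. weighted R b \<and> (\<forall>t\<in>{0..T}. \<forall>\<xi>. picard s b t \<xi> = b t \<xi>)
      \<and> weight_dist (C * \<bar>s\<bar> ^ 3) b (\<lambda>t \<xi>. of_real s * free_B t \<xi> + of_real (s\<^sup>2) * quad t \<xi>)"
      by (intro exI[of _ R] exI[of _ b] conjI ballI allI b wdq)
  qed
qed

end

subsection \<open>From the Fourier side to smooth solutions\<close>

context horizon
begin

text \<open>Up to time \<open>T\<close> the decay rate is at least 1, and \<open>exp |\<xi>|\<close>
  beats every power of \<open>1 + \<xi>^2\<close>. So one weighted bound gives all Sobolev exponents
  at once, as \<open>smooth_zr_solution\<close> requires.\<close>

lemma weight_W_bound: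
  obtains M where "0 \<le> M" "\<And>t \<xi>. t \<le> T \<Longrightarrow> (1 + \<xi>\<^sup>2) powr \<sigma> * (W t \<xi>)\<^sup>2 \<le> M * (1 / (1 + \<xi>\<^sup>2))"
proof -
  define n where "n = nat \<lceil>\<bar>\<sigma>\<bar>\<rceil>"
  define M where "M = fact (2 * n) * exp (1::real)"
  have "(1 + \<xi>\<^sup>2) powr \<sigma> * (W t \<xi>)\<^sup>2 \<le> M * (1 / (1 + \<xi>\<^sup>2))" if t: "t \<le> T" for t \<xi>
  proof -
    have pos: "1 + \<xi>\<^sup>2 > 0" by (rule one_plus_sq_pos)
    have "(1 + \<xi>\<^sup>2) powr \<sigma> \<le> (1 + \<xi>\<^sup>2) powr real n"
      by (rule powr_mono) (auto simp: n_def intro: order_trans[OF abs_ge_self] of_nat_ceiling)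
    also have "\<dots> = (1 + \<xi>\<^sup>2) ^ n" using pos by (simp add: powr_realpow)
    also have "\<dots> \<le> ((1 + \<bar>\<xi>\<bar>)\<^sup>2) ^ n"
      by (rule power_mono) (auto simp: power2_sum)
    also have "\<dots> = \<bar>1 + \<bar>\<xi>\<bar>\<bar> ^ (2 * n)" by (simp add: power_mult)
    also have "\<dots> \<le> fact (2 * n) * exp \<bar>1 + \<bar>\<xi>\<bar>\<bar>" by (rule abs_power_le_exp)
    also have "\<dots> = M * exp \<bar>\<xi>\<bar>" by (simp add: M_def exp_add)
    finally have 1: "(1 + \<xi>\<^sup>2) powr \<sigma> \<le> M * exp \<bar>\<xi>\<bar>" .
    have "W t \<xi> \<le> W T \<xi>" by (rule W_mono[OF t])
    then have 2: "W t \<xi> * W t \<xi> \<le> W T \<xi> * (1 / (1 + \<xi>\<^sup>2))"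
      using less_imp_le[OF W_pos] W_le[OF t] by (intro mult_mono) auto
    have "(1 + \<xi>\<^sup>2) powr \<sigma> * (W t \<xi>)\<^sup>2 \<le> (M * exp \<bar>\<xi>\<bar>) * (W T \<xi> * (1 / (1 + \<xi>\<^sup>2)))"
      unfolding power2_eq_square[of "W t \<xi>"]
      by (rule mult_mono[OF 1 2]) (use less_imp_le[OF W_pos[of t \<xi>]] order_trans[OF powr_ge_zero 1] in auto)
    also have "\<dots> = M * (1 / (1 + \<xi>\<^sup>2)) * (1 / (1 + \<xi>\<^sup>2))"
      by (simp add: W_def exp_minus)
    also have "\<dots> \<le> M * (1 / (1 + \<xi>\<^sup>2))"
      using pos by (intro mult_left_le) (auto simp: M_def)
    finally show ?thesis .
  qed
  moreover have "0 \<le> M" by (simp add: M_def)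
  ultimately show thesis using that by blast
qed

lemma wL2_bound:
  obtains M where "0 \<le> M" "\<And>t g \<xi> C. t \<le> T \<Longrightarrow> cmod (g \<xi>) \<le> C * W t \<xi> \<Longrightarrow> wL2 \<sigma> g \<xi> \<le> C\<^sup>2 * M * (1 / (1 + \<xi>\<^sup>2))"
proof -
  obtain M where M: "0 \<le> M" "\<And>t \<xi>. t \<le> T \<Longrightarrow> (1 + \<xi>\<^sup>2) powr \<sigma> * (W t \<xi>)\<^sup>2 \<le> M * (1 / (1 + \<xi>\<^sup>2))"
    using weight_W_bound[of \<sigma>] by blast
  have "wL2 \<sigma> g \<xi> \<le> C\<^sup>2 * M * (1 / (1 + \<xi>\<^sup>2))" if t: "t \<le> T" and g: "cmod (g \<xi>) \<le> C * W t \<xi>" for t g \<xi> C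
  proof -
    have "wL2 \<sigma> g \<xi> \<le> (1 + \<xi>\<^sup>2) powr \<sigma> * (C * W t \<xi>)\<^sup>2"
      unfolding wL2_def using g by (intro mult_left_mono power_mono) auto
    also have "\<dots> = C\<^sup>2 * ((1 + \<xi>\<^sup>2) powr \<sigma> * (W t \<xi>)\<^sup>2)" by (simp add: power_mult_distrib)
    also have "\<dots> \<le> C\<^sup>2 * (M * (1 / (1 + \<xi>\<^sup>2)))" by (intro mult_left_mono M(2) t) simp
    finally show ?thesis by (simp add: mult.assoc)
  qed
  with M(1) show thesis using that by blast
qed

lemma integrable_wL2:
  assumes [measurable]: "g \<in> borel_measurable borel" and t: "t \<le> T" and g: "\<And>\<xi>. cmod (g \<xi>) \<le> C * W t \<xi>"
  shows "integrable lborel (wL2 \<sigma> g)"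
proof -
  obtain M where M: "0 \<le> M" "\<And>t g \<xi> C. t \<le> T \<Longrightarrow> cmod (g \<xi>) \<le> C * W t \<xi> \<Longrightarrow> wL2 \<sigma> g \<xi> \<le> C\<^sup>2 * M * (1 / (1 + \<xi>\<^sup>2))"
    using wL2_bound[of \<sigma>] by blast
  show ?thesis
  proof (rule Bochner_Integration.integrable_bound)
    show "integrable lborel (\<lambda>x. C\<^sup>2 * M * (1 / (1 + x\<^sup>2)))"
      by (intro integrable_mult_right integrable_inverse_1_plus_sq)
    have "norm (wL2 \<sigma> g x) \<le> norm (C\<^sup>2 * M * (1 / (1 + x\<^sup>2)))" for x
      using M(2)[of t g x C, OF t g] wL2_nonneg[of \<sigma> g x] by (simp add: abs_mult M(1))
    then show "AE x in lborel. norm (wL2 \<sigma> g x) \<le> norm (C\<^sup>2 * M * (1 / (1 + x\<^sup>2)))" by simp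
  qed simp
qed

lemma weighted_wL2:
  assumes "weighted C f" "t \<in> {0..T}"
  shows "integrable lborel (wL2 \<sigma> (f t))"
  by (rule integrable_wL2[of _ t C]) (use assms in \<open>auto simp: weighted_def joint_cont_measurable wbD\<close>)

text \<open>Continuity in \<open>H^\<sigma>\<close> is dominated convergence: at each frequency the
  density is continuous in time, and twice the bound at time \<open>T\<close> serves as a common
  majorant.\<close>

lemma fdistr_curve_mem:
  assumes f: "weighted C f"
  shows "(\<lambda>t. if t \<in> {0..T} then fdistr (f t) else 0) \<in> vecs (curve_space T (sobolev \<sigma>))"
proof -
  have f': "joint_cont f" "weight_bdd C f" "C \<ge> 0" using f weight_bdd_nonneg by (auto simp: weighted_def)
  note int = weighted_integrable[OF f]
  obtain M where M: "0 \<le> M" "\<And>t g \<xi> C. t \<le> T \<Longrightarrow> cmod (g \<xi>) \<le> C * W t \<xi> \<Longrightarrow> wL2 \<sigma> g \<xi> \<le> C\<^sup>2 * M * (1 / (1 + \<xi>\<^sup>2))"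
    using wL2_bound[of \<sigma>] by blast
  have cont: "\<exists>d>0. \<forall>t'\<in>{0..T}. \<bar>t' - t\<bar> < d \<longrightarrow> nrm (sobolev \<sigma>) (fdistr (f t') - fdistr (f t)) < e"
    if t: "t \<in> {0..T}" and e: "e > 0" for t e
  proof -
    \<comment> \<open>The squared norm of the difference, written as a complex number because
      \<open>continuous_integral_dominated\<close> is about complex integrands.\<close>
    define \<Phi> where "\<Phi> = (\<lambda>t'. \<integral>\<xi>. complex_of_real (wL2 \<sigma> (\<lambda>\<xi>. f t' \<xi> - f t \<xi>) \<xi>) \<partial>lborel)"
    have "continuous (at t within {0..T}) \<Phi>"
      unfolding \<Phi>_def
    proof (rule continuous_integral_dominated[OF t])
      show "integrable lborel (\<lambda>x. (2 * C)\<^sup>2 * M * (1 / (1 + x\<^sup>2)))"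
        by (intro integrable_mult_right integrable_inverse_1_plus_sq)
      fix t' assume t': "t' \<in> {0..T}"
      have [measurable]: "f t \<in> borel_measurable borel" "f t' \<in> borel_measurable borel"
        using f' t t' by (auto simp: joint_cont_measurable)
      show "(\<lambda>\<xi>. complex_of_real (wL2 \<sigma> (\<lambda>\<xi>. f t' \<xi> - f t \<xi>) \<xi>)) \<in> borel_measurable lborel"
        by measurable
      fix \<xi>
      have "cmod (f t' \<xi> - f t \<xi>) \<le> C * W t' \<xi> + C * W t \<xi>"
        using wbD[OF f'(2)] t t' by (intro order_trans[OF norm_triangle_ineq4] add_mono) auto
      also have "\<dots> \<le> C * W T \<xi> + C * W T \<xi>"
        using t t' f' by (intro add_mono mult_left_mono W_mono) auto
      finally have "cmod (f t' \<xi> - f t \<xi>) \<le> 2 * C * W T \<xi>" by simp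
      from M(2)[of T "\<lambda>\<xi>. f t' \<xi> - f t \<xi>", OF order_refl this]
      show "cmod (complex_of_real (wL2 \<sigma> (\<lambda>\<xi>. f t' \<xi> - f t \<xi>) \<xi>)) \<le> (2 * C)\<^sup>2 * M * (1 / (1 + \<xi>\<^sup>2))"
        using wL2_nonneg[of \<sigma> "\<lambda>\<xi>. f t' \<xi> - f t \<xi>" \<xi>] by (simp only: norm_of_real abs_of_nonneg)
    next
      show "AE \<xi> in lborel. continuous (at t within {0..T}) (\<lambda>t'. complex_of_real (wL2 \<sigma> (\<lambda>\<xi>. f t' \<xi> - f t \<xi>) \<xi>))"
      proof (intro AE_I2)
        fix \<xi> :: real
        have "continuous (at t within {0..T}) (\<lambda>t'. f t' \<xi>)"
          using joint_cont_slice_time[OF f'(1), of \<xi>] t unfolding continuous_on_eq_continuous_within by blast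
        then show "continuous (at t within {0..T}) (\<lambda>t'. complex_of_real (wL2 \<sigma> (\<lambda>\<xi>. f t' \<xi> - f t \<xi>) \<xi>))"
          unfolding wL2_def by (intro continuous_intros)
      qed
    qed
    moreover have "\<Phi> t = 0" by (simp add: \<Phi>_def wL2_def)
    ultimately obtain d where d: "d > 0" "\<And>t'. t' \<in> {0..T} \<Longrightarrow> \<bar>t' - t\<bar> < d \<Longrightarrow> cmod (\<Phi> t') < e\<^sup>2"
      using e unfolding continuous_within_eps_delta dist_real_def dist_norm
      by (metis diff_zero zero_less_power)
    have "nrm (sobolev \<sigma>) (fdistr (f t') - fdistr (f t)) < e" if t': "t' \<in> {0..T}" "\<bar>t' - t\<bar> < d" for t'
    proof -
      have "\<Phi> t' = of_real (\<integral>\<xi>. wL2 \<sigma> (\<lambda>\<xi>. f t' \<xi> - f t \<xi>) \<xi> \<partial>lborel)"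
        unfolding \<Phi>_def by (rule integral_complex_of_real)
      then have "(\<integral>\<xi>. wL2 \<sigma> (\<lambda>\<xi>. f t' \<xi> - f t \<xi>) \<xi> \<partial>lborel) < e\<^sup>2"
        using d(2)[OF t'] by simp
      moreover have "nrm (sobolev \<sigma>) (fdistr (f t') - fdistr (f t)) = sqrt (\<integral>\<xi>. wL2 \<sigma> (\<lambda>\<xi>. f t' \<xi> - f t \<xi>) \<xi> \<partial>lborel)"
        unfolding fdistr_diff[OF int[OF t'(1)] int[OF t]]
        by (rule nrm_fdistr) (intro Bochner_Integration.integrable_diff int t t')
      ultimately show ?thesis using e by (simp add: real_less_lsqrt wL2_nonneg)
    qed
    with d(1) show ?thesis by blast
  qed
  have "fdistr (f t) \<in> vecs (sobolev \<sigma>)" if "t \<in> {0..T}" for t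
    by (intro fdistr_mem_sobolev int weighted_wL2[OF f] that)
  with cont show ?thesis unfolding curve_space_def by simp
qed

end

lemma curve_space_real_sobolevI:
  assumes "u \<in> vecs (curve_space T (sobolev \<sigma>))" "\<And>t. t \<in> {0..T} \<Longrightarrow> real_distr (u t)"
  shows "u \<in> vecs (curve_space T (real_sobolev \<sigma>))"
  using assms by (simp add: curve_space_def real_sobolev_def)

lemma curve_space_contD:
  "u \<in> vecs (curve_space T X) \<Longrightarrow> t \<in> {0..T} \<Longrightarrow> e > 0 \<Longrightarrow>
    \<exists>d>0. \<forall>t'\<in>{0..T}. \<bar>t' - t\<bar> < d \<longrightarrow> nrm X (u t' - u t) < e"
  by (simp add: curve_space_def)

lemma curve_space_prodI:
  assumes u: "u \<in> vecs (curve_space T X)" and v: "v \<in> vecs (curve_space T Y)"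
    and X: "snvs X" and Y: "snvs Y"
  shows "(\<lambda>t. (u t, v t)) \<in> vecs (curve_space T (prod_space X Y))"
proof -
  interpret X: snvs X by fact
  interpret Y: snvs Y by fact
  have mem: "u t \<in> vecs X" "v t \<in> vecs Y" if "t \<in> {0..T}" for t
    using u v that by (simp_all add: curve_space_def)
  have "\<exists>d>0. \<forall>t'\<in>{0..T}. \<bar>t' - t\<bar> < d \<longrightarrow> nrm (prod_space X Y) ((u t', v t') - (u t, v t)) < e"
    if t: "t \<in> {0..T}" and e: "e > 0" for t e
  proof -
    have "e / 2 > 0" using e by simp
    obtain d1 where d1: "d1 > 0" "\<And>t'. t' \<in> {0..T} \<Longrightarrow> \<bar>t' - t\<bar> < d1 \<Longrightarrow> nrm X (u t' - u t) < e / 2"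
      using curve_space_contD[OF u t \<open>e / 2 > 0\<close>] by blast
    obtain d2 where d2: "d2 > 0" "\<And>t'. t' \<in> {0..T} \<Longrightarrow> \<bar>t' - t\<bar> < d2 \<Longrightarrow> nrm Y (v t' - v t) < e / 2"
      using curve_space_contD[OF v t \<open>e / 2 > 0\<close>] by blast
    have "nrm (prod_space X Y) ((u t', v t') - (u t, v t)) < e" if t': "t' \<in> {0..T}" "\<bar>t' - t\<bar> < min d1 d2" for t'
    proof -
      have "nrm (prod_space X Y) ((u t', v t') - (u t, v t)) \<le> nrm X (u t' - u t) + nrm Y (v t' - v t)"
        using sqrt_sum_squares_le_sum[of "nrm X (u t' - u t)" "nrm Y (v t' - v t)"] t t' mem X.diff_mem Y.diff_mem
        by (simp add: prod_space_def X.nrm_nonneg Y.nrm_nonneg)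
      also have "\<dots> < e" using d1(2)[of t'] d2(2)[of t'] t' by simp
      finally show ?thesis .
    qed
    then show ?thesis using d1(1) d2(1) by (intro exI[of _ "min d1 d2"]) auto
  qed
  moreover have "(u t, v t) = 0" if "t \<notin> {0..T}" for t
    using u v that by (simp add: curve_space_def zero_prod_def)
  moreover have "(u t, v t) \<in> vecs (prod_space X Y)" if "t \<in> {0..T}" for t
    using mem[OF that] by (simp add: prod_space_def)
  ultimately show ?thesis unfolding curve_space_def by simp
qed

text \<open>Fubini, followed by the translation \<open>\<xi> -> \<eta> + \<xi>\<close>, which splits
  the exponential.\<close>

lemma inv_fourier_convolution:
  assumes f: "integrable lborel f" and g: "integrable lborel g"
  shows "inv_fourier (\<lambda>\<xi>. (\<integral>\<eta>. f \<eta> * g (\<xi> - \<eta>) \<partial>lborel) / of_real (2 * pi)) x = inv_fourier f x * inv_fourier g x"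
proof -
  have [measurable]: "f \<in> borel_measurable borel" "g \<in> borel_measurable borel"
    using f g by auto
  have gt: "integrable lborel (\<lambda>\<xi>. g (\<xi> - \<eta>))" "(\<integral>\<xi>. norm (g (\<xi> - \<eta>)) \<partial>lborel) = (\<integral>\<xi>. norm (g \<xi>) \<partial>lborel)" for \<eta>
    using lborel_integrable_real_affine[OF g, of 1 "- \<eta>"]
      lborel_integral_real_affine[of 1 "\<lambda>\<xi>. norm (g \<xi>)" "- \<eta>"] by simp_all
  have int: "integrable (lborel \<Otimes>\<^sub>M lborel) (\<lambda>(\<eta>, \<xi>). cis (x * \<xi>) * (f \<eta> * g (\<xi> - \<eta>)))"
  proof (rule lborel_pair.Fubini_integrable)
    show "(\<lambda>(\<eta>, \<xi>). cis (x * \<xi>) * (f \<eta> * g (\<xi> - \<eta>))) \<in> borel_measurable (lborel \<Otimes>\<^sub>M lborel)"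
      by measurable
    show "integrable lborel (\<lambda>\<eta>. \<integral>\<xi>. norm (case (\<eta>, \<xi>) of (\<eta>, \<xi>) \<Rightarrow> cis (x * \<xi>) * (f \<eta> * g (\<xi> - \<eta>))) \<partial>lborel)"
      using f by (simp add: norm_mult gt)
    show "AE \<eta> in lborel. integrable lborel (\<lambda>\<xi>. case (\<eta>, \<xi>) of (\<eta>, \<xi>) \<Rightarrow> cis (x * \<xi>) * (f \<eta> * g (\<xi> - \<eta>)))"
      using gt(1) by (auto intro!: integrable_cis_mult)
  qed
  have inner: "(\<integral>\<xi>. cis (x * \<xi>) * (f \<eta> * g (\<xi> - \<eta>)) \<partial>lborel) = (cis (x * \<eta>) * f \<eta>) * (\<integral>\<xi>. cis (x * \<xi>) * g \<xi> \<partial>lborel)" for \<eta>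
  proof -
    have "(\<integral>\<xi>. cis (x * \<xi>) * (f \<eta> * g (\<xi> - \<eta>)) \<partial>lborel) = (\<integral>\<xi>. cis (x * (\<eta> + \<xi>)) * (f \<eta> * g \<xi>) \<partial>lborel)"
      using lborel_integral_real_affine[of 1 "\<lambda>\<xi>. cis (x * \<xi>) * (f \<eta> * g (\<xi> - \<eta>))" \<eta>] by simp
    also have "\<dots> = (\<integral>\<xi>. (cis (x * \<eta>) * f \<eta>) * (cis (x * \<xi>) * g \<xi>) \<partial>lborel)"
      by (simp add: distrib_left mult_ac flip: cis_mult)
    finally show ?thesis by (simp only: integral_mult_right_zero)
  qed
  have "(\<integral>\<xi>. cis (x * \<xi>) * (\<integral>\<eta>. f \<eta> * g (\<xi> - \<eta>) \<partial>lborel) \<partial>lborel)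
      = (\<integral>\<xi>. (\<integral>\<eta>. cis (x * \<xi>) * (f \<eta> * g (\<xi> - \<eta>)) \<partial>lborel) \<partial>lborel)"
    by simp
  also have "\<dots> = (\<integral>\<eta>. (\<integral>\<xi>. cis (x * \<xi>) * (f \<eta> * g (\<xi> - \<eta>)) \<partial>lborel) \<partial>lborel)"
    by (rule lborel_pair.Fubini_integral[OF int])
  also have "\<dots> = (\<integral>\<eta>. cis (x * \<eta>) * f \<eta> \<partial>lborel) * (\<integral>\<xi>. cis (x * \<xi>) * g \<xi> \<partial>lborel)"
    by (simp only: inner integral_mult_left_zero)
  finally show ?thesis
    by (simp add: inv_fourier_def)
qed

context horizon
begin

lemma inv_fourier_convol:
  assumes "weighted A f" "weighted B g" "t \<in> {0..T}"
  shows "inv_fourier (convol f g t) x = inv_fourier (f t) x * inv_fourier (g t) x"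
  using inv_fourier_convolution[OF weighted_integrable[OF assms(1,3)] weighted_integrable[OF assms(2,3)], of x]
  unfolding convol_def[abs_def] .

lemma inv_fourier_adj: "inv_fourier (adj f t) x = cnj (inv_fourier (f t) x)"
  unfolding cnj_inv_fourier adj_def[abs_def] ..

lemma inv_fourier_self_adj:
  assumes "\<And>\<xi>. f (- \<xi>) = cnj (f \<xi>)"
  shows "of_real (Re (inv_fourier f x)) = inv_fourier f x"
  using cnj_inv_fourier[of f x] assms by (simp add: complex_eq_iff)

text \<open>Duhamel's formula at each frequency, integrated against the inverse transform of a test
  function. Fubini exchanges time and frequency. The bound on \<open>N\<close> is unweighted because
  the transport forcing carries a factor \<open>\<xi>\<close>.\<close>

lemma duhamel_fdistr:
  assumes symb: "\<And>t. symb t = (\<lambda>\<xi>. cis (- (t * m \<xi>)))" and quadr: "m = (\<lambda>\<xi>. a * \<xi>\<^sup>2 + c * \<xi>)"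
    and g: "continuous_on UNIV g" "\<And>\<xi>. cmod (g \<xi>) \<le> D"
    and N: "joint_cont N" "\<And>t \<xi>. t \<in> {0..T} \<Longrightarrow> cmod (N t \<xi>) \<le> C"
    and F: "\<And>t. t \<in> {0..T} \<Longrightarrow> F t = fdistr (N t)"
    and u: "\<And>t. t \<in> {0..T} \<Longrightarrow> u t = fdistr (\<lambda>\<xi>. free m g t \<xi> + duhamel_int m N t \<xi>)"
  shows "duhamel symb F T (fdistr g) u"
  unfolding duhamel_def
proof (intro ballI allI impI)
  fix t \<phi> assume t: "t \<in> {0..T}" and \<phi>: "schwartz \<phi>"
  have m: "continuous_on UNIV m" unfolding quadr by (intro continuous_intros)
  have mult: "fourier_multiplier (symb t) (fdistr h) \<phi> = (\<integral>\<xi>. cis (- (t * m \<xi>)) * h \<xi> * inv_fourier \<phi> \<xi> \<partial>lborel)" for t h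
  proof -
    have "symb t = (\<lambda>\<xi>. cis ((- t * a) * \<xi>\<^sup>2 + (- t * c) * \<xi>))"
      by (simp add: symb quadr fun_eq_iff algebra_simps)
    from fourier_multiplier_fdistr[OF this, of h] show ?thesis
      using \<phi> by (simp add: fdistr_def symb)
  qed
  note inv = schwartz_integrable[OF schwartz_inv_fourier[OF \<phi>]]
  have C: "0 \<le> C" using order_trans[OF norm_ge_zero N(2)[OF zero_mem_Icc]] .
  \<comment> \<open>The integrand on the product of time and frequency: its iterated integrals in
    the two orders are the two forms of the Duhamel term.\<close>
  define h where "h = (\<lambda>\<tau> \<xi>. indicator {0..t} \<tau> *\<^sub>R (cis (- ((t - \<tau>) * m \<xi>)) * N \<tau> \<xi>) * inv_fourier \<phi> \<xi>)"
  have h: "integrable (lborel \<Otimes>\<^sub>M lborel) (case_prod h)"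
  proof (rule Bochner_Integration.integrable_bound)
    have ind: "integrable lborel (\<lambda>\<tau>. complex_of_real (C * indicator {0..t} \<tau>))"
      by (intro integrable_of_real integrable_mult_right) (simp add: integrable_indicator_iff emeasure_lborel_Icc_eq)
    show "integrable (lborel \<Otimes>\<^sub>M lborel) (\<lambda>(\<tau>, \<xi>). 1 * complex_of_real (C * indicator {0..t} \<tau>) * inv_fourier \<phi> \<xi>)"
      by (rule integrable_bounded_kernel[OF _ _ ind inv]) auto
    have sub: "{0..t} \<times> UNIV \<subseteq> dom" using t by auto
    have "continuous_on ({0..t} \<times> UNIV) (\<lambda>p. m (snd p))"
      by (auto intro!: continuous_on_compose2[OF m] continuous_intros)
    moreover have "continuous_on ({0..t} \<times> UNIV) (\<lambda>p. N (fst p) (snd p))"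
      by (rule continuous_on_subset[OF N(1)[unfolded joint_cont_def] sub])
    ultimately have "continuous_on ({0..t} \<times> UNIV) (\<lambda>p. cis (- ((t - fst p) * m (snd p))) * N (fst p) (snd p))"
      unfolding cis_conv_exp by (intro continuous_intros)
    then have 1: "(\<lambda>p. indicator ({0..t} \<times> UNIV) p *\<^sub>R (cis (- ((t - fst p) * m (snd p))) * N (fst p) (snd p)))
        \<in> borel_measurable (borel :: (real \<times> real) measure)"
      by (intro borel_measurable_continuous_on_indicator) (auto intro!: borel_closed closed_Times)
    have [measurable]: "inv_fourier \<phi> \<in> borel_measurable borel" using inv by auto
    have 2: "(\<lambda>p. inv_fourier \<phi> (snd p)) \<in> borel_measurable (borel :: (real \<times> real) measure)"
      unfolding borel_prod[symmetric] by measurable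
    have "case_prod h = (\<lambda>p. indicator ({0..t} \<times> UNIV) p *\<^sub>R (cis (- ((t - fst p) * m (snd p))) * N (fst p) (snd p)) * inv_fourier \<phi> (snd p))"
      by (auto simp: h_def fun_eq_iff indicator_def)
    with borel_measurable_times[OF 1 2] show "case_prod h \<in> borel_measurable (lborel \<Otimes>\<^sub>M lborel)"
      by (simp add: lborel_prod)
    have "norm (h \<tau> \<xi>) \<le> norm (complex_of_real (C * indicator {0..t} \<tau>) * inv_fourier \<phi> \<xi>)" for \<tau> \<xi>
    proof (cases "\<tau> \<in> {0..t}")
      case True
      then have "cmod (N \<tau> \<xi>) \<le> C" using t by (intro N(2)) auto
      then have "cmod (N \<tau> \<xi>) * cmod (inv_fourier \<phi> \<xi>) \<le> C * cmod (inv_fourier \<phi> \<xi>)"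
        by (rule mult_right_mono) simp
      then show ?thesis using True C by (simp add: h_def norm_mult)
    qed (simp add: h_def)
    then show "AE p in lborel \<Otimes>\<^sub>M lborel. norm (case_prod h p)
        \<le> norm (case p of (\<tau>, \<xi>) \<Rightarrow> 1 * complex_of_real (C * indicator {0..t} \<tau>) * inv_fourier \<phi> \<xi>)"
      by (intro AE_I2) (simp add: case_prod_beta')
  qed
  have duhamel_int_int: "(\<integral>\<tau>. h \<tau> \<xi> \<partial>lborel) = duhamel_int m N t \<xi> * inv_fourier \<phi> \<xi>" for \<xi>
    unfolding h_def duhamel_int_def by (simp only: integral_mult_left_zero)
  have swap: "(\<integral>\<xi>. duhamel_int m N t \<xi> * inv_fourier \<phi> \<xi> \<partial>lborel) = (\<integral>\<tau>. (\<integral>\<xi>. h \<tau> \<xi> \<partial>lborel) \<partial>lborel)"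
    unfolding duhamel_int_int[symmetric] by (rule lborel_pair.Fubini_integral[OF h])
  have inner: "(\<integral>\<xi>. h \<tau> \<xi> \<partial>lborel) = indicator {0..t} \<tau> *\<^sub>R fourier_multiplier (symb (t - \<tau>)) (F \<tau>) \<phi>" for \<tau>
  proof (cases "\<tau> \<in> {0..t}")
    case True
    then have "F \<tau> = fdistr (N \<tau>)" using t by (intro F) auto
    then show ?thesis using True by (simp add: mult h_def)
  qed (simp add: h_def)
  have "integrable lborel (\<lambda>\<tau>. \<integral>\<xi>. h \<tau> \<xi> \<partial>lborel)"
    by (rule lborel_pair.integrable_fst[OF h])
  then have "set_integrable lborel {0..t} (\<lambda>\<tau>. fourier_multiplier (symb (t - \<tau>)) (F \<tau>) \<phi>)"
    by (simp add: set_integrable_def inner)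
  \<comment> \<open>\<open>duhamel\<close> uses the gauge integral, which agrees with the Lebesgue
    integral on integrable functions.\<close>
  from set_borel_integral_eq_integral(2)[OF this]
  have HK: "(\<integral>\<tau>. (\<integral>\<xi>. h \<tau> \<xi> \<partial>lborel) \<partial>lborel) = integral {0..t} (\<lambda>\<tau>. fourier_multiplier (symb (t - \<tau>)) (F \<tau>) \<phi>)"
    by (simp add: set_lebesgue_integral_def inner)
  have i1: "integrable lborel (\<lambda>\<xi>. free m g t \<xi> * inv_fourier \<phi> \<xi>)"
  proof (rule Bochner_Integration.integrable_bound)
    show "integrable lborel (\<lambda>\<xi>. D * norm (inv_fourier \<phi> \<xi>))" using inv by simp
    have [measurable]: "g \<in> borel_measurable borel" "m \<in> borel_measurable borel" "inv_fourier \<phi> \<in> borel_measurable borel"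
      using g m inv by (auto intro: borel_measurable_continuous_onI)
    show "(\<lambda>\<xi>. free m g t \<xi> * inv_fourier \<phi> \<xi>) \<in> borel_measurable lborel"
      unfolding free_def by measurable
    have "norm (free m g t \<xi> * inv_fourier \<phi> \<xi>) \<le> norm (D * norm (inv_fourier \<phi> \<xi>))" for \<xi>
      using mult_right_mono[OF g(2)[of \<xi>] norm_ge_zero[of "inv_fourier \<phi> \<xi>"]] order_trans[OF norm_ge_zero g(2)]
      by (simp add: free_def norm_mult abs_mult)
    then show "AE \<xi> in lborel. norm (free m g t \<xi> * inv_fourier \<phi> \<xi>) \<le> norm (D * norm (inv_fourier \<phi> \<xi>))" by simp
  qed
  have i2: "integrable lborel (\<lambda>\<xi>. duhamel_int m N t \<xi> * inv_fourier \<phi> \<xi>)"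
    unfolding duhamel_int_int[symmetric] by (rule lborel_pair.integrable_snd[OF h])
  show "u t \<phi> = fourier_multiplier (symb t) (fdistr g) \<phi> + integral {0..t} (\<lambda>\<tau>. fourier_multiplier (symb (t - \<tau>)) (F \<tau>) \<phi>)"
    unfolding u[OF t] mult HK[symmetric] swap[symmetric]
    using \<phi> i1 i2 by (simp add: fdistr_def distrib_right) (simp add: free_def)
qed

end

text \<open>Hermitian symmetry of \<open>p0\<close> and \<open>r0\<close> makes the data for the
  waves, and then the waves themselves, real.\<close>

locale smooth_zr = fourier_zr +
  assumes p0_real: "\<And>\<xi>. p0 (- \<xi>) = cnj (p0 \<xi>)" and r0_real: "\<And>\<xi>. r0 (- \<xi>) = cnj (r0 \<xi>)"
begin

text \<open>\<open>|B|^2\<close> is real whatever \<open>b\<close> is; on the Fourier side this is a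
  translation by \<open>\<xi>\<close> inside the convolution.\<close>

lemma sq_self_adj: "sq b t (- \<xi>) = cnj (sq b t \<xi>)"
proof -
  have "(\<integral>\<eta>. cnj (b t \<eta>) * b t (- (\<xi> - \<eta>)) \<partial>lborel) = (\<integral>\<eta>. cnj (b t (\<xi> + \<eta>)) * b t \<eta> \<partial>lborel)"
    using lborel_integral_real_affine[of 1 "\<lambda>\<eta>. cnj (b t \<eta>) * b t (- (\<xi> - \<eta>))" \<xi>] by simp
  then show ?thesis
    by (simp add: sq_def convol_def adj_def mult.commute add.commute[of _ \<xi>] flip: Bochner_Integration.integral_cnj)
qed

lemma wave_self_adj:
  assumes "\<And>\<xi>. g (- \<xi>) = cnj (g \<xi>)"
  shows "wave v c g s b t (- \<xi>) = cnj (wave v c g s b t \<xi>)"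
proof -
  have "duhamel_int (\<lambda>\<xi>. v * \<xi>) (\<lambda>t \<xi>. \<i> * of_real \<xi> * sq b t \<xi>) t (- \<xi>) =
      cnj (duhamel_int (\<lambda>\<xi>. v * \<xi>) (\<lambda>t \<xi>. \<i> * of_real \<xi> * sq b t \<xi>) t \<xi>)"
    by (simp add: duhamel_int_def sq_self_adj cis_cnj flip: Bochner_Integration.integral_cnj)
  then show ?thesis by (simp add: wave_def free_def assms cis_cnj)
qed

definition sol :: "real \<Rightarrow> (real \<Rightarrow> real \<Rightarrow> complex) \<Rightarrow> real \<Rightarrow> distr \<times> distr \<times> distr" where
  "sol s b t = (if t \<in> {0..T} then fdistr (b t) else 0,
     if t \<in> {0..T} then fdistr (wave v1 c1 p0 s b t) else 0,
     if t \<in> {0..T} then fdistr (wave v2 c2 r0 s b t) else 0)"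

definition data :: "distr \<times> distr \<times> distr" where
  "data = (fdistr b0, fdistr p0, fdistr r0)"

lemma ex_weighted_wave:
  assumes g: "continuous_on UNIV g" "\<And>\<xi>. cmod (g \<xi>) \<le> H * W 0 \<xi>" and b: "weighted R b"
  shows "\<exists>C. weighted C (wave v c g s b)"
  unfolding wave_def[abs_def]
  by (rule exI, rule weighted_add[OF weighted_cmult[OF weighted_free[OF continuous_symbols(2) g]]
        weighted_cmult[OF weighted_duhamel_int_deriv[OF continuous_symbols(2) weighted_sq[OF b]]]])

lemma weight_at_0_le: "H * W 0 \<xi> \<le> H"
  using mult_left_mono[OF W_le_1[of 0 \<xi>] H_nonneg] T_nonneg by simp

text \<open>The inverse transforms of \<open>b\<close> and of its two waves are the functions that
  \<open>smooth_zr_solution\<close> asks for. Convolutions become products, so the fixed point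
  equation is the first Duhamel formula, and the definition of \<open>wave\<close> gives the other
  two.\<close>

lemma smooth_zr_solution_sol:
  assumes b: "weighted R b" and fix_b: "\<And>t \<xi>. t \<in> {0..T} \<Longrightarrow> picard s b t \<xi> = b t \<xi>"
    and "a1 = \<gamma> * (sqrt \<beta> - \<nu> / 2)" "a2 = - (\<gamma> * (sqrt \<beta> + \<nu> / 2))" "p = \<gamma> * q"
    and "v1 = (sqrt \<beta> - \<nu>) / \<theta>" "v2 = - (\<nu> + sqrt \<beta>) / \<theta>"
    and "c1 = \<gamma> / 2 * (- 1 + \<nu> / (2 * sqrt \<beta>)) / \<theta>" "c2 = \<gamma> / 2 * (- 1 - \<nu> / (2 * sqrt \<beta>)) / \<theta>"
  shows "smooth_zr_solution \<theta> \<gamma> \<omega> \<nu> \<beta> q T (s *\<^sub>R data) (sol s b)"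
proof -
  let ?w1 = "wave v1 c1 p0 s b" and ?w2 = "wave v2 c2 r0 s b"
  obtain C1 where w1: "weighted C1 ?w1" using ex_weighted_wave[OF p0 b] by blast
  obtain C2 where w2: "weighted C2 ?w2" using ex_weighted_wave[OF r0 b] by blast
  have sq: "weighted (K * R * R) (sq b)" by (rule weighted_sq[OF b])
  have potential: "weighted (cmod (of_real a1) * C1 + cmod (of_real a2) * C2 + cmod (of_real p) * (K * R * R)) (potential s b)"
    unfolding potential_def[abs_def] by (intro weighted_add weighted_cmult w1 w2 sq)
  define B where "B = (\<lambda>t. inv_fourier (b t))"
  define \<psi>1 where "\<psi>1 = (\<lambda>t x. Re (inv_fourier (?w1 t) x))"
  define \<psi>2 where "\<psi>2 = (\<lambda>t x. Re (inv_fourier (?w2 t) x))"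
  \<comment> \<open>Taking the real part loses nothing, by the Hermitian symmetry of the
    wave.\<close>
  have \<psi>1: "of_real (\<psi>1 t x) = inv_fourier (?w1 t) x" for t x
    unfolding \<psi>1_def by (rule inv_fourier_self_adj) (rule wave_self_adj[of p0, OF p0_real])
  have \<psi>2: "of_real (\<psi>2 t x) = inv_fourier (?w2 t) x" for t x
    unfolding \<psi>2_def by (rule inv_fourier_self_adj) (rule wave_self_adj[of r0, OF r0_real])
  have bc: "bounded_continuous (inv_fourier (f t))" if "weighted C f" "t \<in> {0..T}" for C f t
    unfolding bounded_continuous_def bounded_iff
    using continuous_on_inv_fourier[OF weighted_integrable[OF that]] norm_inv_fourier_le by blast
  have bcR: "bounded_continuous (\<lambda>x. Re (f x))" if bf: "bounded_continuous f" for f :: "real \<Rightarrow> complex"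
  proof -
    obtain a where "\<And>x. cmod (f x) \<le> a"
      using bf unfolding bounded_continuous_def bounded_iff by auto
    then have "\<bar>Re (f x)\<bar> \<le> a" for x using abs_Re_le_cmod[of "f x"] order_trans by blast
    then show ?thesis
      using bf unfolding bounded_continuous_def bounded_iff by (auto intro!: continuous_intros)
  qed
  have sqB: "of_real ((cmod (B t x))\<^sup>2) = inv_fourier (sq b t) x" if "t \<in> {0..T}" for t x
    unfolding sq_def inv_fourier_convol[OF b weighted_adj[OF b] that] inv_fourier_adj
    unfolding B_def by (rule complex_norm_square)
  note sh = weighted_integrable
  have reg: "regular_distr (inv_fourier (f t)) = fdistr (f t)" if "weighted C f" "t \<in> {0..T}" for C f t
    by (rule regular_distr_inv_fourier[OF weighted_integrable[OF that]])
  have data_s: "s *\<^sub>R data = (fdistr (\<lambda>\<xi>. s *\<^sub>R b0 \<xi>), fdistr (\<lambda>\<xi>. s *\<^sub>R p0 \<xi>), fdistr (\<lambda>\<xi>. s *\<^sub>R r0 \<xi>))"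
    by (simp add: data_def fdistr_scaleR)
  have bd: "cmod (s *\<^sub>R g \<xi>) \<le> \<bar>s\<bar> * H" if "\<And>\<xi>. cmod (g \<xi>) \<le> H * W 0 \<xi>" for g \<xi>
    using order_trans[OF that weight_at_0_le] by (simp add: mult_left_mono)
  have eqB: "(\<lambda>x. - \<i> * (of_real (\<gamma> * (sqrt \<beta> - \<nu> / 2) * \<psi>1 t x) * B t x
        - of_real (\<gamma> * (sqrt \<beta> + \<nu> / 2) * \<psi>2 t x) * B t x + of_real (\<gamma> * q * (cmod (B t x))\<^sup>2) * B t x))
      = inv_fourier (\<lambda>\<xi>. - \<i> * convol (potential s b) b t \<xi>)" if t: "t \<in> {0..T}" for t
  proof
    fix x
    have i: "integrable lborel (\<lambda>\<xi>. of_real a1 * ?w1 t \<xi>)" "integrable lborel (\<lambda>\<xi>. of_real a2 * ?w2 t \<xi>)"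
      "integrable lborel (\<lambda>\<xi>. of_real p * sq b t \<xi>)"
      using sh[OF w1 t] sh[OF w2 t] sh[OF sq t] by auto
    have a2: "\<gamma> * (sqrt \<beta> + \<nu> / 2) = - a2" using assms(4) by simp
    have ip: "inv_fourier (potential s b t) x = of_real a1 * inv_fourier (?w1 t) x + of_real a2 * inv_fourier (?w2 t) x
        + of_real p * inv_fourier (sq b t) x"
      unfolding potential_def[abs_def] inv_fourier_add[OF Bochner_Integration.integrable_add[OF i(1,2)] i(3)]
        inv_fourier_add[OF i(1,2)] inv_fourier_cmult ..
    have rhs: "inv_fourier (\<lambda>\<xi>. - \<i> * convol (potential s b) b t \<xi>) x = - \<i> * (inv_fourier (potential s b t) x * B t x)"
      unfolding inv_fourier_cmult inv_fourier_convol[OF potential b t] B_def ..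
    show "- \<i> * (of_real (\<gamma> * (sqrt \<beta> - \<nu> / 2) * \<psi>1 t x) * B t x
        - of_real (\<gamma> * (sqrt \<beta> + \<nu> / 2) * \<psi>2 t x) * B t x + of_real (\<gamma> * q * (cmod (B t x))\<^sup>2) * B t x)
      = inv_fourier (\<lambda>\<xi>. - \<i> * convol (potential s b) b t \<xi>) x"
      unfolding rhs assms(3,5)[symmetric] a2 ip
        of_real_mult of_real_minus \<psi>1 \<psi>2 sqB[OF t]
      by (simp add: algebra_simps)
  qed
  have nonlin: "weighted (cmod (- \<i>) * (K * (cmod (of_real a1) * C1 + cmod (of_real a2) * C2 + cmod (of_real p) * (K * R * R)) * R))
      (\<lambda>t \<xi>. - \<i> * convol (potential s b) b t \<xi>)"
    by (intro weighted_cmult weighted_convol potential b)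
  have D1: "duhamel (schroedinger_symbol \<omega>)
          (\<lambda>t. regular_distr (\<lambda>x. - \<i> *
             (of_real (\<gamma> * (sqrt \<beta> - \<nu> / 2) * \<psi>1 t x) * B t x
              - of_real (\<gamma> * (sqrt \<beta> + \<nu> / 2) * \<psi>2 t x) * B t x
              + of_real (\<gamma> * q * (cmod (B t x))\<^sup>2) * B t x)))
          T (fst (s *\<^sub>R data)) (\<lambda>t. fst (sol s b t))"
    unfolding data_s fst_conv
  proof (rule duhamel_fdistr[where m = "\<lambda>\<xi>. \<omega> * \<xi>\<^sup>2" and a = \<omega> and c = 0 and N = "\<lambda>t \<xi>. - \<i> * convol (potential s b) b t \<xi>"])
    show "schroedinger_symbol \<omega> t = (\<lambda>\<xi>. cis (- (t * (\<omega> * \<xi>\<^sup>2))))" for t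
      by (simp add: schroedinger_symbol_def fun_eq_iff mult.assoc)
    show "continuous_on UNIV (\<lambda>\<xi>. s *\<^sub>R b0 \<xi>)" by (intro continuous_intros b0)
    show "cmod (s *\<^sub>R b0 \<xi>) \<le> \<bar>s\<bar> * H" for \<xi> by (rule bd[OF b0(2)])
    show "joint_cont (\<lambda>t \<xi>. - \<i> * convol (potential s b) b t \<xi>)" using nonlin by (simp add: weighted_def)
    show "t \<in> {0..T} \<Longrightarrow> cmod (- \<i> * convol (potential s b) b t \<xi>) \<le> cmod (- \<i>) * (K * (cmod (of_real a1) * C1 + cmod (of_real a2) * C2 + cmod (of_real p) * (K * R * R)) * R)" for t \<xi>
      using weight_bdd_le nonlin unfolding weighted_def by blast
    fix t assume t: "t \<in> {0..T}"
    show "regular_distr (\<lambda>x. - \<i> * (of_real (\<gamma> * (sqrt \<beta> - \<nu> / 2) * \<psi>1 t x) * B t x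
        - of_real (\<gamma> * (sqrt \<beta> + \<nu> / 2) * \<psi>2 t x) * B t x + of_real (\<gamma> * q * (cmod (B t x))\<^sup>2) * B t x))
      = fdistr (\<lambda>\<xi>. - \<i> * convol (potential s b) b t \<xi>)"
      unfolding eqB[OF t] by (rule reg[OF nonlin t])
    have "b t = (\<lambda>\<xi>. free (\<lambda>\<xi>. \<omega> * \<xi>\<^sup>2) (\<lambda>\<xi>. s *\<^sub>R b0 \<xi>) t \<xi> + duhamel_int (\<lambda>\<xi>. \<omega> * \<xi>\<^sup>2) (\<lambda>t \<xi>. - \<i> * convol (potential s b) b t \<xi>) t \<xi>)"
    proof
      fix \<xi>
      have "duhamel_int (\<lambda>\<xi>. \<omega> * \<xi>\<^sup>2) (\<lambda>t \<xi>. - \<i> * convol (potential s b) b t \<xi>) t \<xi> = - \<i> * duhamel_int (\<lambda>\<xi>. \<omega> * \<xi>\<^sup>2) (convol (potential s b) b) t \<xi>"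
        unfolding duhamel_int_def integral_mult_right_zero[symmetric]
        by (rule Bochner_Integration.integral_cong) (simp_all add: scaleR_conv_of_real)
      then show "b t \<xi> = free (\<lambda>\<xi>. \<omega> * \<xi>\<^sup>2) (\<lambda>\<xi>. s *\<^sub>R b0 \<xi>) t \<xi> + duhamel_int (\<lambda>\<xi>. \<omega> * \<xi>\<^sup>2) (\<lambda>t \<xi>. - \<i> * convol (potential s b) b t \<xi>) t \<xi>"
        unfolding fix_b[OF t, symmetric] by (simp add: picard_def free_def scaleR_conv_of_real)
    qed
    then show "fst (sol s b t) = fdistr (\<lambda>\<xi>. free (\<lambda>\<xi>. \<omega> * \<xi>\<^sup>2) (\<lambda>\<xi>. s *\<^sub>R b0 \<xi>) t \<xi> + duhamel_int (\<lambda>\<xi>. \<omega> * \<xi>\<^sup>2) (\<lambda>t \<xi>. - \<i> * convol (potential s b) b t \<xi>) t \<xi>)"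
      using t by (simp add: sol_def)
  qed simp
  \<comment> \<open>Both transport equations at once, with speed \<open>v\<close>, coefficient
    \<open>c\<close> and datum \<open>g\<close> left open.\<close>
  have D2: "duhamel (transport_symbol v) (\<lambda>t. c *\<^sub>R distr_deriv (regular_distr (\<lambda>x. of_real ((cmod (B t x))\<^sup>2))))
      T (fdistr (\<lambda>\<xi>. s *\<^sub>R g \<xi>)) u"
    if g: "continuous_on UNIV g" "\<And>\<xi>. cmod (g \<xi>) \<le> H * W 0 \<xi>"
      and u: "\<And>t. t \<in> {0..T} \<Longrightarrow> u t = fdistr (wave v c g s b t)" for v c g u
  proof (rule duhamel_fdistr[where m = "\<lambda>\<xi>. v * \<xi>" and a = 0 and c = v and N = "\<lambda>t \<xi>. of_real c * (\<i> * of_real \<xi> * sq b t \<xi>)"])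
    show "transport_symbol v t = (\<lambda>\<xi>. cis (- (t * (v * \<xi>))))" for t
      by (simp add: transport_symbol_def fun_eq_iff mult.assoc)
    show "continuous_on UNIV (\<lambda>\<xi>. s *\<^sub>R g \<xi>)" by (intro continuous_intros g)
    show "cmod (s *\<^sub>R g \<xi>) \<le> \<bar>s\<bar> * H" for \<xi> by (rule bd[OF g(2)])
    show "joint_cont (\<lambda>t \<xi>. of_real c * (\<i> * of_real \<xi> * sq b t \<xi>))"
      using sq by (intro joint_cont_cmult joint_cont_mult_xi) (simp add: weighted_def)
    show "cmod (of_real c * (\<i> * of_real \<xi> * sq b t \<xi>)) \<le> \<bar>c\<bar> * (K * R * R * 1)" if t: "t \<in> {0..T}" for t \<xi>
    proof -
      have "cmod (sq b t \<xi>) \<le> K * R * R * W t \<xi>" using wbD sq t unfolding weighted_def by blast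
      then have "\<bar>\<xi>\<bar> * cmod (sq b t \<xi>) \<le> \<bar>\<xi>\<bar> * (K * R * R * W t \<xi>)" by (rule mult_left_mono) simp
      also have "\<dots> = K * R * R * (\<bar>\<xi>\<bar> * W t \<xi>)" by simp
      also have "\<dots> \<le> K * R * R * 1"
        using t sq weight_bdd_nonneg unfolding weighted_def by (intro mult_left_mono abs_W_le_1) auto
      finally have "\<bar>c\<bar> * (\<bar>\<xi>\<bar> * cmod (sq b t \<xi>)) \<le> \<bar>c\<bar> * (K * R * R * 1)" by (rule mult_left_mono) simp
      then show ?thesis by (simp add: norm_mult)
    qed
    fix t assume t: "t \<in> {0..T}"
    have "(\<lambda>x. of_real ((cmod (B t x))\<^sup>2)) = inv_fourier (sq b t)" using sqB[OF t] by auto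
    then show "c *\<^sub>R distr_deriv (regular_distr (\<lambda>x. of_real ((cmod (B t x))\<^sup>2))) = fdistr (\<lambda>\<xi>. of_real c * (\<i> * of_real \<xi> * sq b t \<xi>))"
      by (simp add: reg[OF sq t] distr_deriv_fdistr fdistr_scaleR scaleR_conv_of_real del: of_real_power)
    have "wave v c g s b t = (\<lambda>\<xi>. free (\<lambda>\<xi>. v * \<xi>) (\<lambda>\<xi>. s *\<^sub>R g \<xi>) t \<xi> + duhamel_int (\<lambda>\<xi>. v * \<xi>) (\<lambda>t \<xi>. of_real c * (\<i> * of_real \<xi> * sq b t \<xi>)) t \<xi>)"
    proof
      fix \<xi>
      have "duhamel_int (\<lambda>\<xi>. v * \<xi>) (\<lambda>t \<xi>. of_real c * (\<i> * of_real \<xi> * sq b t \<xi>)) t \<xi> = of_real c * duhamel_int (\<lambda>\<xi>. v * \<xi>) (\<lambda>t \<xi>. \<i> * of_real \<xi> * sq b t \<xi>) t \<xi>"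
        unfolding duhamel_int_def integral_mult_right_zero[symmetric]
        by (rule Bochner_Integration.integral_cong) (simp_all add: scaleR_conv_of_real)
      then show "wave v c g s b t \<xi> = free (\<lambda>\<xi>. v * \<xi>) (\<lambda>\<xi>. s *\<^sub>R g \<xi>) t \<xi> + duhamel_int (\<lambda>\<xi>. v * \<xi>) (\<lambda>t \<xi>. of_real c * (\<i> * of_real \<xi> * sq b t \<xi>)) t \<xi>"
        by (simp add: wave_def free_def scaleR_conv_of_real)
    qed
    then show "u t = fdistr (\<lambda>\<xi>. free (\<lambda>\<xi>. v * \<xi>) (\<lambda>\<xi>. s *\<^sub>R g \<xi>) t \<xi> + duhamel_int (\<lambda>\<xi>. v * \<xi>) (\<lambda>t \<xi>. of_real c * (\<i> * of_real \<xi> * sq b t \<xi>)) t \<xi>)"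
      using u[OF t] by simp
  qed simp
  have mem: "sol s b \<in> vecs (curve_space T (zr_space \<sigma> \<sigma> \<sigma>))" for \<sigma>
    unfolding zr_space_def sol_def[abs_def]
    by (intro curve_space_prodI curve_space_real_sobolevI fdistr_curve_mem[OF b] fdistr_curve_mem[OF w1]
        fdistr_curve_mem[OF w2] snvs_prod_space snvs_sobolev snvs_real_sobolev)
      (simp_all add: real_distr_fdistr wave_self_adj p0_real r0_real)
  have comp: "bounded_continuous (B t) \<and> bounded_continuous (\<psi>1 t) \<and> bounded_continuous (\<psi>2 t) \<and>
           sol s b t = (regular_distr (B t), regular_distr (\<lambda>x. of_real (\<psi>1 t x)),
                  regular_distr (\<lambda>x. of_real (\<psi>2 t x)))" if t: "t \<in> {0..T}" for t
  proof (intro conjI)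
    show "bounded_continuous (B t)" unfolding B_def by (rule bc[OF b t])
    show "bounded_continuous (\<psi>1 t)" unfolding \<psi>1_def by (rule bcR[OF bc[OF w1 t]])
    show "bounded_continuous (\<psi>2 t)" unfolding \<psi>2_def by (rule bcR[OF bc[OF w2 t]])
    show "sol s b t = (regular_distr (B t), regular_distr (\<lambda>x. of_real (\<psi>1 t x)), regular_distr (\<lambda>x. of_real (\<psi>2 t x)))"
      using t by (simp add: sol_def \<psi>1 \<psi>2 B_def reg[OF b t] reg[OF w1 t] reg[OF w2 t])
  qed
  show ?thesis
    unfolding smooth_zr_solution_def
  proof (rule conjI[OF allI[OF mem]], rule exI[of _ B], rule exI[of _ \<psi>1], rule exI[of _ \<psi>2],
      rule conjI[rotated], rule conjI[OF D1], rule conjI)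
    show "duhamel (transport_symbol ((sqrt \<beta> - \<nu>) / \<theta>))
          (\<lambda>t. (\<gamma> / 2 * (- 1 + \<nu> / (2 * sqrt \<beta>)) / \<theta>) *\<^sub>R
             distr_deriv (regular_distr (\<lambda>x. of_real ((cmod (B t x))\<^sup>2))))
          T (fst (snd (s *\<^sub>R data))) (\<lambda>t. fst (snd (sol s b t)))"
      unfolding assms(6,8)[symmetric] data_s fst_conv snd_conv
      by (rule D2[OF p0]) (simp add: sol_def)
    show "duhamel (transport_symbol (- (\<nu> + sqrt \<beta>) / \<theta>))
          (\<lambda>t. (\<gamma> / 2 * (- 1 - \<nu> / (2 * sqrt \<beta>)) / \<theta>) *\<^sub>R
             distr_deriv (regular_distr (\<lambda>x. of_real ((cmod (B t x))\<^sup>2))))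
          T (snd (snd (s *\<^sub>R data))) (\<lambda>t. snd (snd (sol s b t)))"
      unfolding assms(7,9)[symmetric] data_s snd_conv
      by (rule D2[OF r0]) (simp add: sol_def)
  qed (rule ballI, rule comp)
qed

end

subsection \<open>The second derivative of the data-to-solution map\<close>

context horizon
begin

text \<open>The form that \<open>quad\<close> takes when one of the two waves has zero data; both
  couplings reduce to it.\<close>

definition bilin :: "real \<Rightarrow> real \<Rightarrow> real \<Rightarrow> (real \<Rightarrow> complex) \<Rightarrow> (real \<Rightarrow> complex) \<Rightarrow> real \<Rightarrow> real \<Rightarrow> complex" where
  "bilin \<omega> v a b g t \<xi> = - \<i> * duhamel_int (\<lambda>\<xi>. \<omega> * \<xi>\<^sup>2)
     (convol (\<lambda>t \<xi>. of_real a * free (\<lambda>\<xi>. v * \<xi>) g t \<xi>) (free (\<lambda>\<xi>. \<omega> * \<xi>\<^sup>2) b)) t \<xi>"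

lemma initial_density:
  assumes g: "continuous_on UNIV g" "\<And>\<xi>. cmod (g \<xi>) \<le> H * W 0 \<xi>"
  shows "integrable lborel g" "integrable lborel (wL2 \<sigma> g)"
proof -
  \<comment> \<open>With symbol 0 the free evolution is constant in time, so \<open>g\<close> is its
    value at time 0 and the lemmas on weighted curves apply to it.\<close>
  have "weighted H (free (\<lambda>_. 0) g)" by (intro weighted_free g continuous_intros)
  moreover have "free (\<lambda>_. 0) g 0 = g" by (simp add: free_def fun_eq_iff)
  ultimately show "integrable lborel g" "integrable lborel (wL2 \<sigma> g)"
    using weighted_integrable[of H _ 0] weighted_wL2[of H _ 0 \<sigma>] zero_mem_Icc by metis+
qed

lemma integrable_mult_weighted:
  assumes f: "weighted C f" and t: "t \<in> {0..T}" and \<phi>: "integrable lborel \<phi>"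
  shows "integrable lborel (\<lambda>\<xi>. f t \<xi> * \<phi> \<xi>)"
proof (rule Bochner_Integration.integrable_bound)
  show "integrable lborel (\<lambda>\<xi>. C * norm (\<phi> \<xi>))" using \<phi> by simp
  show "(\<lambda>\<xi>. f t \<xi> * \<phi> \<xi>) \<in> borel_measurable lborel"
    using weighted_integrable[OF f t] \<phi> by (intro borel_measurable_times) auto
  have f': "weight_bdd C f" using f by (simp add: weighted_def)
  have "norm (f t \<xi> * \<phi> \<xi>) \<le> norm (C * norm (\<phi> \<xi>))" for \<xi>
    using mult_right_mono[OF weight_bdd_le[OF f' t, of \<xi>] norm_ge_zero[of "\<phi> \<xi>"]] weight_bdd_nonneg[OF f']
    by (simp add: norm_mult abs_mult)
  then show "AE \<xi> in lborel. norm (f t \<xi> * \<phi> \<xi>) \<le> norm (C * norm (\<phi> \<xi>))" by simp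
qed

end

context smooth_zr
begin

lemma data_mem: "data \<in> vecs (zr_space k l s)"
  unfolding data_def zr_space_def prod_space_def real_sobolev_def
  using initial_density[OF b0] initial_density[OF p0] initial_density[OF r0]
  by (simp add: fdistr_mem_sobolev real_distr_fdistr p0_real r0_real)

lemma nrm_data: "(nrm (zr_space k l s) data)\<^sup>2 =
  (\<integral>\<xi>. wL2 k b0 \<xi> \<partial>lborel) + (\<integral>\<xi>. wL2 l p0 \<xi> \<partial>lborel) + (\<integral>\<xi>. wL2 s r0 \<xi> \<partial>lborel)"
  unfolding data_def zr_space_def prod_space_def real_sobolev_def
  using initial_density(1)[OF b0] initial_density(1)[OF p0] initial_density(1)[OF r0]
  by (simp add: nrm_fdistr wL2_nonneg)

lemma weighted_quad: "\<exists>C. weighted C quad"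
  unfolding quad_def[abs_def]
  by (rule exI, rule weighted_cmult[OF weighted_duhamel_int[OF continuous_symbols(1) weighted_convol[OF weighted_potential_lin weighted_free_B]]])

text \<open>For small \<open>s\<close> the scaled datum lies in the ball where \<Phi> is pinned
  down, so \<Phi> must return the solution constructed for it. The expansion of that solution is
  then integrated against \<open>\<phi>\<close>, the remainder costing the \<open>L^1\<close> norm
  of \<open>\<phi>\<close>.\<close>

lemma solution_map_expansion:
  assumes \<Phi>: "data_to_solution_map \<theta> \<gamma> \<omega> \<nu> \<beta> q k l \<sigma> T \<Phi>"
    and params: "a1 = \<gamma> * (sqrt \<beta> - \<nu> / 2)" "a2 = - (\<gamma> * (sqrt \<beta> + \<nu> / 2))" "p = \<gamma> * q"
      "v1 = (sqrt \<beta> - \<nu>) / \<theta>" "v2 = - (\<nu> + sqrt \<beta>) / \<theta>"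
      "c1 = \<gamma> / 2 * (- 1 + \<nu> / (2 * sqrt \<beta>)) / \<theta>" "c2 = \<gamma> / 2 * (- 1 - \<nu> / (2 * sqrt \<beta>)) / \<theta>"
    and t: "t \<in> {0..T}" and \<phi>: "integrable lborel \<phi>"
  obtains K' s0 where "s0 > 0" "\<And>s. \<bar>s\<bar> < s0 \<Longrightarrow>
    cmod (dens_pairing \<phi> (fst (\<Phi> (s *\<^sub>R data) t)) - s *\<^sub>R (\<integral>\<xi>. free_B t \<xi> * \<phi> \<xi> \<partial>lborel)
      - s\<^sup>2 *\<^sub>R (\<integral>\<xi>. quad t \<xi> * \<phi> \<xi> \<partial>lborel)) \<le> K' * \<bar>s\<bar> ^ 3"
proof -
  interpret Z: snvs "zr_space k l \<sigma>" by (rule snvs_zr_space)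
  obtain r where r0: "r > 0" and r1: "\<forall>u0\<in>vecs (zr_space k l \<sigma>). nrm (zr_space k l \<sigma>) u0 < r \<longrightarrow>
      \<Phi> u0 \<in> vecs (curve_space T (zr_space k l \<sigma>)) \<and>
      (\<forall>u. smooth_zr_solution \<theta> \<gamma> \<omega> \<nu> \<beta> q T u0 u \<longrightarrow> \<Phi> u0 = u)"
    using \<Phi> unfolding data_to_solution_map_def by (elim exE conjE) (rule that; assumption)
  have r: "\<Phi> u0 = u" if "u0 \<in> vecs (zr_space k l \<sigma>)" "nrm (zr_space k l \<sigma>) u0 < r"
      "smooth_zr_solution \<theta> \<gamma> \<omega> \<nu> \<beta> q T u0 u" for u0 u
    using r1[rule_format, OF that(1,2)] that(3) by (elim conjE allE[of _ u]) simp
  obtain C s0 where s0: "s0 > 0" "\<And>s. \<bar>s\<bar> < s0 \<Longrightarrow> \<exists>R b. weighted R b \<and> (\<forall>t\<in>{0..T}. \<forall>\<xi>. picard s b t \<xi> = b t \<xi>)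
    \<and> weight_dist (C * \<bar>s\<bar> ^ 3) b (\<lambda>t \<xi>. of_real s * free_B t \<xi> + of_real (s\<^sup>2) * quad t \<xi>)"
    by (rule small_solutions) (rule that; assumption)
  define N where "N = nrm (zr_space k l \<sigma>) data"
  have N: "N \<ge> 0" unfolding N_def by (rule Z.nrm_nonneg[OF data_mem])
  define K' where "K' = C * (\<integral>\<xi>. norm (\<phi> \<xi>) \<partial>lborel)"
  show thesis
  proof (rule that[of "min s0 (r / (N + 1))" K'])
    show "0 < min s0 (r / (N + 1))" using s0 r0 N by simp
    fix s :: real assume s: "\<bar>s\<bar> < min s0 (r / (N + 1))"
    then obtain R b where b: "weighted R b" "\<And>t \<xi>. t \<in> {0..T} \<Longrightarrow> picard s b t \<xi> = b t \<xi>"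
      and d: "weight_dist (C * \<bar>s\<bar> ^ 3) b (\<lambda>t \<xi>. of_real s * free_B t \<xi> + of_real (s\<^sup>2) * quad t \<xi>)"
      using s0(2)[of s] by auto
    have "nrm (zr_space k l \<sigma>) (s *\<^sub>R data) = \<bar>s\<bar> * N" by (simp add: Z.nrm_scale[OF data_mem] N_def)
    also have "\<dots> \<le> \<bar>s\<bar> * (N + 1)" by (simp add: mult_left_mono)
    also have "\<dots> < r" using s N by (simp add: pos_less_divide_eq)
    finally have "\<Phi> (s *\<^sub>R data) = sol s b"
      by (intro r Z.scale_mem data_mem smooth_zr_solution_sol[OF b params])
    then have "fst (\<Phi> (s *\<^sub>R data) t) = fdistr (b t)" using t by (simp add: sol_def)
    then have pair: "dens_pairing \<phi> (fst (\<Phi> (s *\<^sub>R data) t)) = (\<integral>\<xi>. b t \<xi> * \<phi> \<xi> \<partial>lborel)"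
      using dens_pairing_eq[OF fourier_density_fdistr[OF weighted_integrable[OF b(1) t]], of \<phi>] \<phi> by simp
    obtain Q where Q: "weighted Q quad" using weighted_quad by blast
    note i = integrable_mult_weighted[OF b(1) t \<phi>] integrable_mult_weighted[OF weighted_free_B t \<phi>] integrable_mult_weighted[OF Q t \<phi>]
    have eq: "dens_pairing \<phi> (fst (\<Phi> (s *\<^sub>R data) t)) - s *\<^sub>R (\<integral>\<xi>. free_B t \<xi> * \<phi> \<xi> \<partial>lborel)
        - s\<^sup>2 *\<^sub>R (\<integral>\<xi>. quad t \<xi> * \<phi> \<xi> \<partial>lborel) = 
        (\<integral>\<xi>. b t \<xi> * \<phi> \<xi> - s *\<^sub>R (free_B t \<xi> * \<phi> \<xi>) - s\<^sup>2 *\<^sub>R (quad t \<xi> * \<phi> \<xi>) \<partial>lborel)"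
      unfolding pair using i by simp
    have "cmod (\<integral>\<xi>. b t \<xi> * \<phi> \<xi> - s *\<^sub>R (free_B t \<xi> * \<phi> \<xi>) - s\<^sup>2 *\<^sub>R (quad t \<xi> * \<phi> \<xi>) \<partial>lborel)
        \<le> (\<integral>\<xi>. (C * \<bar>s\<bar> ^ 3) * norm (\<phi> \<xi>) \<partial>lborel)"
    proof (rule order_trans[OF integral_norm_bound integral_mono])
      show "integrable lborel (\<lambda>\<xi>. cmod (b t \<xi> * \<phi> \<xi> - s *\<^sub>R (free_B t \<xi> * \<phi> \<xi>) - s\<^sup>2 *\<^sub>R (quad t \<xi> * \<phi> \<xi>)))"
        by (intro integrable_norm Bochner_Integration.integrable_diff integrable_scaleR_right i)
      show "integrable lborel (\<lambda>\<xi>. (C * \<bar>s\<bar> ^ 3) * norm (\<phi> \<xi>))" using \<phi> by simp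
      fix \<xi>
      have "b t \<xi> * \<phi> \<xi> - s *\<^sub>R (free_B t \<xi> * \<phi> \<xi>) - s\<^sup>2 *\<^sub>R (quad t \<xi> * \<phi> \<xi>)
          = (b t \<xi> - (of_real s * free_B t \<xi> + of_real (s\<^sup>2) * quad t \<xi>)) * \<phi> \<xi>"
        by (simp add: scaleR_conv_of_real algebra_simps)
      then show "cmod (b t \<xi> * \<phi> \<xi> - s *\<^sub>R (free_B t \<xi> * \<phi> \<xi>) - s\<^sup>2 *\<^sub>R (quad t \<xi> * \<phi> \<xi>)) \<le> (C * \<bar>s\<bar> ^ 3) * norm (\<phi> \<xi>)"
        using mult_right_mono[OF weight_bdd_le[OF d[unfolded weight_dist_def] t, of \<xi>] norm_ge_zero[of "\<phi> \<xi>"]] by (simp only: norm_mult)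
    qed
    also have "\<dots> = K' * \<bar>s\<bar> ^ 3" by (simp add: K'_def)
    finally show "cmod (dens_pairing \<phi> (fst (\<Phi> (s *\<^sub>R data) t)) - s *\<^sub>R (\<integral>\<xi>. free_B t \<xi> * \<phi> \<xi> \<partial>lborel)
      - s\<^sup>2 *\<^sub>R (\<integral>\<xi>. quad t \<xi> * \<phi> \<xi> \<partial>lborel)) \<le> K' * \<bar>s\<bar> ^ 3" unfolding eq .
  qed
qed

end

lemma zr_space_fst_le:
  assumes "u \<in> vecs (zr_space k l s)"
  shows "fst u \<in> vecs (sobolev k)" "nrm (sobolev k) (fst u) \<le> nrm (zr_space k l s) u"
  using assms by (auto simp: zr_space_def prod_space_def intro!: real_le_rsqrt)

text \<open>The functional takes the \<open>B\<close> component at time \<open>t\<close> and pairs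
  it with \<open>\<phi>\<close>; by duality its norm is at most the \<open>H^-k\<close> norm of
  \<open>\<phi>\<close>. The constant is fixed before the data, \<open>t\<close> and
  \<open>\<phi>\<close> are chosen.\<close>

theorem C2_at_imp_quad_bound:
  assumes T: "0 \<le> T" and \<Phi>: "data_to_solution_map \<theta> \<gamma> \<omega> \<nu> \<beta> q k l \<sigma> T \<Phi>"
    and C2: "C2_at (zr_space k l \<sigma>) (curve_space T (zr_space k l \<sigma>)) \<Phi> 0"
    and params: "a1 = \<gamma> * (sqrt \<beta> - \<nu> / 2)" "a2 = - (\<gamma> * (sqrt \<beta> + \<nu> / 2))" "p = \<gamma> * q"
      "v1 = (sqrt \<beta> - \<nu>) / \<theta>" "v2 = - (\<nu> + sqrt \<beta>) / \<theta>"
      "c1 = \<gamma> / 2 * (- 1 + \<nu> / (2 * sqrt \<beta>)) / \<theta>" "c2 = \<gamma> / 2 * (- 1 - \<nu> / (2 * sqrt \<beta>)) / \<theta>"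
  obtains C where "\<And>H b0 p0 r0 t \<phi>. smooth_zr T H b0 p0 r0 \<Longrightarrow> t \<in> {0..T} \<Longrightarrow> integrable lborel \<phi> \<Longrightarrow>
    integrable lborel (wL2 (- k) \<phi>) \<Longrightarrow>
    cmod (\<integral>\<xi>. fourier_zr.quad \<omega> v1 v2 a1 a2 b0 p0 r0 t \<xi> * \<phi> \<xi> \<partial>lborel) \<le> C * sqrt (\<integral>\<xi>. wL2 (- k) \<phi> \<xi> \<partial>lborel) *
      ((\<integral>\<xi>. wL2 k b0 \<xi> \<partial>lborel) + (\<integral>\<xi>. wL2 l p0 \<xi> \<partial>lborel) + (\<integral>\<xi>. wL2 \<sigma> r0 \<xi> \<partial>lborel))"
proof -
  let ?X = "zr_space k l \<sigma>" and ?Y = "curve_space T (zr_space k l \<sigma>)"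
  interpret X: snvs ?X by (rule snvs_zr_space)
  have Y: "snvs ?Y" by (rule X.snvs_curve_space[OF T])
  show thesis
  proof (rule C2_at_second_order[OF X.snvs_axioms Y C2], rule that)
    fix C
    assume C: "\<And>h (f :: _ \<Rightarrow> complex) L a1 a2 K s0.
    \<lbrakk>h \<in> vecs ?X; \<And>u v. u \<in> vecs ?Y \<Longrightarrow> v \<in> vecs ?Y \<Longrightarrow> f (u - v) = f u - f v;
     \<And>c u. u \<in> vecs ?Y \<Longrightarrow> f (c *\<^sub>R u) = c *\<^sub>R f u;
     \<And>u. u \<in> vecs ?Y \<Longrightarrow> norm (f u) \<le> L * nrm ?Y u; L \<ge> 0; s0 > 0;
     \<And>s. \<bar>s\<bar> < s0 \<Longrightarrow> norm (f (\<Phi> (s *\<^sub>R h)) - s *\<^sub>R a1 - s\<^sup>2 *\<^sub>R a2) \<le> K * \<bar>s\<bar> ^ 3\<rbrakk>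
    \<Longrightarrow> norm a2 \<le> C * L * (nrm ?X h)\<^sup>2"
    fix H b0 p0 r0 t \<phi>
    assume zr: "smooth_zr T H b0 p0 r0" and t: "t \<in> {0..T}" and \<phi>: "integrable lborel \<phi>" "integrable lborel (wL2 (- k) \<phi>)"
    interpret smooth_zr T \<omega> v1 v2 a1 a2 p c1 c2 H b0 p0 r0 by (rule zr)
    define f where "f = (\<lambda>u :: real \<Rightarrow> distr \<times> distr \<times> distr. dens_pairing \<phi> (fst (u t)))"
    define L where "L = sqrt (\<integral>\<xi>. wL2 (- k) \<phi> \<xi> \<partial>lborel)"
    have L: "L \<ge> 0" by (simp add: L_def wL2_nonneg)
    have \<phi>m: "\<phi> \<in> borel_measurable borel" using \<phi> by simp
    have mem: "u t \<in> vecs ?X" if "u \<in> vecs ?Y" for u using that t by (simp add: curve_space_def)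
    note mem' = zr_space_fst_le(1)[OF mem]
    obtain K' s0 where s0: "s0 > 0" "\<And>s. \<bar>s\<bar> < s0 \<Longrightarrow>
      cmod (f (\<Phi> (s *\<^sub>R data)) - s *\<^sub>R (\<integral>\<xi>. free_B t \<xi> * \<phi> \<xi> \<partial>lborel)
        - s\<^sup>2 *\<^sub>R (\<integral>\<xi>. quad t \<xi> * \<phi> \<xi> \<partial>lborel)) \<le> K' * \<bar>s\<bar> ^ 3"
      by (rule solution_map_expansion[OF \<Phi> params t \<phi>(1)]) (rule that[unfolded f_def]; assumption)
    have "cmod (\<integral>\<xi>. quad t \<xi> * \<phi> \<xi> \<partial>lborel) \<le> C * L * (nrm ?X data)\<^sup>2"
    proof (rule C[of _ f L, OF data_mem _ _ _ L s0])
      fix u v assume u: "u \<in> vecs ?Y" and v: "v \<in> vecs ?Y"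
      show "f (u - v) = f u - f v"
        using dens_pairing_linear(1)[OF mem'[OF u] mem'[OF v] \<phi>m \<phi>(2)] by (simp add: f_def)
    next
      fix c u assume u: "u \<in> vecs ?Y"
      show "f (c *\<^sub>R u) = c *\<^sub>R f u"
        using dens_pairing_linear(2)[OF mem'[OF u] mem'[OF u] \<phi>m \<phi>(2), of c] by (simp add: f_def)
    next
      fix u assume u: "u \<in> vecs ?Y"
      have "cmod (f u) \<le> L * nrm (sobolev k) (fst (u t))"
        unfolding f_def L_def by (rule dens_pairing_bound(2)[OF mem'[OF u] \<phi>m \<phi>(2)])
      also have "\<dots> \<le> L * nrm ?X (u t)"
        by (intro mult_left_mono L zr_space_fst_le(2) mem u)
      also have "\<dots> \<le> L * nrm ?Y u"
        by (intro mult_left_mono L X.curve_nrm_le u t)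
      finally show "cmod (f u) \<le> L * nrm ?Y u" .
    qed
    then show "cmod (\<integral>\<xi>. quad t \<xi> * \<phi> \<xi> \<partial>lborel) \<le> C * sqrt (\<integral>\<xi>. wL2 (- k) \<phi> \<xi> \<partial>lborel) *
      ((\<integral>\<xi>. wL2 k b0 \<xi> \<partial>lborel) + (\<integral>\<xi>. wL2 l p0 \<xi> \<partial>lborel) + (\<integral>\<xi>. wL2 \<sigma> r0 \<xi> \<partial>lborel))"
      unfolding nrm_data L_def .
  qed
qed

subsection \<open>Resonant wave packets\<close>

text \<open>Packets must have continuous densities for \<open>weighted_free\<close>; compact support
  makes the exponential bound automatic.\<close>

definition tent :: "real \<Rightarrow> real \<Rightarrow> real \<Rightarrow> real" where
  "tent c d x = max 0 (1 - \<bar>x - c\<bar> / d)"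

lemma continuous_on_tent: "continuous_on UNIV (tent c d)"
  unfolding tent_def divide_inverse by (intro continuous_intros)

lemma tent_nonneg: "0 \<le> tent c d x"
  by (simp add: tent_def)

lemma tent_le_1: "d > 0 \<Longrightarrow> tent c d x \<le> 1"
  by (simp add: tent_def)

lemma tent_support: "d > 0 \<Longrightarrow> tent c d x \<noteq> 0 \<Longrightarrow> \<bar>x - c\<bar> < d"
  by (auto simp: tent_def max_def split: if_splits)

lemma tent_ge_half: "d > 0 \<Longrightarrow> \<bar>x - c\<bar> \<le> d / 2 \<Longrightarrow> 1 / 2 \<le> tent c d x"
  by (simp add: tent_def field_simps)

lemma tent_uminus: "tent c d (- x) = tent (- c) d x"
proof -
  have "\<bar>- x - c\<bar> = \<bar>x + c\<bar>" by (simp add: abs_if)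
  then show ?thesis by (simp add: tent_def)
qed

text \<open>On the annulus \<open>1 + x^2\<close> and \<open>M^2\<close> agree up to factors 1/65
  and 65: \<open>x^2\<close> lies between \<open>M^2 / 64\<close> and \<open>64 * M^2\<close>, and
  \<open>M >= 1\<close> absorbs the 1.\<close>

lemma powr_annulus_le:
  fixes M x k :: real
  assumes M1: "1 \<le> M" and x: "M / 8 \<le> \<bar>x\<bar>" "\<bar>x\<bar> \<le> 8 * M"
  shows "(1 + x\<^sup>2) powr k \<le> 65 powr \<bar>k\<bar> * M powr (2 * k)"
proof -
  define y where "y = (1 + x\<^sup>2) / M\<^sup>2"
  have M: "M > 0" using M1 by simp
  have M2: "M\<^sup>2 \<ge> 1" using M1 by (rule one_le_power)
  have "(M / 8)\<^sup>2 \<le> \<bar>x\<bar>\<^sup>2" by (rule power_mono[OF x(1)]) (use M in simp)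
  moreover have "\<bar>x\<bar>\<^sup>2 \<le> (8 * M)\<^sup>2" by (rule power_mono[OF x(2)]) simp
  ultimately have x2: "M\<^sup>2 / 64 \<le> x\<^sup>2" "x\<^sup>2 \<le> 64 * M\<^sup>2" by (simp_all add: power_divide power_mult_distrib)
  have y: "1 / 65 \<le> y" "y \<le> 65" "y > 0"
    using x2 M2 M by (auto simp: y_def field_simps add_pos_nonneg)
  have "y powr k \<le> 65 powr \<bar>k\<bar>"
  proof (cases "k \<ge> 0")
    case True
    then show ?thesis using y powr_mono2[of k y 65] by simp
  next
    case False
    then have "y powr k \<le> (1 / 65) powr k" using y powr_mono2'[of k "1 / 65" y] by simp
    also have "\<dots> = 65 powr \<bar>k\<bar>" using False by (simp add: powr_divide powr_minus_divide)
    finally show ?thesis .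
  qed
  then have "M powr (2 * k) * y powr k \<le> M powr (2 * k) * 65 powr \<bar>k\<bar>"
    by (intro mult_left_mono) auto
  moreover have "(1 + x\<^sup>2) powr k = M powr (2 * k) * y powr k"
  proof -
    have "1 + x\<^sup>2 = M\<^sup>2 * y" using M by (simp add: y_def)
    then have "(1 + x\<^sup>2) powr k = (M\<^sup>2) powr k * y powr k" using M y by (simp add: powr_mult)
    also have "(M\<^sup>2) powr k = M powr (2 * k)" using M by (simp add: powr_powr flip: powr_numeral)
    finally show ?thesis .
  qed
  ultimately show ?thesis by (simp add: mult.commute)
qed

text \<open>Two centres are allowed because a real wave packet lives at both signs of the frequency.
  The two intervals of length \<open>2 * d\<close> account for the \<open>4 * d\<close>.\<close>

lemma wL2_annulus_le:
  assumes M: "1 \<le> M" and d: "0 < d" and meas [measurable]: "f \<in> borel_measurable borel"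
    and bound: "\<And>x. cmod (f x) \<le> \<alpha>"
    and supp: "\<And>x. f x \<noteq> 0 \<Longrightarrow> \<bar>x - c\<bar> \<le> d \<or> \<bar>x - c'\<bar> \<le> d"
    and annulus: "\<And>x. f x \<noteq> 0 \<Longrightarrow> M / 8 \<le> \<bar>x\<bar> \<and> \<bar>x\<bar> \<le> 8 * M"
  shows "integrable lborel (wL2 k f)" "integrable lborel f"
    "(\<integral>x. wL2 k f x \<partial>lborel) \<le> \<alpha>\<^sup>2 * (65 powr \<bar>k\<bar> * M powr (2 * k)) * (4 * d)"
proof -
  let ?A = "\<alpha>\<^sup>2 * (65 powr \<bar>k\<bar> * M powr (2 * k))"
  let ?I = "\<lambda>x. indicator {c - d..c + d} x + indicator {c' - d..c' + d} x :: real"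
  have int: "integrable lborel ?I" and val: "(\<integral>x. ?I x \<partial>lborel) = 4 * d"
    using d by (simp_all add: integrable_indicator_iff emeasure_lborel_Icc_eq)
  have ind: "1 \<le> ?I x" if "f x \<noteq> 0" for x
    using supp[OF that] by (auto simp: indicator_def abs_le_iff)
  have pt: "wL2 k f x \<le> ?A * ?I x" for x
  proof (cases "f x = 0")
    case True
    then show ?thesis by (simp add: wL2_def)
  next
    case False
    have "wL2 k f x \<le> (65 powr \<bar>k\<bar> * M powr (2 * k)) * \<alpha>\<^sup>2"
      unfolding wL2_def using annulus[OF False] M bound
      by (intro mult_mono powr_annulus_le power_mono) auto
    also have "\<dots> \<le> ((65 powr \<bar>k\<bar> * M powr (2 * k)) * \<alpha>\<^sup>2) * ?I x"
      using mult_left_mono[OF ind[OF False], of "(65 powr \<bar>k\<bar> * M powr (2 * k)) * \<alpha>\<^sup>2"] by simp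
    finally show ?thesis by (simp only: mult_ac)
  qed
  show i: "integrable lborel (wL2 k f)"
    by (rule Bochner_Integration.integrable_bound[OF integrable_mult_right[OF int, of ?A]])
      (use order_trans[OF pt abs_ge_self] in \<open>auto simp: wL2_nonneg abs_of_nonneg\<close>)
  show "integrable lborel f"
  proof (rule Bochner_Integration.integrable_bound[OF integrable_mult_right[OF int, of \<alpha>]])
    have "cmod (f x) \<le> \<alpha> * ?I x" for x
    proof (cases "f x = 0")
      case True
      then show ?thesis using order_trans[OF norm_ge_zero bound[of x]] by simp
    next
      case False
      show ?thesis
        using mult_left_mono[OF ind[OF False] order_trans[OF norm_ge_zero bound[of x]]] bound[of x] by simp
    qed
    then show "AE x in lborel. norm (f x) \<le> norm (\<alpha> * ?I x)"
      by (intro AE_I2) (metis abs_ge_self order_trans real_norm_def)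
  qed simp
  have "(\<integral>x. wL2 k f x \<partial>lborel) \<le> (\<integral>x. ?A * ?I x \<partial>lborel)"
    by (intro integral_mono i integrable_mult_right int pt)
  also have "\<dots> = ?A * (4 * d)" by (simp only: integral_mult_right_zero val)
  finally show "(\<integral>x. wL2 k f x \<partial>lborel) \<le> ?A * (4 * d)" .
qed

lemma half_le_cos: "\<bar>x\<bar> \<le> 1 \<Longrightarrow> 1 / 2 \<le> cos x" for x :: real
proof -
  assume x: "\<bar>x\<bar> \<le> 1"
  have "cos (pi / 3) \<le> cos \<bar>x\<bar>"
    using x pi_gt3 by (intro cos_monotone_0_pi_le) auto
  then show ?thesis by (simp add: cos_60)
qed

context horizon
begin

text \<open>Up to a factor of modulus 1, the time integrand is an integral of nonnegative amplitudes
  with phases of size at most 1. Their real parts are at least half the amplitudes, so nothing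
  cancels and the lower bound grows linearly in \<open>t\<close>.\<close>

lemma norm_bilin_ge:
  assumes t: "t \<in> {0..T}"
    and b: "continuous_on UNIV (\<lambda>\<xi>. complex_of_real (b \<xi>))" "\<And>\<xi>. cmod (of_real (b \<xi>)) \<le> H * W 0 \<xi>" "\<And>\<xi>. 0 \<le> b \<xi>"
    and g: "continuous_on UNIV (\<lambda>\<xi>. complex_of_real (g \<xi>))" "\<And>\<xi>. cmod (of_real (g \<xi>)) \<le> H * W 0 \<xi>" "\<And>\<xi>. 0 \<le> g \<xi>"
    and phase: "\<And>\<eta>. g \<eta> \<noteq> 0 \<Longrightarrow> b (\<xi> - \<eta>) \<noteq> 0 \<Longrightarrow> t * \<bar>\<omega> * \<xi>\<^sup>2 - v * \<eta> - \<omega> * (\<xi> - \<eta>)\<^sup>2\<bar> \<le> 1"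
  shows "integrable lborel (\<lambda>\<eta>. g \<eta> * b (\<xi> - \<eta>))"
    and "\<bar>a\<bar> / (4 * pi) * t * (\<integral>\<eta>. g \<eta> * b (\<xi> - \<eta>) \<partial>lborel)
      \<le> cmod (bilin \<omega> v a (\<lambda>\<xi>. of_real (b \<xi>)) (\<lambda>\<xi>. of_real (g \<xi>)) t \<xi>)"
proof -
  define m where "m = (\<lambda>\<xi>::real. \<omega> * \<xi>\<^sup>2)"
  define fb where "fb = free m (\<lambda>\<xi>. of_real (b \<xi>))"
  define fg where "fg = free (\<lambda>\<xi>. v * \<xi>) (\<lambda>\<xi>. of_real (g \<xi>))"
  have weighted: "weighted H fb" "weighted H fg"
    unfolding fb_def fg_def m_def by (intro weighted_free b g continuous_intros)+
  have "integrable lborel (\<lambda>\<eta>. fg 0 \<eta> * fb 0 (\<xi> - \<eta>))"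
    by (rule convol_integrable[OF weighted(2,1) zero_mem_Icc])
  then have gb: "integrable lborel (\<lambda>\<eta>. complex_of_real (g \<eta> * b (\<xi> - \<eta>)))"
    by (simp add: fb_def fg_def free_def)
  then show gb': "integrable lborel (\<lambda>\<eta>. g \<eta> * b (\<xi> - \<eta>))"
    by (simp only: complex_of_real_integrable_eq)
  \<comment> \<open>The phase left over from output frequency \<open>\<xi>\<close>, wave frequency
    \<open>\<eta>\<close> and \<open>B\<close> frequency \<open>\<zeta> = \<xi> - \<eta>\<close>; it
    factors as \<open>\<eta> * (\<omega> * (2 * \<zeta> + \<eta>) - v)\<close>.\<close>
  define \<Psi> where "\<Psi> = (\<lambda>\<eta>. \<omega> * \<xi>\<^sup>2 - v * \<eta> - \<omega> * (\<xi> - \<eta>)\<^sup>2)"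
  define S where "S = (\<integral>\<eta>. g \<eta> * b (\<xi> - \<eta>) \<partial>lborel)"
  define E where "E = (\<lambda>\<tau>. \<integral>\<eta>. cis (\<tau> * \<Psi> \<eta>) * of_real (g \<eta> * b (\<xi> - \<eta>)) \<partial>lborel)"
  have meas [measurable]: "\<Psi> \<in> borel_measurable borel" unfolding \<Psi>_def by measurable
  have ReE: "S / 2 \<le> Re (E \<tau>)" if \<tau>: "\<tau> \<in> {0..t}" for \<tau>
  proof -
    have i: "integrable lborel (\<lambda>\<eta>. cis (\<tau> * \<Psi> \<eta>) * of_real (g \<eta> * b (\<xi> - \<eta>)))"
      by (intro integrable_cis_mult gb) simp
    have "Re (E \<tau>) = (\<integral>\<eta>. Re (cis (\<tau> * \<Psi> \<eta>) * of_real (g \<eta> * b (\<xi> - \<eta>))) \<partial>lborel)"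
      unfolding E_def by (rule integral_Re[OF i, symmetric])
    also have "\<dots> \<ge> (\<integral>\<eta>. 1 / 2 * (g \<eta> * b (\<xi> - \<eta>)) \<partial>lborel)"
    proof (intro integral_mono)
      show "integrable lborel (\<lambda>\<eta>. 1 / 2 * (g \<eta> * b (\<xi> - \<eta>)))" using gb' by (rule integrable_mult_right)
      show "integrable lborel (\<lambda>\<eta>. Re (cis (\<tau> * \<Psi> \<eta>) * of_real (g \<eta> * b (\<xi> - \<eta>))))"
        using i by (rule integrable_Re)
      fix \<eta>
      show "1 / 2 * (g \<eta> * b (\<xi> - \<eta>)) \<le> Re (cis (\<tau> * \<Psi> \<eta>) * of_real (g \<eta> * b (\<xi> - \<eta>)))"
      proof (cases "g \<eta> = 0 \<or> b (\<xi> - \<eta>) = 0")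
        case False
        have "\<bar>\<tau> * \<Psi> \<eta>\<bar> \<le> t * \<bar>\<Psi> \<eta>\<bar>"
          using \<tau> by (simp add: abs_mult mult_right_mono)
        also have "\<dots> \<le> 1" using False phase[of \<eta>] by (simp add: \<Psi>_def)
        finally have "1 / 2 * (g \<eta> * b (\<xi> - \<eta>)) \<le> cos (\<tau> * \<Psi> \<eta>) * (g \<eta> * b (\<xi> - \<eta>))"
          using b(3) g(3) by (intro mult_right_mono half_le_cos) auto
        then show ?thesis by simp
      qed auto
    qed
    finally show ?thesis by (simp add: S_def)
  qed
  have f: "joint_cont (convol fg fb)" using weighted_convol[OF weighted(2,1)] by (simp add: weighted_def)
  \<comment> \<open>Multiplication by \<open>cis (t * m \<xi>)\<close>, of modulus 1, replaces the
    phase in \<open>t - \<tau>\<close> by one in \<open>\<tau>\<close> alone, which combines with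
    the two free evolutions to \<open>E\<close>.\<close>
  have key: "cis (t * m \<xi>) * (indicator {0..t} \<tau> *\<^sub>R (cis (- ((t - \<tau>) * m \<xi>)) * convol fg fb \<tau> \<xi>))
      = indicator {0..t} \<tau> *\<^sub>R (E \<tau> / of_real (2 * pi))" for \<tau>
  proof -
    have "cis (\<tau> * m \<xi>) * (\<integral>\<eta>. fg \<tau> \<eta> * fb \<tau> (\<xi> - \<eta>) \<partial>lborel) = E \<tau>"
    proof -
      have "cis (\<tau> * m \<xi>) * (fg \<tau> \<eta> * fb \<tau> (\<xi> - \<eta>)) = cis (\<tau> * \<Psi> \<eta>) * of_real (g \<eta> * b (\<xi> - \<eta>))" for \<eta>
      proof -
        have "cis (\<tau> * \<Psi> \<eta>) = cis (\<tau> * m \<xi>) * cis (- (\<tau> * (v * \<eta>))) * cis (- (\<tau> * m (\<xi> - \<eta>)))"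
          by (simp add: cis_mult \<Psi>_def m_def algebra_simps)
        then show ?thesis by (simp add: fg_def fb_def free_def)
      qed
      then show ?thesis unfolding E_def integral_mult_right_zero[symmetric] by simp
    qed
    moreover have "cis (t * m \<xi>) * cis (- ((t - \<tau>) * m \<xi>)) = cis (\<tau> * m \<xi>)"
      by (simp add: cis_mult algebra_simps)
    ultimately show ?thesis
      unfolding convol_def by (simp add: mult.assoc[symmetric])
  qed
  have int: "integrable lborel (\<lambda>\<tau>. indicator {0..t} \<tau> *\<^sub>R (E \<tau> / of_real (2 * pi)))"
    unfolding key[symmetric] by (intro integrable_mult_right duhamel_int_integrable f t)
  have "cis (t * m \<xi>) * duhamel_int m (convol fg fb) t \<xi> = (\<integral>\<tau>. indicator {0..t} \<tau> *\<^sub>R (E \<tau> / of_real (2 * pi)) \<partial>lborel)"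
    unfolding duhamel_int_def key[symmetric] by (simp only: integral_mult_right_zero)
  then have "Re (cis (t * m \<xi>) * duhamel_int m (convol fg fb) t \<xi>) = (\<integral>\<tau>. Re (indicator {0..t} \<tau> *\<^sub>R (E \<tau> / of_real (2 * pi))) \<partial>lborel)"
    using integral_Re[OF int] by simp
  also have "\<dots> \<ge> (\<integral>\<tau>. indicator {0..t} \<tau> *\<^sub>R (S / (4 * pi)) \<partial>lborel)"
  proof (intro integral_mono)
    show "integrable lborel (\<lambda>\<tau>. indicator {0..t} \<tau> *\<^sub>R (S / (4 * pi)))"
      by (intro integrable_scaleR_left) (simp add: integrable_indicator_iff emeasure_lborel_Icc_eq)
    show "integrable lborel (\<lambda>\<tau>. Re (indicator {0..t} \<tau> *\<^sub>R (E \<tau> / of_real (2 * pi))))"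
      using int by (rule integrable_Re)
    fix \<tau>
    show "indicator {0..t} \<tau> *\<^sub>R (S / (4 * pi)) \<le> Re (indicator {0..t} \<tau> *\<^sub>R (E \<tau> / of_real (2 * pi)))"
    proof (cases "\<tau> \<in> {0..t}")
      case True
      have "Re (E \<tau> / of_real (2 * pi)) = Re (E \<tau>) / (2 * pi)" by (rule Re_divide_of_real)
      moreover have "S / (4 * pi) \<le> Re (E \<tau>) / (2 * pi)"
        using divide_right_mono[OF ReE[OF True], of "2 * pi"] by simp
      ultimately show ?thesis using True by simp
    qed simp
  qed
  finally have "t * (S / (4 * pi)) \<le> Re (cis (t * m \<xi>) * duhamel_int m (convol fg fb) t \<xi>)"
    using t by simp
  also have "\<dots> \<le> cmod (cis (t * m \<xi>) * duhamel_int m (convol fg fb) t \<xi>)" by (rule complex_Re_le_cmod)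
  finally have le: "t * (S / (4 * pi)) \<le> cmod (duhamel_int m (convol fg fb) t \<xi>)" by (simp add: norm_mult)
  have "convol (\<lambda>t \<xi>. of_real a * fg t \<xi>) fb = (\<lambda>t \<xi>. of_real a * convol fg fb t \<xi>)"
    by (intro ext) (simp add: convol_def mult.assoc)
  then have "duhamel_int m (convol (\<lambda>t \<xi>. of_real a * fg t \<xi>) fb) t \<xi> = of_real a * duhamel_int m (convol fg fb) t \<xi>"
    by (simp add: duhamel_int_def mult.left_commute[of _ "of_real a"] flip: integral_mult_right_zero)
  then have "cmod (bilin \<omega> v a (\<lambda>\<xi>. of_real (b \<xi>)) (\<lambda>\<xi>. of_real (g \<xi>)) t \<xi>) = \<bar>a\<bar> * cmod (duhamel_int m (convol fg fb) t \<xi>)"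
    by (simp add: bilin_def fb_def fg_def m_def norm_mult)
  then show "\<bar>a\<bar> / (4 * pi) * t * (\<integral>\<eta>. g \<eta> * b (\<xi> - \<eta>) \<partial>lborel)
      \<le> cmod (bilin \<omega> v a (\<lambda>\<xi>. of_real (b \<xi>)) (\<lambda>\<xi>. of_real (g \<xi>)) t \<xi>)"
    using mult_left_mono[OF le abs_ge_zero[of a]] by (simp add: S_def mult_ac)
qed

text \<open>The quadratic bound tested on packets of norm of order 1. The size conditions on
  \<open>\<eta>0\<close> keep the \<open>B\<close> packet and the output near
  \<open>\<eta>0 + M\<close> at frequencies comparable to \<open>M\<close>, so that the powers of
  \<open>M\<close> with exponent \<open>k\<close> cancel.\<close>

lemma resonance_inequality:
  assumes quad_bound: "\<And>b g H t \<phi>. continuous_on UNIV b \<Longrightarrow> (\<And>\<xi>. cmod (b \<xi>) \<le> H * W 0 \<xi>) \<Longrightarrow>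
      continuous_on UNIV g \<Longrightarrow> (\<And>\<xi>. cmod (g \<xi>) \<le> H * W 0 \<xi>) \<Longrightarrow> (\<And>\<xi>. g (- \<xi>) = cnj (g \<xi>)) \<Longrightarrow>
      t \<in> {0..T} \<Longrightarrow> integrable lborel \<phi> \<Longrightarrow> integrable lborel (wL2 (- k) \<phi>) \<Longrightarrow>
      cmod (\<integral>\<xi>. bilin \<omega> v a b g t \<xi> * \<phi> \<xi> \<partial>lborel) \<le> C * sqrt (\<integral>\<xi>. wL2 (- k) \<phi> \<xi> \<partial>lborel) *
        ((\<integral>\<xi>. wL2 k b \<xi> \<partial>lborel) + (\<integral>\<xi>. wL2 l g \<xi> \<partial>lborel))"
    and a: "a \<noteq> 0" and M: "1 \<le> M" and d: "0 < d" "d \<le> M / 8"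
    and \<eta>0: "3 * M / 8 \<le> \<bar>\<eta>0\<bar>" "\<bar>\<eta>0\<bar> \<le> 4 * M" "3 * M / 8 \<le> \<bar>\<eta>0 + M\<bar>" "\<bar>\<eta>0 + M\<bar> \<le> 4 * M"
    and t: "t \<in> {0..T}"
    and phase: "\<And>\<zeta> \<eta>. \<bar>\<zeta> - \<eta>0\<bar> < d \<Longrightarrow> \<bar>\<eta> - M\<bar> < d \<Longrightarrow> t * \<bar>\<eta> * (\<omega> * (2 * \<zeta> + \<eta>) - v)\<bar> \<le> 1"
  shows "t * sqrt d \<le> (64 * pi / \<bar>a\<bar>) * (\<bar>C\<bar> * (2 * sqrt (65 powr \<bar>k\<bar>)) * (4 * 65 powr \<bar>k\<bar> + 16 * 65 powr \<bar>l\<bar>)) * M powr l"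
proof -
  have Mpos: "0 < M" using M by simp
  \<comment> \<open>The heights give packets of width \<open>d\<close> at frequencies comparable to
    \<open>M\<close> a norm of order 1 in \<open>H^k\<close> and in \<open>H^l\<close>.\<close>
  define \<alpha> where "\<alpha> = M powr (- k) / sqrt d"
  define \<beta> where "\<beta> = M powr (- l) / sqrt d"
  have \<alpha>\<beta>: "\<alpha> > 0" "\<beta> > 0" using Mpos d by (simp_all add: \<alpha>_def \<beta>_def)
  define b where "b = (\<lambda>\<xi>. \<alpha> * tent \<eta>0 d \<xi>)"
  \<comment> \<open>The mirror packet at \<open>- M\<close> makes the wave real.\<close>
  define g where "g = (\<lambda>\<xi>. \<beta> * (tent M d \<xi> + tent (- M) d \<xi>))"
  let ?b = "\<lambda>\<xi>. complex_of_real (b \<xi>)" and ?g = "\<lambda>\<xi>. complex_of_real (g \<xi>)"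
  have b_supp: "\<bar>x - \<eta>0\<bar> < d" if "b x \<noteq> 0" for x
    using that tent_support[OF d(1), of \<eta>0 x] by (auto simp: b_def)
  have g_supp: "\<bar>x - M\<bar> < d \<or> \<bar>x - - M\<bar> < d" if "g x \<noteq> 0" for x
  proof -
    have "tent M d x \<noteq> 0 \<or> tent (- M) d x \<noteq> 0" using that by (auto simp: g_def)
    then show ?thesis using tent_support[OF d(1), of M x] tent_support[OF d(1), of "- M" x] by blast
  qed
  have b_nonneg: "0 \<le> b x" and g_nonneg: "0 \<le> g x" for x
    using \<alpha>\<beta> tent_nonneg by (simp_all add: b_def g_def)
  have b_le: "b x \<le> \<alpha>" for x
    unfolding b_def using \<alpha>\<beta> tent_le_1[OF d(1), of \<eta>0 x] tent_nonneg[of \<eta>0 d x] by (intro mult_left_le) auto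
  have g_le: "g x \<le> 2 * \<beta>" for x
  proof -
    have "\<beta> * (tent M d x + tent (- M) d x) \<le> \<beta> * 2"
      using \<alpha>\<beta> tent_le_1[OF d(1), of M x] tent_le_1[OF d(1), of "- M" x] by (intro mult_left_mono) auto
    then show ?thesis by (simp add: g_def)
  qed
  have b_ann: "M / 8 \<le> \<bar>x\<bar> \<and> \<bar>x\<bar> \<le> 8 * M" if "b x \<noteq> 0" for x
    using b_supp[OF that] \<eta>0 d M by linarith
  have g_ann: "M / 8 \<le> \<bar>x\<bar> \<and> \<bar>x\<bar> \<le> 8 * M" if "g x \<noteq> 0" for x
    using g_supp[OF that] d M by linarith
  have b_cont: "continuous_on UNIV ?b" and g_cont: "continuous_on UNIV ?g"
    unfolding b_def g_def by (intro continuous_intros continuous_on_tent)+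
  \<comment> \<open>All packets live in \<open>|x| <= 8 * M\<close>, where \<open>W 0\<close> is
    smallest at the endpoints.\<close>
  define H where "H = (\<alpha> + 2 * \<beta>) / W 0 (8 * M)"
  have HW: "\<alpha> + 2 * \<beta> \<le> H * W 0 x" if "\<bar>x\<bar> \<le> 8 * M" for x
  proof -
    have "(1 + T) * \<bar>x\<bar> \<le> (1 + T) * (8 * M)" using that T_nonneg by (intro mult_left_mono) auto
    moreover have "x\<^sup>2 \<le> (8 * M)\<^sup>2" using that by (metis abs_ge_zero power2_abs power_mono)
    ultimately have "W 0 (8 * M) \<le> W 0 x"
      unfolding W_def using Mpos one_plus_sq_pos[of x] by (intro frac_le) auto
    then have "(\<alpha> + 2 * \<beta>) / W 0 (8 * M) * W 0 (8 * M) \<le> (\<alpha> + 2 * \<beta>) / W 0 (8 * M) * W 0 x"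
      using \<alpha>\<beta> W_pos[of 0 "8 * M"] by (intro mult_left_mono) auto
    then show ?thesis using W_pos[of 0 "8 * M"] by (simp add: H_def)
  qed
  have H: "0 \<le> H" using \<alpha>\<beta> W_pos[of 0 "8 * M"] by (simp add: H_def)
  have b_W: "cmod (?b \<xi>) \<le> H * W 0 \<xi>" for \<xi>
  proof (cases "b \<xi> = 0")
    case False
    with b_le[of \<xi>] b_nonneg[of \<xi>] HW[of \<xi>] b_ann[of \<xi>] \<alpha>\<beta> show ?thesis by simp
  qed (use H less_imp_le[OF W_pos] in simp)
  have g_W: "cmod (?g \<xi>) \<le> H * W 0 \<xi>" for \<xi>
  proof (cases "g \<xi> = 0")
    case False
    with g_le[of \<xi>] g_nonneg[of \<xi>] HW[of \<xi>] g_ann[of \<xi>] \<alpha>\<beta> show ?thesis by simp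
  qed (use H less_imp_le[OF W_pos] in simp)
  have g_sym: "?g (- \<xi>) = cnj (?g \<xi>)" for \<xi>
    by (simp add: g_def tent_uminus add.commute)
  define J where "J = {\<eta>0 + M - d / 4..\<eta>0 + M + d / 4}"
  \<comment> \<open>For \<open>\<xi>\<close> in \<open>J\<close> and \<open>\<eta>\<close> within
    \<open>d / 4\<close> of \<open>M\<close> both tents are at least 1/2, so the convolution is at
    least \<open>\<alpha> * \<beta> / 4\<close> times the length \<open>d / 2\<close>.\<close>
  define \<kappa> where "\<kappa> = \<bar>a\<bar> / (4 * pi) * t * (\<alpha> * \<beta> * d / 8)"
  let ?Q = "bilin \<omega> v a ?b ?g t"
  have lower: "\<kappa> \<le> cmod (?Q \<xi>)" if \<xi>: "\<xi> \<in> J" for \<xi>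
  proof -
    have \<xi>': "\<bar>\<xi> - (\<eta>0 + M)\<bar> \<le> d / 4" using \<xi> unfolding J_def atLeastAtMost_iff by linarith
    have ph: "t * \<bar>\<omega> * \<xi>\<^sup>2 - v * \<eta> - \<omega> * (\<xi> - \<eta>)\<^sup>2\<bar> \<le> 1" if "g \<eta> \<noteq> 0" "b (\<xi> - \<eta>) \<noteq> 0" for \<eta>
    proof -
      have "\<bar>\<xi> - \<eta> - \<eta>0\<bar> < d" by (rule b_supp[OF that(2)])
      \<comment> \<open>\<open>\<xi>\<close> in \<open>J\<close> and the support of \<open>b\<close>
        put \<open>\<eta>\<close> within \<open>5 * d / 4\<close> of \<open>M\<close>, far from
        \<open>- M\<close>, so the mirror packet does not contribute.\<close>
      moreover have "\<bar>\<eta> - M\<bar> < d"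
        using g_supp[OF that(1)] calculation \<xi>' d M by linarith
      ultimately have "t * \<bar>\<eta> * (\<omega> * (2 * (\<xi> - \<eta>) + \<eta>) - v)\<bar> \<le> 1" by (rule phase)
      moreover have "\<eta> * (\<omega> * (2 * (\<xi> - \<eta>) + \<eta>) - v) = \<omega> * \<xi>\<^sup>2 - v * \<eta> - \<omega> * (\<xi> - \<eta>)\<^sup>2"
        by (simp add: power2_eq_square algebra_simps)
      ultimately show ?thesis by simp
    qed
    note nb = norm_bilin_ge[OF t b_cont b_W b_nonneg g_cont g_W g_nonneg ph]
    have "\<alpha> * \<beta> * d / 8 = (\<integral>\<eta>. indicator {M - d / 4..M + d / 4} \<eta> * (\<alpha> * \<beta> / 4) \<partial>lborel)"
      using d by simp
    also have "\<dots> \<le> (\<integral>\<eta>. g \<eta> * b (\<xi> - \<eta>) \<partial>lborel)"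
    proof (intro integral_mono nb(1))
      show "integrable lborel (\<lambda>\<eta>. indicator {M - d / 4..M + d / 4} \<eta> * (\<alpha> * \<beta> / 4))"
        by (intro integrable_mult_left) (simp add: integrable_indicator_iff emeasure_lborel_Icc_eq)
      fix \<eta>
      show "indicator {M - d / 4..M + d / 4} \<eta> * (\<alpha> * \<beta> / 4) \<le> g \<eta> * b (\<xi> - \<eta>)"
      proof (cases "\<eta> \<in> {M - d / 4..M + d / 4}")
        case True
        then have e: "\<bar>\<eta> - M\<bar> \<le> d / 4" unfolding atLeastAtMost_iff by linarith
        then have e2: "\<bar>\<eta> - M\<bar> \<le> d / 2" "\<bar>\<xi> - \<eta> - \<eta>0\<bar> \<le> d / 2" using \<xi>' d by linarith+
        have h: "1 / 2 \<le> tent M d \<eta>" "1 / 2 \<le> tent \<eta>0 d (\<xi> - \<eta>)"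
          by (rule tent_ge_half[OF d(1) e2(1)], rule tent_ge_half[OF d(1) e2(2)])
        have "\<beta> * (1 / 2) \<le> g \<eta>"
          unfolding g_def using h(1) tent_nonneg[of "- M" d \<eta>] \<alpha>\<beta> by (intro mult_left_mono) auto
        moreover have "\<alpha> * (1 / 2) \<le> b (\<xi> - \<eta>)"
          unfolding b_def using h(2) \<alpha>\<beta> by (intro mult_left_mono) auto
        ultimately have "\<beta> * (1 / 2) * (\<alpha> * (1 / 2)) \<le> g \<eta> * b (\<xi> - \<eta>)"
          using \<alpha>\<beta> g_nonneg by (intro mult_mono) auto
        then show ?thesis using True by (simp add: mult_ac)
      qed (simp add: g_nonneg b_nonneg)
    qed
    finally have "\<alpha> * \<beta> * d / 8 \<le> (\<integral>\<eta>. g \<eta> * b (\<xi> - \<eta>) \<partial>lborel)" .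
    then have "\<kappa> \<le> \<bar>a\<bar> / (4 * pi) * t * (\<integral>\<eta>. g \<eta> * b (\<xi> - \<eta>) \<partial>lborel)"
      unfolding \<kappa>_def using t by (intro mult_left_mono) auto
    also have "\<dots> \<le> cmod (?Q \<xi>)" by (rule nb(2))
    finally show ?thesis .
  qed
  have clsQ: "weighted (cmod (- \<i>) * (T * (K * (cmod (of_real a) * H) * H))) (bilin \<omega> v a ?b ?g)"
    unfolding bilin_def[abs_def]
    by (intro weighted_cmult weighted_duhamel_int weighted_convol weighted_free b_cont g_cont b_W g_W continuous_intros)
  then have Qm [measurable]: "?Q \<in> borel_measurable borel" using joint_cont_measurable t by (simp add: weighted_def)
  \<comment> \<open>The dual function: its pairing with the bilinear term is the \<open>L^1\<close>
    norm of that term on \<open>J\<close>. It is cut off sharply at the ends of \<open>J\<close>,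
    hence the pairing with functions that are not Schwartz.\<close>
  define \<phi> where "\<phi> = (\<lambda>\<xi>. indicator J \<xi> *\<^sub>R cnj (sgn (?Q \<xi>)))"
  have [measurable]: "J \<in> sets borel" by (simp add: J_def)
  have "cnj \<in> borel_measurable borel"
    by (intro borel_measurable_continuous_onI continuous_intros)
  moreover have "(\<lambda>\<xi>. sgn (?Q \<xi>)) \<in> borel_measurable borel"
    unfolding sgn_div_norm by measurable
  ultimately have "(\<lambda>\<xi>. cnj (sgn (?Q \<xi>))) \<in> borel_measurable borel"
    by (rule measurable_compose[rotated])
  then have \<phi>m: "\<phi> \<in> borel_measurable borel" unfolding \<phi>_def by measurable
  have \<phi>_le: "cmod (\<phi> x) \<le> 1" for x by (simp add: \<phi>_def norm_sgn indicator_def)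
  have J_near: "\<bar>x - (\<eta>0 + M)\<bar> \<le> d / 4" if "x \<in> J" for x
    using that unfolding J_def atLeastAtMost_iff by linarith
  have \<phi>_supp: "x \<in> J" if "\<phi> x \<noteq> 0" for x using that by (auto simp: \<phi>_def indicator_def split: if_splits)
  have \<phi>_near: "\<bar>x - (\<eta>0 + M)\<bar> \<le> d \<or> \<bar>x - (\<eta>0 + M)\<bar> \<le> d" if "\<phi> x \<noteq> 0" for x
    using J_near[OF \<phi>_supp[OF that]] d by linarith
  have \<phi>_ann: "M / 8 \<le> \<bar>x\<bar> \<and> \<bar>x\<bar> \<le> 8 * M" if "\<phi> x \<noteq> 0" for x
    using J_near[OF \<phi>_supp[OF that]] d M \<eta>0 by linarith
  note \<phi>W = wL2_annulus_le(1)[OF M d(1) \<phi>m \<phi>_le \<phi>_near \<phi>_ann, where k = "- k"]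
    wL2_annulus_le(2)[OF M d(1) \<phi>m \<phi>_le \<phi>_near \<phi>_ann]
    wL2_annulus_le(3)[OF M d(1) \<phi>m \<phi>_le \<phi>_near \<phi>_ann, where k = "- k"]
  have meas: "?b \<in> borel_measurable borel" "?g \<in> borel_measurable borel"
    using b_cont g_cont by (auto intro: borel_measurable_continuous_onI)
  have "(\<integral>\<xi>. wL2 k ?b \<xi> \<partial>lborel) \<le> \<alpha>\<^sup>2 * (65 powr \<bar>k\<bar> * M powr (2 * k)) * (4 * d)"
  proof (rule wL2_annulus_le(3)[OF M d(1) meas(1)])
    show "cmod (?b x) \<le> \<alpha>" for x using b_le b_nonneg by simp
    show "\<bar>x - \<eta>0\<bar> \<le> d \<or> \<bar>x - \<eta>0\<bar> \<le> d" if "?b x \<noteq> 0" for x using b_supp[of x] that by simp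
    show "M / 8 \<le> \<bar>x\<bar> \<and> \<bar>x\<bar> \<le> 8 * M" if "?b x \<noteq> 0" for x using b_ann[of x] that by simp
  qed
  also have "\<dots> = 4 * 65 powr \<bar>k\<bar>"
  proof -
    have "\<alpha>\<^sup>2 * M powr (2 * k) * d = 1"
      using d Mpos by (simp add: \<alpha>_def power_divide powr_minus field_simps power2_eq_square flip: powr_add)
    then show ?thesis by (simp add: mult_ac)
  qed
  finally have bN: "(\<integral>\<xi>. wL2 k ?b \<xi> \<partial>lborel) \<le> 4 * 65 powr \<bar>k\<bar>" .
  have "(\<integral>\<xi>. wL2 l ?g \<xi> \<partial>lborel) \<le> (2 * \<beta>)\<^sup>2 * (65 powr \<bar>l\<bar> * M powr (2 * l)) * (4 * d)"
  proof (rule wL2_annulus_le(3)[OF M d(1) meas(2)])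
    show "cmod (?g x) \<le> 2 * \<beta>" for x using g_le g_nonneg by simp
    show "\<bar>x - M\<bar> \<le> d \<or> \<bar>x - - M\<bar> \<le> d" if "?g x \<noteq> 0" for x using g_supp[of x] that by auto
    show "M / 8 \<le> \<bar>x\<bar> \<and> \<bar>x\<bar> \<le> 8 * M" if "?g x \<noteq> 0" for x using g_ann[of x] that by simp
  qed
  also have "\<dots> = 16 * 65 powr \<bar>l\<bar>"
  proof -
    have "\<beta>\<^sup>2 * M powr (2 * l) * d = 1"
      using d Mpos by (simp add: \<beta>_def power_divide powr_minus field_simps power2_eq_square flip: powr_add)
    then show ?thesis by (simp add: power_mult_distrib mult_ac)
  qed
  finally have gN: "(\<integral>\<xi>. wL2 l ?g \<xi> \<partial>lborel) \<le> 16 * 65 powr \<bar>l\<bar>" .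
  have "sqrt (\<integral>\<xi>. wL2 (- k) \<phi> \<xi> \<partial>lborel) \<le> sqrt (1\<^sup>2 * (65 powr \<bar>- k\<bar> * M powr (2 * - k)) * (4 * d))"
    by (rule real_sqrt_le_mono[OF \<phi>W(3)])
  also have "\<dots> = 2 * sqrt (65 powr \<bar>k\<bar>) * M powr (- k) * sqrt d"
  proof -
    have "sqrt (M powr (2 * - k)) = M powr (- k)"
      using Mpos by (simp add: powr_half_sqrt[symmetric] powr_powr)
    then show ?thesis by (simp add: real_sqrt_mult)
  qed
  finally have \<phi>N: "sqrt (\<integral>\<xi>. wL2 (- k) \<phi> \<xi> \<partial>lborel) \<le> 2 * sqrt (65 powr \<bar>k\<bar>) * M powr (- k) * sqrt d" .
  have Q\<phi>: "?Q \<xi> * \<phi> \<xi> = of_real (indicator J \<xi> * cmod (?Q \<xi>))" for \<xi>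
  proof -
    have "z * cnj (sgn z) = of_real (cmod z)" for z :: complex
    proof (cases "z = 0")
      case False
      have "z * cnj (sgn z) = z * cnj z / of_real (cmod z)" by (simp add: sgn_eq)
      also have "\<dots> = of_real ((cmod z)\<^sup>2) / of_real (cmod z)" by (simp only: complex_norm_square)
      also have "\<dots> = of_real (cmod z)" using False by (simp add: power2_eq_square)
      finally show ?thesis .
    qed simp
    then show ?thesis by (simp add: \<phi>_def indicator_def)
  qed
  have Qint: "integrable lborel (\<lambda>\<xi>. indicator J \<xi> * cmod (?Q \<xi>))"
  proof -
    have "integrable lborel (\<lambda>\<xi>. ?Q \<xi> * \<phi> \<xi>)"
      by (rule integrable_mult_weighted[OF clsQ t \<phi>W(2)])
    then show ?thesis unfolding Q\<phi> by (simp only: complex_of_real_integrable_eq)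
  qed
  have "\<kappa> * (d / 2) = (\<integral>\<xi>. indicator J \<xi> * \<kappa> \<partial>lborel)" using d by (simp add: J_def)
  also have "\<dots> \<le> (\<integral>\<xi>. indicator J \<xi> * cmod (?Q \<xi>) \<partial>lborel)"
  proof (intro integral_mono Qint)
    show "integrable lborel (\<lambda>\<xi>. indicator J \<xi> * \<kappa>)"
      unfolding J_def by (intro integrable_mult_left) (simp add: integrable_indicator_iff emeasure_lborel_Icc_eq)
    show "indicator J \<xi> * \<kappa> \<le> indicator J \<xi> * cmod (?Q \<xi>)" for \<xi>
      using lower[of \<xi>] by (simp add: indicator_def)
  qed
  also have "\<dots> = Re (\<integral>\<xi>. ?Q \<xi> * \<phi> \<xi> \<partial>lborel)"
    unfolding Q\<phi> by (simp only: integral_complex_of_real Re_complex_of_real)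
  also have "\<dots> \<le> cmod (\<integral>\<xi>. ?Q \<xi> * \<phi> \<xi> \<partial>lborel)" by (rule complex_Re_le_cmod)
  also have "\<dots> \<le> C * sqrt (\<integral>\<xi>. wL2 (- k) \<phi> \<xi> \<partial>lborel) *
        ((\<integral>\<xi>. wL2 k ?b \<xi> \<partial>lborel) + (\<integral>\<xi>. wL2 l ?g \<xi> \<partial>lborel))"
    by (rule quad_bound[OF b_cont b_W g_cont g_W g_sym t \<phi>W(2,1)])
  also have "\<dots> \<le> \<bar>C\<bar> * (2 * sqrt (65 powr \<bar>k\<bar>) * M powr (- k) * sqrt d) * (4 * 65 powr \<bar>k\<bar> + 16 * 65 powr \<bar>l\<bar>)"
    by (intro mult_mono \<phi>N add_mono bN gN) (auto simp: wL2_nonneg intro!: mult_nonneg_nonneg add_nonneg_nonneg d(1)[THEN less_imp_le])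
  finally have main: "\<kappa> * (d / 2) \<le> \<bar>C\<bar> * (2 * sqrt (65 powr \<bar>k\<bar>) * M powr (- k) * sqrt d) * (4 * 65 powr \<bar>k\<bar> + 16 * 65 powr \<bar>l\<bar>)" .
  define X where "X = \<bar>C\<bar> * (2 * sqrt (65 powr \<bar>k\<bar>)) * (4 * 65 powr \<bar>k\<bar> + 16 * 65 powr \<bar>l\<bar>)"
  have "\<alpha> * \<beta> * d = M powr (- k) * M powr (- l)"
    using d by (simp add: \<alpha>_def \<beta>_def)
  \<comment> \<open>The factor \<open>M powr (- k) * sqrt d\<close> occurs on both sides: its power
    of \<open>M\<close> comes from \<open>\<alpha>\<close> on the left and from the norm of
    \<open>\<phi>\<close> on the right. Dividing it out removes \<open>k\<close> from the powers of
    \<open>M\<close>.\<close>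
  then have \<kappa>d: "\<kappa> * (d / 2) = (M powr (- k) * sqrt d) * (\<bar>a\<bar> / (64 * pi) * (M powr (- l) * (t * sqrt d)))"
    using d by (simp add: \<kappa>_def field_simps)
  have "(M powr (- k) * sqrt d) * (\<bar>a\<bar> / (64 * pi) * (M powr (- l) * (t * sqrt d))) \<le> (M powr (- k) * sqrt d) * X"
    using main unfolding \<kappa>d by (simp add: X_def mult_ac)
  then have "\<bar>a\<bar> / (64 * pi) * (M powr (- l) * (t * sqrt d)) \<le> X"
    by (rule mult_left_le_imp_le) (use Mpos d in simp)
  then have "M powr (- l) * (t * sqrt d) \<le> 64 * pi / \<bar>a\<bar> * X"
    using a by (simp add: field_simps)
  from mult_left_mono[OF this, of "M powr l"]
  have "(M powr l * M powr (- l)) * (t * sqrt d) \<le> M powr l * (64 * pi / \<bar>a\<bar> * X)"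
    by (simp add: mult.assoc)
  then show ?thesis using Mpos by (simp add: X_def mult_ac flip: powr_add)
qed

text \<open>Both choices of packets give a lower bound \<open>c * M powr (- 1 / 2)\<close> with
  \<open>c > 0\<close>; since \<open>l + 1 / 2 < 0\<close>, it exceeds \<open>Q * M powr l\<close>
  for large \<open>M\<close>.\<close>

lemma no_quad_bound:
  assumes quad_bound: "\<And>b g H t \<phi>. continuous_on UNIV b \<Longrightarrow> (\<And>\<xi>. cmod (b \<xi>) \<le> H * W 0 \<xi>) \<Longrightarrow>
      continuous_on UNIV g \<Longrightarrow> (\<And>\<xi>. cmod (g \<xi>) \<le> H * W 0 \<xi>) \<Longrightarrow> (\<And>\<xi>. g (- \<xi>) = cnj (g \<xi>)) \<Longrightarrow>
      t \<in> {0..T} \<Longrightarrow> integrable lborel \<phi> \<Longrightarrow> integrable lborel (wL2 (- k) \<phi>) \<Longrightarrow>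
      cmod (\<integral>\<xi>. bilin \<omega> v a b g t \<xi> * \<phi> \<xi> \<partial>lborel) \<le> C * sqrt (\<integral>\<xi>. wL2 (- k) \<phi> \<xi> \<partial>lborel) *
        ((\<integral>\<xi>. wL2 k b \<xi> \<partial>lborel) + (\<integral>\<xi>. wL2 l g \<xi> \<partial>lborel))"
    and a: "a \<noteq> 0" and l: "l < - 1 / 2" and T: "T > 0"
  shows False
proof -
  define Q where "Q = (64 * pi / \<bar>a\<bar>) * (\<bar>C\<bar> * (2 * sqrt (65 powr \<bar>k\<bar>)) * (4 * 65 powr \<bar>k\<bar> + 16 * 65 powr \<bar>l\<bar>))"
  have ineq: "t * sqrt d \<le> Q * M powr l"
    if "1 \<le> M" "0 < d" "d \<le> M / 8"
      "3 * M / 8 \<le> \<bar>\<eta>0\<bar>" "\<bar>\<eta>0\<bar> \<le> 4 * M" "3 * M / 8 \<le> \<bar>\<eta>0 + M\<bar>" "\<bar>\<eta>0 + M\<bar> \<le> 4 * M" "t \<in> {0..T}"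
      "\<And>\<zeta> \<eta>. \<bar>\<zeta> - \<eta>0\<bar> < d \<Longrightarrow> \<bar>\<eta> - M\<bar> < d \<Longrightarrow> t * \<bar>\<eta> * (\<omega> * (2 * \<zeta> + \<eta>) - v)\<bar> \<le> 1"
    for M d \<eta>0 t
    unfolding Q_def
    by (rule resonance_inequality[OF _ a that(1-8)])
      ((rule quad_bound; assumption) | (rule that(9); assumption))+
  have "\<exists>c>0. \<forall>\<^sub>F M in at_top. c * M powr (- 1 / 2) \<le> Q * M powr l"
  proof (cases "\<omega> = 0")
    case True
    \<comment> \<open>Without dispersion the phase is \<open>- v * \<eta>\<close>, which no choice
      of \<open>\<eta>0\<close> improves. Hence wide packets, \<open>d = M / 8\<close> and
      \<open>\<eta>0 = 2 * M\<close>, and the short time \<open>t = 1 / (2 * (|v| + 1) * M)\<close>,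
      where \<open>|v| + 1\<close> allows \<open>v = 0\<close> and \<open>1 / T <= M\<close> ensures
      \<open>t <= T\<close>.\<close>
    define c where "c = 1 / (2 * (\<bar>v\<bar> + 1)) * sqrt (1 / 8)"
    have "c * M powr (- 1 / 2) \<le> Q * M powr l" if M: "1 \<le> M" "1 / T \<le> M" for M
    proof -
      have Mpos: "M > 0" using M by simp
      define D where "D = 2 * (\<bar>v\<bar> + 1) * M"
      define t where "t = 1 / D"
      have D: "D > 0" unfolding D_def using Mpos by (intro mult_pos_pos) auto
      have "1 \<le> T * M" using M(2) T by (simp add: field_simps)
      also have "\<dots> \<le> T * D"
      proof (intro mult_left_mono)
        have "1 * M \<le> 2 * (\<bar>v\<bar> + 1) * M" using Mpos by (intro mult_right_mono) auto
        then show "M \<le> D" by (simp only: D_def mult_1)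
      qed (use T in simp)
      finally have "t \<le> T" using D by (simp add: t_def pos_divide_le_eq)
      then have t: "t \<in> {0..T}" using D by (simp add: t_def)
      have "t * sqrt (M / 8) \<le> Q * M powr l"
      proof (rule ineq[of M "M / 8" "2 * M" t])
        fix \<zeta> \<eta> assume "\<bar>\<eta> - M\<bar> < M / 8"
        then have "\<bar>\<eta>\<bar> \<le> 2 * M" by linarith
        then have "\<bar>\<eta>\<bar> * \<bar>v\<bar> \<le> 2 * M * (\<bar>v\<bar> + 1)" by (intro mult_mono) auto
        then have "t * (\<bar>\<eta>\<bar> * \<bar>v\<bar>) \<le> t * (2 * M * (\<bar>v\<bar> + 1))"
          using t by (intro mult_left_mono) auto
        also have "2 * M * (\<bar>v\<bar> + 1) = D" by (simp add: D_def)
        also have "t * D = 1" using D by (simp add: t_def)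
        finally show "t * \<bar>\<eta> * (\<omega> * (2 * \<zeta> + \<eta>) - v)\<bar> \<le> 1" by (simp add: True abs_mult)
      qed (use M Mpos t in auto)
      moreover have "t * sqrt (M / 8) = c * M powr (- 1 / 2)"
      proof -
        have "sqrt M / M = M powr (- 1 / 2)"
          using Mpos by (simp add: powr_minus powr_half_sqrt real_sqrt_divide field_simps)
        moreover have "t * sqrt (M / 8) = c * (sqrt M / M)"
          by (simp add: t_def D_def c_def real_sqrt_divide)
        ultimately show ?thesis by simp
      qed
      ultimately show ?thesis by simp
    qed
    note large = this
    have "\<forall>\<^sub>F M in at_top. c * M powr (- 1 / 2) \<le> Q * M powr l"
      using eventually_ge_at_top[of 1] eventually_ge_at_top[of "1 / T"] by eventually_elim (rule large)
    moreover have "c > 0" by (simp add: c_def add_pos_nonneg)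
    ultimately show ?thesis by blast
  next
    case False
    define c where "c = T * sqrt (1 / (4 * \<bar>\<omega>\<bar> * T))"
    have "c * M powr (- 1 / 2) \<le> Q * M powr l"
      if M: "1 \<le> M" "4 * \<bar>v / \<omega>\<bar> \<le> M" "8 * (1 / (4 * \<bar>\<omega>\<bar> * T)) \<le> M" for M
    proof -
      have Mpos: "M > 0" using M by simp
      \<comment> \<open>With \<open>|\<eta>| <= 9 / 8 * M\<close> and detuning at most
        \<open>3 * |\<omega>| * d\<close> the phase over time \<open>T\<close> is at most
        \<open>27 / 8 * T * |\<omega>| * M * d\<close>, and this \<open>d\<close> makes it
        \<open>27 / 32\<close>.\<close>
      define d where "d = 1 / (4 * \<bar>\<omega>\<bar> * T) / M"
      have d0: "d > 0" using False T Mpos by (simp add: d_def)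
      have "d \<le> 1 / (4 * \<bar>\<omega>\<bar> * T) / 1" unfolding d_def using M T by (intro divide_left_mono) auto
      then have "8 * d \<le> 8 * (1 / (4 * \<bar>\<omega>\<bar> * T) / 1)" by (rule mult_left_mono) simp
      also have "\<dots> \<le> M" using M(3) by (simp only: div_by_1)
      finally have dM: "d \<le> M / 8" by simp
      define z where "z = v / \<omega>"
      have z: "4 * \<bar>z\<bar> \<le> M" using M(2) by (simp only: z_def)
      \<comment> \<open>The solution of the resonance condition
        \<open>\<omega> * (2 * \<eta>0 + M) = v\<close>. It is close to \<open>- M / 2\<close> up to
        \<open>M / 8\<close>, so \<open>\<eta>0 + M\<close> is comparable to \<open>M\<close> as
        well.\<close>
      define \<eta>0 where "\<eta>0 = (z - M) / 2"
      have eta: "2 * \<eta>0 = z - M" by (simp add: \<eta>0_def)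
      have v: "\<omega> * (2 * \<eta>0 + M) = v" using False by (simp add: \<eta>0_def z_def field_simps)
      have "T * sqrt d \<le> Q * M powr l"
      proof (rule ineq[OF M(1) d0 dM, of \<eta>0 T])
        show "3 * M / 8 \<le> \<bar>\<eta>0\<bar>"
          using M(1) z eta by linarith
        show "\<bar>\<eta>0\<bar> \<le> 4 * M"
          using M(1) z eta by linarith
        show "3 * M / 8 \<le> \<bar>\<eta>0 + M\<bar>"
          using M(1) z eta by linarith
        show "\<bar>\<eta>0 + M\<bar> \<le> 4 * M"
          using M(1) z eta by linarith
        show "T \<in> {0..T}" using T by simp
        fix \<zeta> \<eta> assume \<zeta>: "\<bar>\<zeta> - \<eta>0\<bar> < d" and \<eta>: "\<bar>\<eta> - M\<bar> < d"
        have "\<omega> * (2 * \<zeta> + \<eta>) - v = \<omega> * (2 * (\<zeta> - \<eta>0) + (\<eta> - M))"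
          unfolding v[symmetric] by (simp add: algebra_simps)
        then have "\<bar>\<omega> * (2 * \<zeta> + \<eta>) - v\<bar> = \<bar>\<omega>\<bar> * \<bar>2 * (\<zeta> - \<eta>0) + (\<eta> - M)\<bar>"
          by (simp add: abs_mult)
        also have "\<dots> \<le> \<bar>\<omega>\<bar> * (3 * d)"
        proof (rule mult_left_mono)
          have "\<bar>2 * (\<zeta> - \<eta>0) + (\<eta> - M)\<bar> \<le> 2 * \<bar>\<zeta> - \<eta>0\<bar> + \<bar>\<eta> - M\<bar>"
            by (rule order_trans[OF abs_triangle_ineq]) (simp only: abs_mult abs_numeral order_refl)
          also have "\<dots> \<le> 2 * d + d"
            by (rule add_mono[OF mult_left_mono[OF less_imp_le[OF \<zeta>]] less_imp_le[OF \<eta>]]) simp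
          also have "2 * d + d = 3 * d" by simp
          finally show "\<bar>2 * (\<zeta> - \<eta>0) + (\<eta> - M)\<bar> \<le> 3 * d" .
        qed simp
        finally have 1: "\<bar>\<omega> * (2 * \<zeta> + \<eta>) - v\<bar> \<le> \<bar>\<omega>\<bar> * (3 * d)" .
        have 2: "\<bar>\<eta>\<bar> \<le> 9 / 8 * M" using \<eta> dM by linarith
        have "T * \<bar>\<eta> * (\<omega> * (2 * \<zeta> + \<eta>) - v)\<bar> \<le> T * (9 / 8 * M * (\<bar>\<omega>\<bar> * (3 * d)))"
          unfolding abs_mult[of \<eta>] using T Mpos by (intro mult_left_mono mult_mono 1 2) auto
        also have "\<dots> = 27 / 32" using False T Mpos by (simp add: d_def)
        finally show "T * \<bar>\<eta> * (\<omega> * (2 * \<zeta> + \<eta>) - v)\<bar> \<le> 1" by simp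
      qed
      moreover have "T * sqrt d = c * M powr (- 1 / 2)"
      proof -
        have "M powr (- 1 / 2) = 1 / sqrt M"
          using powr_minus_divide[of M "1 / 2"] Mpos by (simp add: powr_half_sqrt)
        then have "sqrt (e / M) = sqrt e * M powr (- 1 / 2)" for e
          by (simp add: real_sqrt_divide)
        then show ?thesis by (simp only: d_def c_def mult.assoc)
      qed
      ultimately show ?thesis by simp
    qed
    note large = this
    have "\<forall>\<^sub>F M in at_top. c * M powr (- 1 / 2) \<le> Q * M powr l"
      using eventually_ge_at_top[of 1] eventually_ge_at_top[of "4 * \<bar>v / \<omega>\<bar>"]
        eventually_ge_at_top[of "8 * (1 / (4 * \<bar>\<omega>\<bar> * T))"]
      by eventually_elim (rule large)
    moreover have "c > 0" using False T by (simp add: c_def)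
    ultimately show ?thesis by blast
  qed
  then obtain c where c: "c > 0" "\<forall>\<^sub>F M in at_top. c * M powr (- 1 / 2) \<le> Q * M powr l" by blast
  have "\<forall>\<^sub>F M in at_top. c \<le> Q * M powr (l + 1 / 2)"
    using c(2) eventually_gt_at_top[of 0]
  proof eventually_elim
    case (elim M)
    from mult_right_mono[OF elim(1), of "M powr (1 / 2)"]
    have "c * (M powr (- 1 / 2) * M powr (1 / 2)) \<le> Q * (M powr l * M powr (1 / 2))"
      by (simp add: mult.assoc)
    then show ?case using elim(2) by (simp flip: powr_add)
  qed
  moreover have "((\<lambda>M. Q * M powr (l + 1 / 2)) \<longlongrightarrow> Q * 0) at_top"
    using l by (intro tendsto_mult tendsto_const tendsto_neg_powr filterlim_ident) simp
  ultimately have "c \<le> Q * 0"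
    by (intro tendsto_lowerbound) auto
  with c(1) show False by simp
qed

end

theorem theorem1p4:
  fixes \<theta> \<gamma> \<omega> \<nu> \<beta> q k l s T :: real
    and \<Phi> :: "distr \<times> distr \<times> distr \<Rightarrow> real \<Rightarrow> distr \<times> distr \<times> distr"
  assumes "\<theta> \<noteq> 0" and "\<beta> > 0" and "\<beta> - \<nu>\<^sup>2 \<noteq> 0"
    and "q = \<gamma> + \<nu> * (\<gamma> * \<nu> - 1) / (2 * (\<beta> - \<nu>\<^sup>2))"
    and "min l s < - 1 / 2" and "T > 0"
    and nondegenerate:
      "l < - 1 / 2 \<and> \<gamma> * (sqrt \<beta> - \<nu> / 2) \<noteq> 0 \<or> s < - 1 / 2 \<and> \<gamma> * (sqrt \<beta> + \<nu> / 2) \<noteq> 0"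
    and "data_to_solution_map \<theta> \<gamma> \<omega> \<nu> \<beta> q k l s T \<Phi>"
  shows "\<not> C2_at (zr_space k l s) (curve_space T (zr_space k l s)) \<Phi> 0"
proof
  assume C2: "C2_at (zr_space k l s) (curve_space T (zr_space k l s)) \<Phi> 0"
  define a1 where "a1 = \<gamma> * (sqrt \<beta> - \<nu> / 2)"
  define a2 where "a2 = - (\<gamma> * (sqrt \<beta> + \<nu> / 2))"
  define p where "p = \<gamma> * q"
  define v1 where "v1 = (sqrt \<beta> - \<nu>) / \<theta>"
  define v2 where "v2 = - (\<nu> + sqrt \<beta>) / \<theta>"
  define c1 where "c1 = \<gamma> / 2 * (- 1 + \<nu> / (2 * sqrt \<beta>)) / \<theta>"
  define c2 where "c2 = \<gamma> / 2 * (- 1 - \<nu> / (2 * sqrt \<beta>)) / \<theta>"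
  have T: "0 \<le> T" using \<open>T > 0\<close> by simp
  interpret horizon T by (rule horizon.intro[OF T])
  show False
  proof (rule C2_at_imp_quad_bound[OF T assms(8) C2 a1_def a2_def p_def v1_def v2_def c1_def c2_def])
    fix C
    assume C: "\<And>H b0 p0 r0 t \<phi>. smooth_zr T H b0 p0 r0 \<Longrightarrow> t \<in> {0..T} \<Longrightarrow> integrable lborel \<phi> \<Longrightarrow>
      integrable lborel (wL2 (- k) \<phi>) \<Longrightarrow>
      cmod (\<integral>\<xi>. fourier_zr.quad \<omega> v1 v2 a1 a2 b0 p0 r0 t \<xi> * \<phi> \<xi> \<partial>lborel) \<le> C * sqrt (\<integral>\<xi>. wL2 (- k) \<phi> \<xi> \<partial>lborel) *
        ((\<integral>\<xi>. wL2 k b0 \<xi> \<partial>lborel) + (\<integral>\<xi>. wL2 l p0 \<xi> \<partial>lborel) + (\<integral>\<xi>. wL2 s r0 \<xi> \<partial>lborel))"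
    have nonneg: "0 \<le> H * W 0 \<xi>" if "\<And>\<xi>. cmod (b \<xi>) \<le> H * W 0 \<xi>" for b :: "real \<Rightarrow> complex" and H \<xi>
      using order_trans[OF norm_ge_zero that[of \<xi>]] .
    have zr: "smooth_zr T H b0 p0 r0"
      if "continuous_on UNIV b0" "\<And>\<xi>. cmod (b0 \<xi>) \<le> H * W 0 \<xi>"
        "continuous_on UNIV p0" "\<And>\<xi>. cmod (p0 \<xi>) \<le> H * W 0 \<xi>" "\<And>\<xi>. p0 (- \<xi>) = cnj (p0 \<xi>)"
        "continuous_on UNIV r0" "\<And>\<xi>. cmod (r0 \<xi>) \<le> H * W 0 \<xi>" "\<And>\<xi>. r0 (- \<xi>) = cnj (r0 \<xi>)" for H b0 p0 r0
      by unfold_locales (fact that)+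
    have wL2_0: "(\<integral>\<xi>. wL2 \<sigma> (\<lambda>_. 0) \<xi> \<partial>lborel) = 0" for \<sigma>
      by (simp add: wL2_def)
    from nondegenerate show False
    proof
      \<comment> \<open>Data with \<open>r0 = 0\<close> leave only the first wave in the
        second-order term, so the exponent of the other component does not enter the test.\<close>
      assume nd: "l < - 1 / 2 \<and> \<gamma> * (sqrt \<beta> - \<nu> / 2) \<noteq> 0"
      show False
      proof (rule no_quad_bound[of k \<omega> v1 a1 C l])
        fix b g H t \<phi>
        assume b: "continuous_on UNIV b" "\<And>\<xi>. cmod (b \<xi>) \<le> H * W 0 \<xi>"
          and g: "continuous_on UNIV g" "\<And>\<xi>. cmod (g \<xi>) \<le> H * W 0 \<xi>" "\<And>\<xi>. g (- \<xi>) = cnj (g \<xi>)"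
          and t: "t \<in> {0..T}" "integrable lborel \<phi>" "integrable lborel (wL2 (- k) \<phi>)"
        have z: "smooth_zr T H b g (\<lambda>_. 0)"
          by (rule zr) (simp_all add: b g nonneg[OF b(2)])
        interpret Z: smooth_zr T \<omega> v1 v2 a1 a2 p c1 c2 H b g "\<lambda>_. 0" by (rule z)
        have "Z.potential_lin = (\<lambda>t \<xi>. of_real a1 * free (\<lambda>\<xi>. v1 * \<xi>) g t \<xi>)"
          by (intro ext) (simp add: Z.potential_lin_def free_def)
        then have "Z.quad t = bilin \<omega> v1 a1 b g t"
          by (intro ext) (simp add: Z.quad_def bilin_def)
        then show "cmod (\<integral>\<xi>. bilin \<omega> v1 a1 b g t \<xi> * \<phi> \<xi> \<partial>lborel) \<le> C * sqrt (\<integral>\<xi>. wL2 (- k) \<phi> \<xi> \<partial>lborel) *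
            ((\<integral>\<xi>. wL2 k b \<xi> \<partial>lborel) + (\<integral>\<xi>. wL2 l g \<xi> \<partial>lborel))"
          using C[OF z t] by (simp add: wL2_0)
      qed (use nd \<open>T > 0\<close> in \<open>simp_all add: a1_def\<close>)
    next
      \<comment> \<open>The same test with \<open>p0 = 0\<close>; the sign in \<open>a2\<close> is
        harmless because the estimate involves only its absolute value.\<close>
      assume nd: "s < - 1 / 2 \<and> \<gamma> * (sqrt \<beta> + \<nu> / 2) \<noteq> 0"
      show False
      proof (rule no_quad_bound[of k \<omega> v2 a2 C s])
        fix b g H t \<phi>
        assume b: "continuous_on UNIV b" "\<And>\<xi>. cmod (b \<xi>) \<le> H * W 0 \<xi>"
          and g: "continuous_on UNIV g" "\<And>\<xi>. cmod (g \<xi>) \<le> H * W 0 \<xi>" "\<And>\<xi>. g (- \<xi>) = cnj (g \<xi>)"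
          and t: "t \<in> {0..T}" "integrable lborel \<phi>" "integrable lborel (wL2 (- k) \<phi>)"
        have z: "smooth_zr T H b (\<lambda>_. 0) g"
          by (rule zr) (simp_all add: b g nonneg[OF b(2)])
        interpret Z: smooth_zr T \<omega> v1 v2 a1 a2 p c1 c2 H b "\<lambda>_. 0" g by (rule z)
        have "Z.potential_lin = (\<lambda>t \<xi>. of_real a2 * free (\<lambda>\<xi>. v2 * \<xi>) g t \<xi>)"
          by (intro ext) (simp add: Z.potential_lin_def free_def)
        then have "Z.quad t = bilin \<omega> v2 a2 b g t"
          by (intro ext) (simp add: Z.quad_def bilin_def)
        then show "cmod (\<integral>\<xi>. bilin \<omega> v2 a2 b g t \<xi> * \<phi> \<xi> \<partial>lborel) \<le> C * sqrt (\<integral>\<xi>. wL2 (- k) \<phi> \<xi> \<partial>lborel) *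
            ((\<integral>\<xi>. wL2 k b \<xi> \<partial>lborel) + (\<integral>\<xi>. wL2 s g \<xi> \<partial>lborel))"
          using C[OF z t] by (simp add: wL2_0)
      qed (use nd \<open>T > 0\<close> in \<open>simp_all add: a2_def\<close>)
    qed
  qed
qed

end
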